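(* Let $k \geq 12$ be an integer with $k \equiv 0 \pmod{4}$. Then \[ \frac{(k-1)^{2}}{16 \pi^{2}} < A(k) \leq \frac{1}{7316} k^{4} (\log k + \log \log k)^{2}. \]
   Context: $M_k$ denotes the complex vector space of holomorphic modular forms of weight $k$ for $\mathrm{SL}_2(\mathbb{Z})$, with Fourier expansions $f(z)=\sum_{n\ge 0} a(n)q^n$, $q=e^{2\pi i z}$. For $f \in M_k$ with real coefficients, $\mathcal{N}(f)$ is the smallest integer $r\ge 0$ with $a(r)<0$ if such $r$ exists, and $\mathcal{N}(f)=\infty$ otherwise. For $k \equiv 0 \pmod 4$, $A(k) = \max\{\mathcal{N}(f) : f \in M_k,\ \mathcal{N}(f)<\infty\}$; equivalently, $A(k)$ is the least integer such that whenever the coefficients $a(1),\dots,a(A(k))$ of a form $f = 1+\sum_{n\ge1}a(n)q^n \in M_k$ are nonnegative, all coefficients of $f$ are nonnegative, and this maximum exists. *)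

theory Defs
  imports "HOL-Analysis.Analysis"
begin

definition upper_half :: "complex set" where
  "upper_half = {z. Im z > 0}"

definition has_q_expansion :: "(complex \<Rightarrow> complex) \<Rightarrow> (nat \<Rightarrow> complex) \<Rightarrow> bool" where
  "has_q_expansion f a \<longleftrightarrow>
     (\<forall>z\<in>upper_half. (\<lambda>n. a n * exp (2 * of_real pi * \<i> * of_nat n * z)) sums f z)"

text \<open>Holomorphic modular forms of weight k for SL_2(Z): holomorphic on H, invariant under
  the generators T and S with weight k, and holomorphic at the cusp (q-expansion with n >= 0).\<close>
definition modular_form :: "nat \<Rightarrow> (complex \<Rightarrow> complex) \<Rightarrow> bool" where
  "modular_form k f \<longleftrightarrow>
     f holomorphic_on upper_half \<and>
     (\<forall>z\<in>upper_half. f (z + 1) = f z) \<and>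
     (\<forall>z\<in>upper_half. f (- 1 / z) = z ^ k * f z) \<and>
     (\<exists>a. has_q_expansion f a)"

definition N_values :: "nat \<Rightarrow> nat set" where
  "N_values k = {r. \<exists>f a. modular_form k f \<and> has_q_expansion f a \<and> (\<forall>n. a n \<in> \<real>) \<and>
                     Re (a r) < 0 \<and> (\<forall>m<r. Re (a m) \<ge> 0)}"

definition A :: "nat \<Rightarrow> nat" where
  "A k = Max (N_values k)"

end

theory Submission
  imports Defs "HOL-Complex_Analysis.Complex_Analysis" "HOL-Real_Asymp.Real_Asymp"
begin

text \<open>
  Write $f$ for a form of weight $k$ with real coefficients $a(n)$. Since $4 \mid k$, the inversion
  gives $f(i/Y) = Y^k f(iY)$, that is $\sum_n a(n) w_n = 0$ with
  $w_n = e^{-2\pi n/Y} - Y^k e^{-2\pi n Y}$. For $Y$ slightly smaller than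
  $\frac{k}{2\pi}(\log k + \log\log k)$ all $w_n$ with $n \ge 1$ are positive, whereas $w_0 = 1 - Y^k$.

  Lower bound: by this relation every nonzero cusp form with real coefficients has a negative
  coefficient. The first Poincare series is a cusp form whose $n$-th coefficient is dominated by its
  $J_{k-1}(4\pi\sqrt n)$ term, hence positive as long as $4\pi\sqrt n \le k - 1$.

  Upper bound: if $a(n) \ge 0$ for $n < r$, apply the relation to the cusp form
  $g = f - a(0) E_k = \sum_n b(n) q^n$. Its coefficients satisfy $b(n) \ge - a(0) e(n)$ for $n < r$, where
  $e(n)$ are the coefficients of $E_k$, so $S = \sum_n |b(n)| w_n$ is at most about $2 a(0) Y^k$.
  In turn $S$ bounds $y^{k/2} |g|$ on $\mathrm{Im}\, z \ge 1/2$, hence on the whole half-plane, which gives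
  $|b(n)| \le D S n^{k/2}$. As $e(n)$ is of size $n^{k-1}$, the coefficient $a(r)$ cannot be negative for
  large $r$.
\<close>

section \<open>Lipschitz formula\<close>

text \<open>For n >= r nothing is known about the signs of b(n), and the bound |b(n)| <= D S n^(k/2)
  itself contains S. There is no circle: the weights decay like e^(-2 pi n / Y) with Y of order k
  log k, whereas r is at least of order k^4, so the terms from r on contribute at most S / 10 to S
  and are absorbed. Hence S <= (20/9) a(0) Y^k. With h = k/2, a negative a(r) then needs D Y^k r^h
  to exceed, up to a constant, the size (2 pi)^k r^(k-1) / (k-1)! of e(r). As Y is about k L / (2
  pi) with L = log k + log log k, and (k-1)! about (k/e)^k, this bounds r^(h-1) by roughly (k^2 L /
  (4 pi^2 e))^k, hence r by roughly k^4 L^2 / (4 pi^2 e)^2. That denominator is about 11516; the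
  smaller 7316 pays for the exponent h - 1 in place of h, down to k = 12. E_k is the Poincare series
  with m = 0, so one Fourier expansion serves both bounds.\<close>

definition cexp :: "complex \<Rightarrow> complex" where
  "cexp z = exp (2 * of_real pi * \<i> * z)"

lemma cexp_add: "cexp (z + w) = cexp z * cexp w"
  by (simp add: cexp_def distrib_left exp_add)

lemma cexp_of_int [simp]: "cexp (of_int n) = 1"
  using exp_eq_1 unfolding cexp_def by (force simp: mult_ac)

lemma cexp_mult_int [simp]: "cexp (of_int a * of_int b) = 1"
  using cexp_of_int[of "a * b"] by simp

lemma norm_cexp: "norm (cexp z) = exp (- 2 * pi * Im z)"
  by (simp add: cexp_def)

lemma cexp_power: "cexp z ^ n = cexp (of_nat n * z)"
  by (simp add: cexp_def exp_of_nat_mult[symmetric] mult_ac)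

lemma norm_cexp_less_1: "z \<in> upper_half \<Longrightarrow> norm (cexp z) < 1"
  by (simp add: norm_cexp upper_half_def)

lemma cexp_has_field_derivative [derivative_intros]:
  "(cexp has_field_derivative (2 * of_real pi * \<i> * cexp z)) (at z)"
  unfolding cexp_def [abs_def] by (auto intro!: derivative_eq_intros)

lemma open_upper_half: "open upper_half"
  unfolding upper_half_def by (rule open_halfspace_Im_gt)

lemma upper_half_not_Int: "z \<in> upper_half \<Longrightarrow> z \<notin> \<int>"
  by (auto simp: upper_half_def elim!: Ints_cases)

lemma upper_half_not_nonpos_Int: "z \<in> upper_half \<Longrightarrow> z \<notin> \<int>\<^sub>\<le>\<^sub>0" "z \<in> upper_half \<Longrightarrow> 1 - z \<notin> \<int>\<^sub>\<le>\<^sub>0"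
  using upper_half_not_Int[of z] by (auto elim!: nonpos_Ints_cases simp: diff_eq_eq)
    (metis Ints_1 Ints_diff Ints_of_int add_diff_cancel_left')

text \<open>Logarithmic derivative of Gamma(z) Gamma(1 - z) = pi / sin(pi z): the difference is -pi
  cot(pi z), and the cotangent is a geometric series in \<open>cexp z\<close>. This is the seed that
  \<open>lipschitz_formula\<close> differentiates.\<close>

lemma digamma_reflection:
  assumes z: "z \<in> upper_half"
  shows "Digamma z - Digamma (1 - z) = of_real pi * \<i> * (1 + 2 * (\<Sum>n. cexp z ^ Suc n))"
proof -
  define w where "w = of_real pi * z"
  have np: "z \<notin> \<int>\<^sub>\<le>\<^sub>0" "1 - z \<notin> \<int>\<^sub>\<le>\<^sub>0" and nI: "z \<notin> \<int>"
    using upper_half_not_nonpos_Int[OF z] upper_half_not_Int[OF z] by auto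
  have sn: "sin w \<noteq> 0"
  proof
    assume "sin w = 0"
    then obtain n :: int where "w = of_real (of_int n * pi)" by (auto simp: sin_eq_0)
    hence "z = of_int n" by (simp add: w_def)
    thus False using nI by simp
  qed
  have G: "Gamma z * Gamma (1 - z) = of_real pi / sin w"
    using Gamma_reflection_complex[of z] by (simp add: w_def)
  have d1: "((\<lambda>x. Gamma x * Gamma (1 - x)) has_field_derivative
      (Gamma z * Gamma (1 - z) * (Digamma z - Digamma (1 - z)))) (at z)"
    using np by (auto intro!: derivative_eq_intros simp: algebra_simps)
  have d2: "((\<lambda>x. of_real pi / sin (of_real pi * x)) has_field_derivative
      (of_real pi / sin w * (- of_real pi * cos w / sin w))) (at z)"
    using sn unfolding w_def
    by (auto intro!: derivative_eq_intros simp: field_simps power2_eq_square)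
  have "Gamma z * Gamma (1 - z) * (Digamma z - Digamma (1 - z)) =
      of_real pi / sin w * (- of_real pi * cos w / sin w)"
    by (rule DERIV_unique[OF d1]) (use d2 in \<open>simp add: Gamma_reflection_complex w_def\<close>)
  hence 1: "Digamma z - Digamma (1 - z) = - of_real pi * cos w / sin w"
    unfolding G using sn by (metis (no_types, opaque_lifting) divide_eq_0_iff mult_left_cancel of_real_eq_0_iff pi_neq_zero)
  have qn: "norm (cexp z) < 1" by (rule norm_cexp_less_1[OF z])
  hence q1: "cexp z \<noteq> 1" by auto
  have e2: "cexp z = exp (\<i> * w) ^ 2"
    by (simp add: cexp_def w_def power2_eq_square exp_add[symmetric] mult_ac)
  have "exp (\<i> * w) * cos w * 2 = cexp z + 1"
    by (simp add: e2 cos_exp_eq field_simps power2_eq_square exp_minus)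
  moreover have "exp (\<i> * w) * sin w * (2 * \<i>) = cexp z - 1"
    by (simp add: e2 sin_exp_eq field_simps power2_eq_square exp_minus)
  ultimately have "cos w / sin w = \<i> * (cexp z + 1) / (cexp z - 1)"
  proof -
    assume c: "exp (\<i> * w) * cos w * 2 = cexp z + 1" and s: "exp (\<i> * w) * sin w * (2 * \<i>) = cexp z - 1"
    show ?thesis
      unfolding c[symmetric] s[symmetric] using sn by (simp add: field_simps)
  qed
  hence 2: "- of_real pi * cos w / sin w = of_real pi * \<i> * ((1 + cexp z) / (1 - cexp z))"
  proof -
    assume h: "cos w / sin w = \<i> * (cexp z + 1) / (cexp z - 1)"
    have "- of_real pi * cos w / sin w = - of_real pi * (cos w / sin w)" by simp
    also have "\<dots> = of_real pi * \<i> * ((1 + cexp z) / (1 - cexp z))"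
      unfolding h using q1 by (simp add: divide_simps) (simp add: algebra_simps)
    finally show ?thesis .
  qed
  have "(\<lambda>n. cexp z * cexp z ^ n) sums (cexp z * (1 / (1 - cexp z)))"
    by (intro sums_mult geometric_sums qn)
  hence "(\<Sum>n. cexp z ^ Suc n) = cexp z / (1 - cexp z)"
    by (simp add: sums_iff)
  hence "1 + 2 * (\<Sum>n. cexp z ^ Suc n) = 1 + 2 * (cexp z / (1 - cexp z))"
    by (simp only:)
  also have "\<dots> = (1 + cexp z) / (1 - cexp z)"
    using q1 by (simp add: field_simps)
  finally have "1 + 2 * (\<Sum>n. cexp z ^ Suc n) = (1 + cexp z) / (1 - cexp z)" .
  with 1 2 show ?thesis by simp
qed

lemma summable_power_mult_cexp:
  assumes z: "z \<in> upper_half"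
  shows "summable (\<lambda>n. norm (of_nat n ^ m * cexp z ^ n))"
proof -
  define x where "x = norm (cexp z)"
  have x: "0 < x" "x < 1" using norm_cexp_less_1[OF z] by (auto simp: x_def norm_cexp)
  obtain r where r: "x < r" "r < 1" using dense[OF x(2)] by auto
  have "eventually (\<lambda>n. real n ^ m * x ^ n \<le> r ^ n) at_top"
    using x r by real_asymp
  hence "eventually (\<lambda>n. norm (norm (of_nat n ^ m * cexp z ^ n)) \<le> r ^ n) at_top"
    by eventually_elim (simp add: norm_mult norm_power x_def)
  thus ?thesis
    by (rule summable_comparison_test_ev) (use r x in \<open>auto intro!: summable_geometric\<close>)
qed

lemma sum_power_mult_has_derivative:
  assumes z: "z \<in> upper_half"
  shows "((\<lambda>z. \<Sum>n. of_nat (Suc n) ^ m * cexp z ^ Suc n) has_field_derivative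
          (2 * of_real pi * \<i> * (\<Sum>n. of_nat (Suc n) ^ Suc m * cexp z ^ Suc n))) (at z)"
proof -
  \<comment> \<open>The \<open>if\<close> removes the constant term: for m = 0 the convention 0^0 =
    1 would otherwise add 1 to a series that starts at n = 1.\<close>
  define c where "c = (\<lambda>n. of_nat n ^ m * (if n = 0 then 0 else 1) :: complex)"
  have geo: "summable (\<lambda>n. c n * x ^ n)" if "norm x < 1" for x
  proof (cases "x = 0")
    case True
    thus ?thesis by (intro summable_finite[of "{0}"]) (auto simp: power_0_left)
  next
    case False
    define w where "w = ln x / (2 * of_real pi * \<i>)"
    have cw: "cexp w = x" using False by (simp add: w_def cexp_def)
    have "Im w > 0"
      using that norm_cexp[of w] unfolding cw by (simp add: zero_less_mult_iff mult_less_0_iff)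
    hence "w \<in> upper_half" by (simp add: upper_half_def)
    from summable_power_mult_cexp[OF this, of m] cw
    have "summable (\<lambda>n. norm (of_nat n ^ m * x ^ n))" by simp
    thus ?thesis
      by (rule summable_comparison_test'[of _ 0])
        (auto simp: c_def norm_mult)
  qed
  define G where "G = (\<lambda>q. \<Sum>n. c n * q ^ n)"
  have G: "(\<Sum>n. of_nat (Suc n) ^ m * cexp w ^ Suc n) = G (cexp w)" if "w \<in> upper_half" for w
    unfolding G_def
    using suminf_split_head[OF geo[OF norm_cexp_less_1[OF that]]] by (simp add: c_def)
  have dG: "(G has_field_derivative (\<Sum>n. diffs c n * q ^ n)) (at q)" if q: "norm q < 1" for q
  proof -
    obtain r where r: "norm q < r" "r < 1" using dense[OF q] by auto
    have "0 < r" using r(1) norm_ge_zero[of q] by linarith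
    show ?thesis unfolding G_def
      by (rule termdiffs_strong[of _ "of_real r"]) (use r \<open>0 < r\<close> geo in auto)
  qed
  have "((\<lambda>w. G (cexp w)) has_field_derivative
      ((\<Sum>n. diffs c n * cexp z ^ n) * (2 * of_real pi * \<i> * cexp z))) (at z)"
    by (rule DERIV_chain2[OF dG[OF norm_cexp_less_1[OF z]] cexp_has_field_derivative])
  hence "((\<lambda>z. \<Sum>n. of_nat (Suc n) ^ m * cexp z ^ Suc n) has_field_derivative
      ((\<Sum>n. diffs c n * cexp z ^ n) * (2 * of_real pi * \<i> * cexp z))) (at z)"
    by (rule has_field_derivative_transform_within_open[OF _ open_upper_half z])
      (rule G[symmetric])
  moreover have "(\<Sum>n. of_nat (Suc n) ^ Suc m * cexp z ^ Suc n) = (\<Sum>n. diffs c n * cexp z ^ n) * cexp z"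
  proof -
    have "summable (\<lambda>n. of_nat n ^ Suc m * cexp z ^ n)"
      using summable_norm_cancel[OF summable_power_mult_cexp[OF z]] .
    hence "summable (\<lambda>n. of_nat (Suc n) ^ Suc m * cexp z ^ Suc n)"
      by (subst summable_Suc_iff[of "\<lambda>n. of_nat n ^ Suc m * cexp z ^ n"])
    hence "summable (\<lambda>n. cexp z * (diffs c n * cexp z ^ n))"
      by (simp add: diffs_def c_def mult_ac)
    hence "summable (\<lambda>n. diffs c n * cexp z ^ n)"
      by (subst (asm) summable_cmult_iff) (auto simp: cexp_def)
    from suminf_mult2[OF this, of "cexp z"] show ?thesis
      by (simp add: diffs_def c_def mult_ac)
  qed
  ultimately show ?thesis by (simp add: mult_ac)
qed

lemma summable_inverse_square_int: "(\<lambda>j::int. 1 / (1 + \<bar>real_of_int j\<bar>) ^ 2) summable_on UNIV"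
proof -
  have "summable (\<lambda>n. 1 / (1 + real n) ^ 2)"
    using inverse_squares_sums by (simp add: sums_iff add.commute)
  hence nat: "(\<lambda>n. 1 / (1 + real n) ^ 2) summable_on UNIV"
    by (rule summable_nonneg_imp_summable_on) auto
  have "(\<lambda>j::int. 1 / (1 + \<bar>real_of_int j\<bar>) ^ 2) summable_on range int"
    by (subst summable_on_reindex) (use nat in \<open>auto simp: o_def\<close>)
  moreover have "(\<lambda>j::int. 1 / (1 + \<bar>real_of_int j\<bar>) ^ 2) summable_on range (\<lambda>n. - int n)"
    by (subst summable_on_reindex) (use nat in \<open>auto simp: o_def inj_on_def\<close>)
  moreover have "UNIV = range int \<union> range (\<lambda>n. - int n)"
  proof -
    have "j \<in> range int \<union> range (\<lambda>n. - int n)" for j by (cases j rule: int_cases2) auto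
    thus ?thesis by blast
  qed
  ultimately show ?thesis using summable_on_union[of _ "range int" "range (\<lambda>n. - int n)"] by simp
qed

text \<open>|c| Im z is at most |cz + d|, and d = (cz + d) - cz. Bounding both |c| and |d| by the
  same norm lets its fourth power dominate (1 + |c|)^2 (1 + |d|)^2, so double sums over (c, d) of
  weight at least 4 converge.\<close>

lemma lattice_lower_bound:
  assumes z: "z \<in> upper_half"
  obtains K where "K > 0"
    and "\<And>c d :: int. (c, d) \<noteq> (0, 0) \<Longrightarrow> 1 + \<bar>real_of_int c\<bar> \<le> K * norm (of_int c * z + of_int d)"
    and "\<And>c d :: int. (c, d) \<noteq> (0, 0) \<Longrightarrow> 1 + \<bar>real_of_int d\<bar> \<le> K * norm (of_int c * z + of_int d)"
proof -
  define y where "y = Im z"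
  have y: "y > 0" using z by (simp add: y_def upper_half_def)
  define K where "K = 1 + (1 + norm z) / y"
  have K: "K \<ge> 1" "K * y \<ge> 1 + norm z" using y by (auto simp: K_def field_simps)
  have *: "\<bar>real_of_int c\<bar> \<le> K * norm (of_int c * z + of_int d) \<and>
      \<bar>real_of_int d\<bar> \<le> K * norm (of_int c * z + of_int d)" for c d
  proof -
    let ?N = "norm (of_int c * z + of_int d)"
    have 1: "\<bar>real_of_int c\<bar> * y \<le> ?N"
      using abs_Im_le_cmod[of "of_int c * z + of_int d"] y by (simp add: y_def abs_mult)
    have "\<bar>real_of_int c\<bar> = \<bar>real_of_int c\<bar> * y / y" using y by simp
    also have "\<dots> \<le> ?N / y" by (intro divide_right_mono 1) (use y in auto)
    finally have 2: "\<bar>real_of_int c\<bar> \<le> ?N / y" .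
    also have "\<dots> \<le> K * ?N"
      using y mult_right_mono[of "1 / y" K ?N] by (simp add: K_def field_simps add_nonneg_nonneg)
    finally have 3: "\<bar>real_of_int c\<bar> \<le> K * ?N" .
    have "\<bar>real_of_int d\<bar> = norm ((of_int c * z + of_int d) - of_int c * z)" by simp
    also have "\<dots> \<le> ?N + \<bar>real_of_int c\<bar> * norm z"
      by (rule order_trans[OF norm_triangle_ineq4]) (simp add: norm_mult)
    also have "\<dots> \<le> ?N + ?N / y * norm z" by (intro add_left_mono mult_right_mono 2) auto
    also have "\<dots> = (1 + norm z / y) * ?N" by (simp add: algebra_simps)
    also have "\<dots> \<le> K * ?N"
      using y by (intro mult_right_mono) (auto simp: K_def divide_right_mono)
    finally show ?thesis using 3 by blast
  qed
  have 1: "1 \<le> K * norm (of_int c * z + of_int d)" if "(c, d) \<noteq> (0, 0)" for c d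
  proof -
    have "\<bar>real_of_int c\<bar> \<ge> 1 \<or> \<bar>real_of_int d\<bar> \<ge> 1" using that by auto
    with *[of c d] show ?thesis by auto
  qed
  show ?thesis
  proof (rule that[of "2 * K"])
    show "2 * K > 0" using K by auto
  next
    fix c d :: int assume cd: "(c, d) \<noteq> (0, 0)"
    show "1 + \<bar>real_of_int c\<bar> \<le> 2 * K * norm (of_int c * z + of_int d)"
      using *[of c d] 1[OF cd] by (simp add: algebra_simps)
    show "1 + \<bar>real_of_int d\<bar> \<le> 2 * K * norm (of_int c * z + of_int d)"
      using *[of c d] 1[OF cd] by (simp add: algebra_simps)
  qed
qed

lemma summable_inverse_shift_power:
  assumes z: "z \<in> upper_half" and s: "s \<ge> 2"
  shows "(\<lambda>j. norm (inverse (z + of_int j) ^ s)) summable_on UNIV"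
proof -
  obtain K where K: "K > 0" "\<And>c d :: int. (c, d) \<noteq> (0, 0) \<Longrightarrow> 1 + \<bar>real_of_int d\<bar> \<le> K * norm (of_int c * z + of_int d)"
    using lattice_lower_bound[OF z] by metis
  have b: "1 + \<bar>real_of_int j\<bar> \<le> K * norm (z + of_int j)" for j
    using K(2)[of 1 j] by simp
  show ?thesis
  proof (rule Infinite_Sum.abs_summable_on_comparison_test'[OF summable_on_cmult_right[OF summable_inverse_square_int, of "K ^ s"]])
    fix j :: int
    have N: "norm (z + of_int j) > 0" using b[of j] K(1)
      by (smt (verit) mult_nonneg_nonpos norm_le_zero_iff mult_zero_right norm_zero zero_less_norm_iff)
    have "inverse (norm (z + of_int j)) \<le> K / (1 + \<bar>real_of_int j\<bar>)"
      using b[of j] N by (simp add: field_simps)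
    hence "inverse (norm (z + of_int j)) ^ s \<le> (K / (1 + \<bar>real_of_int j\<bar>)) ^ s"
      using N by (intro power_mono) auto
    also have "\<dots> = K ^ s * (1 / (1 + \<bar>real_of_int j\<bar>) ^ s)"
      by (simp add: power_divide)
    also have "\<dots> \<le> K ^ s * (1 / (1 + \<bar>real_of_int j\<bar>) ^ 2)"
      using K s by (intro mult_left_mono divide_left_mono power_increasing) auto
    finally show "norm (inverse (z + of_int j) ^ s) \<le> K ^ s * (1 / (1 + \<bar>real_of_int j\<bar>) ^ 2)"
      by (simp add: norm_power norm_inverse)
  qed
qed

text \<open>Split the integers at 0: j >= 0 gives the series of \<open>Polygamma m\<close> at z, and
  j = -n - 1 gives, up to sign, the one at 1 - z.\<close>

lemma inverse_shift_power_has_sum: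
  assumes z: "z \<in> upper_half" and m: "m > 0"
  shows "((\<lambda>j. inverse (z + of_int j) ^ Suc m) has_sum
    ((-1) ^ Suc m * (Polygamma m z - (-1) ^ m * Polygamma m (1 - z)) / fact m)) UNIV"
proof -
  let ?f = "\<lambda>j. inverse (z + of_int j) ^ Suc m"
  have sm: "?f summable_on A" for A
  proof -
    have "Suc m \<ge> 2" using m by simp
    from abs_summable_summable[OF summable_inverse_shift_power[OF z this]]
    show ?thesis by (rule summable_on_subset_banach) simp
  qed
  have z0: "z \<noteq> 0" "1 - z \<noteq> 0" using upper_half_not_Int[OF z] by auto
  have nn: "((\<lambda>n. ?f (int n)) has_sum ((-1) ^ Suc m * Polygamma m z / fact m)) UNIV"
  proof -
    have "(?f \<circ> int) summable_on UNIV"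
      using sm[of "range int"] by (subst (asm) summable_on_reindex) auto
    then obtain S where S: "((\<lambda>n. ?f (int n)) has_sum S) UNIV"
      by (auto simp: summable_on_def o_def)
    hence "(\<lambda>n. ?f (int n)) sums S" by (rule has_sum_imp_sums)
    moreover have "(\<lambda>n. ?f (int n)) sums ((-1) ^ Suc m * Polygamma m z / fact m)"
      using Polygamma_LIMSEQ[OF z0(1) m] by (simp add: power_inverse)
    ultimately have "S = (-1) ^ Suc m * Polygamma m z / fact m"
      by (rule sums_unique2)
    thus ?thesis using S by simp
  qed
  have neg: "((\<lambda>n. ?f (- int n - 1)) has_sum (Polygamma m (1 - z) / fact m)) UNIV"
  proof -
    have "(?f \<circ> (\<lambda>n. - int n - 1)) summable_on UNIV"
      using sm[of "range (\<lambda>n. - int n - 1)"] by (subst (asm) summable_on_reindex) (auto simp: inj_on_def)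
    then obtain S where S: "((\<lambda>n. ?f (- int n - 1)) has_sum S) UNIV"
      by (auto simp: summable_on_def o_def)
    hence "(\<lambda>n. ?f (- int n - 1)) sums S" by (rule has_sum_imp_sums)
    moreover have "(\<lambda>n. (-1) ^ Suc m * inverse ((1 - z + of_nat n) ^ Suc m)) sums
        ((-1) ^ Suc m * ((-1) ^ Suc m * Polygamma m (1 - z) / fact m))"
      by (intro sums_mult Polygamma_LIMSEQ z0 m)
    moreover have "(-1) ^ Suc m * inverse ((1 - z + of_nat n) ^ Suc m) = ?f (- int n - 1)" for n
    proof -
      have "inverse (z + of_int (- int n - 1)) = - inverse (1 - z + of_nat n)"
        by (subst inverse_minus_eq[symmetric]) (simp add: algebra_simps)
      thus ?thesis by (simp only: power_inverse power_minus[of "inverse _"])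
    qed
    moreover have "(-1) ^ Suc m * ((-1) ^ Suc m * Polygamma m (1 - z) / fact m) = Polygamma m (1 - z) / fact m"
      by (simp add: power_mult_distrib[symmetric] mult.assoc[symmetric])
    ultimately have "S = Polygamma m (1 - z) / fact m"
      by (simp only: sums_unique2)
    thus ?thesis using S by simp
  qed
  have "(?f has_sum ((-1) ^ Suc m * Polygamma m z / fact m + Polygamma m (1 - z) / fact m))
      (range int \<union> range (\<lambda>n. - int n - 1))"
  proof (rule has_sum_Un_disjoint)
    show "(?f has_sum ((-1) ^ Suc m * Polygamma m z / fact m)) (range int)"
      by (subst has_sum_reindex) (use nn in \<open>auto simp: o_def\<close>)
    show "(?f has_sum (Polygamma m (1 - z) / fact m)) (range (\<lambda>n. - int n - 1))"
      by (subst has_sum_reindex) (use neg in \<open>auto simp: o_def inj_on_def\<close>)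
  qed auto
  moreover have "range int \<union> range (\<lambda>n. - int n - 1) = UNIV"
  proof -
    have "j \<in> range int \<union> range (\<lambda>n. - int n - 1)" for j
    proof (cases "j \<ge> 0")
      case True
      hence "j = int (nat j)" by simp
      thus ?thesis by blast
    next
      case False
      hence "j = - int (nat (- j - 1)) - 1" by simp
      thus ?thesis by blast
    qed
    thus ?thesis by blast
  qed
  moreover have "(-1) ^ Suc m * Polygamma m z / fact m + Polygamma m (1 - z) / fact m =
     (-1) ^ Suc m * (Polygamma m z - (-1) ^ m * Polygamma m (1 - z)) / fact m"
  proof -
    have "(-1) ^ Suc m * (-1) ^ m = (-1 :: complex)"
      by (simp add: power_mult_distrib[symmetric])
    hence "(-1) ^ Suc m * (X - (-1) ^ m * Y) = (-1) ^ Suc m * X + Y" for X Y :: complex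
      by (simp only: right_diff_distrib mult.assoc[symmetric]) simp
    thus ?thesis by (simp only: add_divide_distrib)
  qed
  ultimately show ?thesis by (simp only:)
qed

text \<open>Differentiating the reflection formula raises the polygamma order on the left and brings
  down 2 pi i n on the right. The induction starts at m = 1, the first order at which the sum over j
  converges absolutely.\<close>

theorem lipschitz_formula:
  assumes z: "z \<in> upper_half" and s: "s \<ge> 2"
  shows "((\<lambda>j. inverse (z + of_int j) ^ s) has_sum
    ((- 2 * of_real pi * \<i>) ^ s / fact (s - 1) * (\<Sum>n. of_nat (Suc n) ^ (s - 1) * cexp z ^ Suc n))) UNIV"
proof -
  have *: "Polygamma m z - (-1) ^ m * Polygamma m (1 - z) =
      (2 * of_real pi * \<i>) ^ Suc m * (\<Sum>n. of_nat (Suc n) ^ m * cexp z ^ Suc n)"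
    if "m > 0" "z \<in> upper_half" for m z
    using that
  proof (induction m arbitrary: z rule: nat_induct_non_zero)
    case (1 z)
    have "((\<lambda>z. Digamma z - Digamma (1 - z)) has_field_derivative
        (Polygamma 1 z + Polygamma 1 (1 - z))) (at z)"
      using upper_half_not_nonpos_Int[OF 1] by (auto intro!: derivative_eq_intros)
    moreover have "((\<lambda>z. of_real pi * \<i> * (1 + 2 * (\<Sum>n. of_nat (Suc n) ^ 0 * cexp z ^ Suc n))) has_field_derivative
        (of_real pi * \<i> * (2 * (2 * of_real pi * \<i> * (\<Sum>n. of_nat (Suc n) ^ Suc 0 * cexp z ^ Suc n))))) (at z)"
      by (rule derivative_eq_intros sum_power_mult_has_derivative 1 refl | simp del: power_Suc)+
    hence "((\<lambda>z. Digamma z - Digamma (1 - z)) has_field_derivative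
        (of_real pi * \<i> * (2 * (2 * of_real pi * \<i> * (\<Sum>n. of_nat (Suc n) ^ Suc 0 * cexp z ^ Suc n))))) (at z)"
      by (rule has_field_derivative_transform_within_open[OF _ open_upper_half 1])
        (simp add: digamma_reflection del: power_Suc)
    ultimately have "Polygamma 1 z + Polygamma 1 (1 - z) =
        of_real pi * \<i> * (2 * (2 * of_real pi * \<i> * (\<Sum>n. of_nat (Suc n) ^ Suc 0 * cexp z ^ Suc n)))"
      by (rule DERIV_unique)
    moreover have "(2 * complex_of_real pi * \<i>) ^ Suc 1 * X = of_real pi * \<i> * (2 * (2 * of_real pi * \<i> * X))" for X
      by (simp add: power2_eq_square)
    ultimately show ?case by simp
  next
    case (Suc m z)
    have "((\<lambda>z. Polygamma m z - (-1) ^ m * Polygamma m (1 - z)) has_field_derivative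
        (Polygamma (Suc m) z - (-1) ^ Suc m * Polygamma (Suc m) (1 - z))) (at z)"
      using upper_half_not_nonpos_Int[OF Suc.prems] by (auto intro!: derivative_eq_intros)
    moreover have "((\<lambda>z. (2 * of_real pi * \<i>) ^ Suc m * (\<Sum>n. of_nat (Suc n) ^ m * cexp z ^ Suc n)) has_field_derivative
        ((2 * of_real pi * \<i>) ^ Suc m * (2 * of_real pi * \<i> * (\<Sum>n. of_nat (Suc n) ^ Suc m * cexp z ^ Suc n)))) (at z)"
      by (rule DERIV_cmult sum_power_mult_has_derivative Suc.prems)+
    hence "((\<lambda>z. Polygamma m z - (-1) ^ m * Polygamma m (1 - z)) has_field_derivative
        ((2 * of_real pi * \<i>) ^ Suc m * (2 * of_real pi * \<i> * (\<Sum>n. of_nat (Suc n) ^ Suc m * cexp z ^ Suc n)))) (at z)"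
      by (rule has_field_derivative_transform_within_open[OF _ open_upper_half Suc.prems])
        (simp add: Suc.IH del: power_Suc)
    ultimately have "Polygamma (Suc m) z - (-1) ^ Suc m * Polygamma (Suc m) (1 - z) =
        (2 * of_real pi * \<i>) ^ Suc m * (2 * of_real pi * \<i> * (\<Sum>n. of_nat (Suc n) ^ Suc m * cexp z ^ Suc n))"
      by (rule DERIV_unique)
    thus ?case by (simp only: power_Suc mult_ac)
  qed
  obtain m where m: "s = Suc m" "m > 0" using s by (cases s) auto
  have "(-1) ^ Suc m * ((2 * of_real pi * \<i>) ^ Suc m * X) = (- 2 * of_real pi * \<i>) ^ Suc m * X" for X :: complex
    by (simp only: mult.assoc[symmetric] power_mult_distrib[symmetric]) simp
  note this[of "\<Sum>n. of_nat (Suc n) ^ m * cexp z ^ Suc n"]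
  with inverse_shift_power_has_sum[OF z m(2)] *[OF m(2) z] show ?thesis
    unfolding m(1) diff_Suc_1 by (simp only: times_divide_eq_left)
qed

text \<open>For x > 0 this is x^(-v/2) J_v(2 sqrt x), an entire function of x: no square roots
  occur, and the Bessel argument 4 pi sqrt(m n) / c becomes x = 4 pi^2 m n / c^2.\<close>

definition bessel :: "nat \<Rightarrow> real \<Rightarrow> real" where
  "bessel v x = (\<Sum>l. (- x) ^ l / (fact l * fact (v + l)))"

lemma bessel_summable: "summable (\<lambda>l. norm ((- x) ^ l / (fact l * fact (v + l)) :: real))"
proof (rule summable_comparison_test'[OF summable_exp[of "\<bar>x\<bar>"]])
  fix l :: nat assume "l \<ge> 0"
  have "\<bar>x\<bar> ^ l / (fact l * fact (v + l)) \<le> \<bar>x\<bar> ^ l / (fact l * 1)"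
    by (intro divide_left_mono mult_left_mono fact_ge_1) auto
  thus "norm (norm ((- x) ^ l / (fact l * fact (v + l)))) \<le> inverse (fact l) * \<bar>x\<bar> ^ l"
    by (simp add: power_abs abs_mult field_simps)
qed

lemma bessel_sums: "(\<lambda>l. (- x) ^ l / (fact l * fact (v + l))) sums bessel v x"
  unfolding bessel_def by (rule summable_sums[OF summable_norm_cancel[OF bessel_summable]])

section \<open>Interchange of sums, and exponential sums over integer translates\<close>

lemma infsum_swap_complex:
  fixes f :: "'a \<times> 'b \<Rightarrow> complex"
  assumes s: "f summable_on (I \<times> J)"
    and 1: "\<And>x. x \<in> I \<Longrightarrow> ((\<lambda>y. f (x, y)) has_sum g x) J"
    and 2: "\<And>y. y \<in> J \<Longrightarrow> ((\<lambda>x. f (x, y)) has_sum h y) I"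
    and 3: "(g has_sum S) I"
  shows "(h has_sum S) J"
proof -
  have "(f has_sum S) (I \<times> J)"
    by (rule has_sum_SigmaI[OF 1 3 s])
  hence "((\<lambda>(x, y). f (y, x)) has_sum S) (J \<times> I)"
    by (subst (asm) has_sum_swap)
  from has_sum_SigmaD[OF this, of h] 2 show ?thesis by simp
qed

lemma summable_on_productI:
  fixes f :: "'a \<times> 'b \<Rightarrow> complex"
  assumes "\<And>x y. x \<in> I \<Longrightarrow> y \<in> J \<Longrightarrow> norm (f (x, y)) \<le> F x y"
    and "\<And>x. x \<in> I \<Longrightarrow> ((\<lambda>y. F x y) has_sum G x) J"
    and "\<And>x. x \<in> I \<Longrightarrow> G x \<le> H x"
    and "H summable_on I"
  shows "f summable_on (I \<times> J)"
proof -
  have F0: "0 \<le> F x y" if "x \<in> I" "y \<in> J" for x y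
    using assms(1)[OF that] norm_ge_zero order_trans by blast
  have G0: "0 \<le> G x" if "x \<in> I" for x
    by (rule has_sum_nonneg[OF assms(2)[OF that]]) (use F0 that in auto)
  have "G summable_on I"
    by (rule summable_on_comparison_test[OF assms(4) assms(3) G0])
  hence "(\<lambda>(x, y). F x y) summable_on (I \<times> J)"
    by (intro summable_on_SigmaI[where g = G]) (use assms(2) F0 in auto)
  hence "(\<lambda>p. norm (f p)) summable_on (I \<times> J)"
    by (rule Infinite_Sum.abs_summable_on_comparison_test') (use assms(1) in auto)
  thus ?thesis by (simp add: summable_on_iff_abs_summable_on_complex)
qed

lemma exp_has_sum: "((\<lambda>l. w ^ l / fact l) has_sum exp (w :: 'a :: {banach, real_normed_field})) UNIV"
proof (rule norm_summable_imp_has_sum)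
  show "summable (\<lambda>n. norm (w ^ n / fact n))"
    using summable_norm_exp[of w] by (simp add: divide_inverse norm_mult norm_power mult_ac norm_inverse scaleR_conv_of_real)
  show "(\<lambda>l. w ^ l / fact l) sums exp w"
    using exp_converges[of w] by (simp add: scaleR_conv_of_real divide_inverse mult_ac)
qed

text \<open>\<open>bessel\<close> with all signs made positive, that is x^(-v/2) I_v(2 sqrt x) for x
  > 0; the majorant behind the interchanges of sums.\<close>

definition iexp :: "nat \<Rightarrow> real \<Rightarrow> real" where
  "iexp v x = (\<Sum>l. x ^ l / (fact l * fact (v + l)))"

lemma iexp_has_sum:
  assumes "x \<ge> 0"
  shows "((\<lambda>l. x ^ l / (fact l * fact (v + l))) has_sum iexp v x) UNIV"
proof (rule sums_nonneg_imp_has_sum)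
  show "(\<lambda>l. x ^ l / (fact l * fact (v + l))) sums iexp v x"
    using bessel_sums[of "- x" v] by (simp add: bessel_def iexp_def)
qed (use assms in auto)

lemma iexp_nonneg: "x \<ge> 0 \<Longrightarrow> iexp v x \<ge> 0"
  by (rule has_sum_nonneg[OF iexp_has_sum]) auto

lemma iexp_mono: "0 \<le> x \<Longrightarrow> x \<le> y \<Longrightarrow> iexp v x \<le> iexp v y"
  by (rule has_sum_mono[OF iexp_has_sum iexp_has_sum]) (auto intro!: divide_right_mono power_mono)

lemma abs_bessel_le: "\<bar>bessel v x\<bar> \<le> iexp v \<bar>x\<bar>"
proof -
  have "norm (bessel v x) \<le> (\<Sum>l. norm ((- x) ^ l / (fact l * fact (v + l)) :: real))"
    unfolding bessel_def by (rule summable_norm[OF bessel_summable])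
  thus ?thesis by (simp add: iexp_def power_abs abs_mult)
qed

text \<open>Splitting $x^l = (\varepsilon n)^l (t/\varepsilon)^l$ shows that the series grows slower than any exponential.\<close>
lemma iexp_le_exp:
  assumes t: "t \<ge> 0" and e: "e > 0"
  shows "iexp v (t * real n) \<le> exp (t / e) * exp (e * real n)"
proof (rule has_sum_mono[OF iexp_has_sum has_sum_cmult_right[OF exp_has_sum]])
  show "t * real n \<ge> 0" using t by simp
  fix l :: nat
  have "(t / e) ^ l / fact l \<le> exp (t / e)"
    by (rule has_sum_mono2[OF has_sum_finite[of "{l}" "\<lambda>l. (t / e) ^ l / fact l"] exp_has_sum, simplified])
      (use t e in auto)
  moreover have "fact l \<le> (fact (v + l) :: real)" by (rule fact_mono) simp
  hence "(t / e) ^ l / fact (v + l) \<le> (t / e) ^ l / fact l"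
    using t e by (intro divide_left_mono) auto
  ultimately have "(t / e) ^ l / fact (v + l) \<le> exp (t / e)" by linarith
  hence "(t / e) ^ l / fact (v + l) * ((e * real n) ^ l / fact l) \<le> exp (t / e) * ((e * real n) ^ l / fact l)"
    by (intro mult_right_mono) (use e in auto)
  moreover have "(t / e) ^ l / fact (v + l) * ((e * real n) ^ l / fact l) = (t * real n) ^ l / (fact l * fact (v + l))"
    using e by (simp add: power_mult_distrib power_divide)
  ultimately show "(t * real n) ^ l / (fact l * fact (v + l)) \<le> exp (t / e) * ((e * real n) ^ l / fact l)"
    by simp
qed

lemma summable_iexp_cexp:
  assumes z: "z \<in> upper_half" and t: "t \<ge> 0"
  shows "(\<lambda>n. real n ^ m * iexp v (t * real n) * norm (cexp (of_nat n * z))) summable_on UNIV"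
proof -
  define y where "y = Im z"
  have y: "y > 0" using z by (simp add: y_def upper_half_def)
  \<comment> \<open>Half of the decay of \<open>cexp (of_nat n * z)\<close> pays for the factor
    exp(pi y n) coming from \<open>iexp_le_exp\<close>; the point at half the height carries the
    other half.\<close>
  define w where "w = \<i> * of_real (y / 2)"
  have w: "w \<in> upper_half" using y by (simp add: w_def upper_half_def)
  have "(\<lambda>n. norm (of_nat n ^ m * cexp w ^ n)) summable_on UNIV"
    by (intro summable_nonneg_imp_summable_on summable_power_mult_cexp w) auto
  hence s: "(\<lambda>n. exp (t / (pi * y)) * norm (of_nat n ^ m * cexp w ^ n)) summable_on UNIV"
    by (rule summable_on_cmult_right)
  show ?thesis
  proof (rule summable_on_comparison_test[OF s])
    fix n :: nat
    have "iexp v (t * real n) \<le> exp (t / (pi * y)) * exp (pi * y * real n)"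
      using y t by (intro iexp_le_exp) auto
    hence "real n ^ m * iexp v (t * real n) * norm (cexp (of_nat n * z)) \<le>
       real n ^ m * (exp (t / (pi * y)) * exp (pi * y * real n)) * norm (cexp (of_nat n * z))"
      by (intro mult_right_mono mult_left_mono) auto
    also have "\<dots> = exp (t / (pi * y)) * norm (of_nat n ^ m * cexp w ^ n)"
    proof -
      have "norm (cexp w ^ n) = exp (pi * y * real n) * norm (cexp (of_nat n * z))"
        by (simp add: cexp_power norm_cexp w_def y_def exp_add[symmetric])
      thus ?thesis by (simp only: norm_mult norm_power norm_of_nat mult_ac)
    qed
    finally show "real n ^ m * iexp v (t * real n) * norm (cexp (of_nat n * z)) \<le>
      exp (t / (pi * y)) * norm (of_nat n ^ m * cexp w ^ n)" .
  qed (use t iexp_nonneg in auto)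
qed

text \<open>Expand the exponential in powers of 1 / (z + j), apply \<open>lipschitz_formula\<close>
  with exponent k + l to each power, and resum over l: the factors (-2 pi i)^(2 l) produce the
  alternating signs of the Bessel series.\<close>

theorem horocycle_expansion:
  assumes z: "z \<in> upper_half" and k: "k \<ge> 2" and t: "t \<ge> 0"
  shows "((\<lambda>j. inverse (z + of_int j) ^ k * cexp (- of_real t * inverse (z + of_int j))) has_sum
     (\<Sum>\<^sub>\<infinity>n. (- 2 * of_real pi * \<i>) ^ k * of_nat n ^ (k - 1) *
        of_real (bessel (k - 1) (4 * pi\<^sup>2 * t * real n)) * cexp (of_nat n * z))) UNIV"
    (is "(?lhs has_sum _) UNIV")
proof -
  define C where "C = - 2 * of_real pi * \<i>"
  define w where "w = (\<lambda>j. inverse (z + of_int j))"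
  define y where "y = Im z"
  have y: "y > 0" using z by (simp add: y_def upper_half_def)
  have wy: "norm (w j) \<le> 1 / y" for j
  proof -
    have "y \<le> norm (z + of_int j)" using abs_Im_le_cmod[of "z + of_int j"] y by (simp add: y_def)
    thus ?thesis using y by (simp add: w_def norm_inverse inverse_eq_divide norm_divide divide_left_mono frac_le)
  qed
  define f where "f = (\<lambda>(j, l). w j ^ k * ((C * of_real t * w j) ^ l / fact l))"
  \<comment> \<open>For fixed l, both double series \<open>f\<close> (over j and l) and
    \<open>h\<close> (over n and l) sum to \<open>L l\<close>. So summing \<open>L\<close> over l
    yields the left side by the first and the right side by the second.\<close>
  define L where "L = (\<lambda>l. (C * of_real t) ^ l / fact l * (C ^ (k + l) / fact (k + l - 1) *
      (\<Sum>n. of_nat (Suc n) ^ (k + l - 1) * cexp z ^ Suc n)))"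
  have f_row: "((\<lambda>l. f (j, l)) has_sum ?lhs j) UNIV" for j
  proof -
    have "((\<lambda>l. w j ^ k * ((C * of_real t * w j) ^ l / fact l)) has_sum (w j ^ k * exp (C * of_real t * w j))) UNIV"
      by (intro has_sum_cmult_right exp_has_sum)
    moreover have "w j ^ k * exp (C * of_real t * w j) = ?lhs j"
      by (simp add: w_def cexp_def C_def mult_ac)
    ultimately show ?thesis by (simp add: f_def)
  qed
  have f_col: "((\<lambda>j. f (j, l)) has_sum L l) UNIV" for l
  proof -
    have "((\<lambda>j. (C * of_real t) ^ l / fact l * w j ^ (k + l)) has_sum L l) UNIV"
      unfolding L_def w_def C_def by (intro has_sum_cmult_right lipschitz_formula z) (use k in auto)
    thus ?thesis by (simp add: f_def power_mult_distrib power_add mult_ac)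
  qed
  \<comment> \<open>The bound |w j| <= 1 / y makes the exponential series bounded uniformly in j,
    which leaves the convergent sum of |w j|^k.\<close>
  have f_sum: "f summable_on (UNIV \<times> UNIV)"
  proof (rule summable_on_productI)
    fix j :: int and l :: nat
    have "norm (C * of_real t * w j) \<le> norm (C * of_real t) * (1 / y)"
      unfolding norm_mult[of "C * of_real t"] by (intro mult_left_mono wy) auto
    hence "norm (C * of_real t * w j) ^ l \<le> (norm (C * of_real t) * (1 / y)) ^ l"
      by (intro power_mono) auto
    hence "norm (w j ^ k) * (norm (C * of_real t * w j) ^ l / fact l) \<le>
        norm (w j ^ k) * ((norm (C * of_real t) * (1 / y)) ^ l / fact l)"
      by (intro mult_left_mono divide_right_mono) auto
    thus "norm (f (j, l)) \<le> norm (w j ^ k) * ((norm (C * of_real t) * (1 / y)) ^ l / fact l)"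
      unfolding f_def prod.case by (simp only: norm_mult norm_power norm_divide norm_fact)
  next
    show "((\<lambda>l. norm (w j ^ k) * ((norm (C * of_real t) * (1 / y)) ^ l / fact l)) has_sum
        norm (w j ^ k) * exp (norm (C * of_real t) * (1 / y))) UNIV" for j
      by (intro has_sum_cmult_right exp_has_sum)
    show "(\<lambda>j. norm (w j ^ k) * exp (norm (C * of_real t) * (1 / y))) summable_on UNIV"
      unfolding w_def by (intro summable_on_cmult_left summable_inverse_shift_power z k)
  qed auto
  have lhs_sum: "?lhs summable_on UNIV"
    using has_sum_SigmaD[OF has_sum_infsum[OF f_sum] f_row] by (auto simp: summable_on_def)
  have L1: "(L has_sum (\<Sum>\<^sub>\<infinity>j. ?lhs j)) UNIV"
    by (rule infsum_swap_complex[OF f_sum f_row f_col has_sum_infsum[OF lhs_sum]])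
  define h where "h = (\<lambda>(n, l). C ^ k * of_nat n ^ (k - 1) * cexp (of_nat n * z) *
      of_real ((- (4 * pi\<^sup>2 * t * real n)) ^ l / (fact l * fact (k - 1 + l))))"
  define X where "X = (\<lambda>n. C ^ k * of_nat n ^ (k - 1) * of_real (bessel (k - 1) (4 * pi\<^sup>2 * t * real n)) * cexp (of_nat n * z))"
  have h_row: "((\<lambda>l. h (n, l)) has_sum X n) UNIV" for n
  proof -
    have "((\<lambda>l. (- (4 * pi\<^sup>2 * t * real n)) ^ l / (fact l * fact (k - 1 + l))) has_sum bessel (k - 1) (4 * pi\<^sup>2 * t * real n)) UNIV"
      by (rule norm_summable_imp_has_sum[OF bessel_summable bessel_sums])
    from has_sum_cmult_right[OF has_sum_of_real[OF this], of "C ^ k * of_nat n ^ (k - 1) * cexp (of_nat n * z)"]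
    show ?thesis by (simp add: h_def X_def mult_ac)
  qed
  have h_sum: "h summable_on (UNIV \<times> UNIV)"
  proof (rule summable_on_productI)
    fix n l :: nat
    show "norm (h (n, l)) \<le> norm (C ^ k) * (real n ^ (k - 1) * norm (cexp (of_nat n * z))) *
       ((4 * pi\<^sup>2 * t * real n) ^ l / (fact l * fact (k - 1 + l)))"
      using t by (simp add: h_def norm_mult norm_power norm_divide power_mult_distrib mult_ac)
  next
    fix n :: nat
    show "((\<lambda>l. norm (C ^ k) * (real n ^ (k - 1) * norm (cexp (of_nat n * z))) *
       ((4 * pi\<^sup>2 * t * real n) ^ l / (fact l * fact (k - 1 + l)))) has_sum
       norm (C ^ k) * (real n ^ (k - 1) * norm (cexp (of_nat n * z))) * iexp (k - 1) (4 * pi\<^sup>2 * t * real n)) UNIV"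
      by (intro has_sum_cmult_right iexp_has_sum) (use t in auto)
    show "norm (C ^ k) * (real n ^ (k - 1) * norm (cexp (of_nat n * z))) * iexp (k - 1) (4 * pi\<^sup>2 * t * real n) \<le>
      norm (C ^ k) * (real n ^ (k - 1) * iexp (k - 1) (4 * pi\<^sup>2 * t * real n) * norm (cexp (of_nat n * z)))"
      by (simp add: mult_ac)
  next
    show "(\<lambda>n. norm (C ^ k) * (real n ^ (k - 1) * iexp (k - 1) (4 * pi\<^sup>2 * t * real n) * norm (cexp (of_nat n * z)))) summable_on UNIV"
      by (intro summable_on_cmult_right summable_iexp_cexp z) (use t in auto)
  qed
  have X_sum: "X summable_on UNIV"
    using has_sum_SigmaD[OF has_sum_infsum[OF h_sum] h_row] by (auto simp: summable_on_def)
  have h_col: "((\<lambda>n. h (n, l)) has_sum L l) UNIV" for l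
  proof -
    define D where "D = (C * of_real t) ^ l / fact l * (C ^ (k + l) / fact (k + l - 1))"
    have sm: "summable (\<lambda>n. norm (of_nat n ^ (k + l - 1) * cexp z ^ n))"
      by (rule summable_power_mult_cexp[OF z])
    have "(\<lambda>n. of_nat n ^ (k + l - 1) * cexp z ^ n) sums (\<Sum>n. of_nat (Suc n) ^ (k + l - 1) * cexp z ^ Suc n)"
      using sums_Suc_iff[of "\<lambda>n. of_nat n ^ (k + l - 1) * cexp z ^ n"] summable_sums[OF summable_norm_cancel[OF sm]]
        suminf_split_head[OF summable_norm_cancel[OF sm]] k by (simp add: power_0_left)
    hence "((\<lambda>n. of_nat n ^ (k + l - 1) * cexp z ^ n) has_sum (\<Sum>n. of_nat (Suc n) ^ (k + l - 1) * cexp z ^ Suc n)) UNIV"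
      by (rule norm_summable_imp_has_sum[OF sm])
    hence "((\<lambda>n. D * (of_nat n ^ (k + l - 1) * cexp z ^ n)) has_sum L l) UNIV"
      unfolding L_def D_def mult.assoc by (intro has_sum_cmult_right)
    moreover have "D * (of_nat n ^ (k + l - 1) * cexp z ^ n) = h (n, l)" for n
    proof -
      have CC: "C * C = - (4 * of_real pi ^ 2)" by (simp add: C_def power2_eq_square algebra_simps)
      have CC': "C ^ l * (C ^ l * (of_real t ^ l * of_nat n ^ l)) = (- (4 * of_real pi ^ 2 * of_real t * of_nat n)) ^ l"
      proof -
        have "C ^ l * (C ^ l * (of_real t ^ l * of_nat n ^ l)) = (C * C * (of_real t * of_nat n)) ^ l"
          by (simp only: power_mult_distrib mult.assoc)
        thus ?thesis unfolding CC by (simp add: mult.assoc)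
      qed
      have kl: "k + l - 1 = k - 1 + l" using k by simp
      have "D * (of_nat n ^ (k + l - 1) * cexp z ^ n) =
        C ^ k * of_nat n ^ (k - 1) * cexp (of_nat n * z) *
          (C ^ l * (C ^ l * (of_real t ^ l * of_nat n ^ l))) / (fact l * fact (k - 1 + l))"
        unfolding D_def kl cexp_power by (simp add: power_add power_mult_distrib)
      also note CC'
      finally show ?thesis by (simp add: h_def)
    qed
    ultimately show ?thesis by simp
  qed
  have "(L has_sum (\<Sum>\<^sub>\<infinity>n. X n)) UNIV"
    by (rule infsum_swap_complex[OF h_sum h_row h_col has_sum_infsum[OF X_sum]])
  hence "(\<Sum>\<^sub>\<infinity>j. ?lhs j) = (\<Sum>\<^sub>\<infinity>n. X n)"
    using L1 has_sum_unique by blast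
  with has_sum_infsum[OF lhs_sum] show ?thesis
    unfolding X_def C_def by simp
qed

section \<open>Positivity of Bessel functions\<close>

lemma bessel_0 [simp]: "bessel v 0 = 1 / fact v"
proof -
  have "(\<lambda>l. (- 0 :: real) ^ l / (fact l * fact (v + l))) sums (1 / fact v)"
    using sums_If_finite[of "\<lambda>l. l = 0" "\<lambda>l. 1 / (fact l * fact (v + l)) :: real"]
    by (simp add: power_0_left if_distrib if_distribR cong: if_cong)
  from sums_unique2[OF bessel_sums this] show ?thesis .
qed

text \<open>The classical relation J_v + J_(v+2) = (2 (v + 1) / y) J_(v+1) with y = 2 sqrt x, in
  this normalisation.\<close>

lemma bessel_recurrence: "bessel v x = (real v + 1) * bessel (Suc v) x - x * bessel (Suc (Suc v)) x"
proof -
  define c where "c = (\<lambda>l. (- x) ^ l / (fact l * fact (v + l)))"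
  define g where "g = (\<lambda>l. case l of 0 \<Rightarrow> 0 | Suc l \<Rightarrow> - x * ((- x) ^ l / (fact l * fact (Suc (Suc v) + l))))"
  have "(\<lambda>l. g (Suc l)) sums (- x * bessel (Suc (Suc v)) x)"
    unfolding g_def nat.case by (intro sums_mult bessel_sums)
  hence "g sums (- x * bessel (Suc (Suc v)) x)"
    by (subst (asm) sums_Suc_iff) (simp add: g_def)
  from sums_add[OF sums_mult[OF bessel_sums[of x "Suc v"], of "real v + 1"] this]
  have "(\<lambda>l. (real v + 1) * ((- x) ^ l / (fact l * fact (Suc v + l))) + g l) sums
     ((real v + 1) * bessel (Suc v) x - x * bessel (Suc (Suc v)) x)" by simp
  moreover have "(real v + 1) * ((- x) ^ l / (fact l * fact (Suc v + l))) + g l = c l" for l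
  proof (cases l)
    case 0
    have "fact (Suc v) = (real v + 1) * (fact v :: real)" by (simp add: algebra_simps)
    thus ?thesis unfolding 0 c_def g_def by (simp del: fact_Suc)
  next
    case (Suc n)
    have f: "fact (Suc n) = (real n + 1) * fact n" "fact (Suc v + Suc n) = (real v + real n + 2) * fact (Suc v + n)"
      "fact (Suc (Suc v) + n) = (real v + real n + 2) * fact (Suc v + n)" "fact (v + Suc n) = (fact (Suc v + n) :: real)"
      by (simp_all add: algebra_simps)
    have "(real v + 1) * ((- x) ^ Suc n / (((real n + 1) * G) * ((real v + real n + 2) * F))) +
        - x * ((- x) ^ n / (G * ((real v + real n + 2) * F))) =
        (- x) ^ Suc n / (((real n + 1) * G) * F)" if "F > 0" "G > 0" for F G :: real
    proof -
      have "real v + real n + 2 \<noteq> 0" "real n + 1 \<noteq> 0" by linarith+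
      thus ?thesis using that by (simp add: divide_simps) (simp add: algebra_simps)
    qed
    thus ?thesis
      unfolding Suc c_def g_def nat.case f by simp
  qed
  ultimately show ?thesis
    using sums_unique2[OF bessel_sums[of x v]] by (simp add: c_def)
qed

lemma bessel_has_derivative: "(bessel v has_real_derivative (- bessel (Suc v) x)) (at x)"
proof -
  define c where "c = (\<lambda>l. (- 1) ^ l / (fact l * fact (v + l)) :: real)"
  have c: "c l * y ^ l = (- y) ^ l / (fact l * fact (v + l))" for l y
    unfolding c_def by (subst (2) power_minus) simp
  have "((\<lambda>y. \<Sum>l. c l * y ^ l) has_real_derivative (\<Sum>l. diffs c l * x ^ l)) (at x)"
    by (rule termdiffs_strong_converges_everywhere)
      (use summable_norm_cancel[OF bessel_summable] in \<open>simp add: c\<close>)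
  moreover have "(\<lambda>y. \<Sum>l. c l * y ^ l) = bessel v"
    by (simp add: c bessel_def [abs_def])
  moreover have "diffs c l * x ^ l = - ((- x) ^ l / (fact l * fact (Suc v + l)))" for l
  proof -
    have "diffs c l = - ((- 1) ^ l / (fact l * fact (Suc v + l)))"
      by (simp add: diffs_def c_def field_simps del: of_nat_Suc)
    thus ?thesis using power_minus[of x l] by simp
  qed
  hence "(\<Sum>l. diffs c l * x ^ l) = - bessel (Suc v) x"
    using sums_minus[OF bessel_sums[of x "Suc v"]] by (simp add: sums_iff)
  ultimately show ?thesis by simp
qed

text \<open>Here the first term dominates: with r = x / (v + 1) <= 1/4 the later terms of
  \<open>fact w * bessel w x\<close> sum to at most r / (1 - 1/8) <= 2/7 in absolute value. So these
  products lie in [5/7, 9/7], and 9/5 <= 2 gives the ratio. This is the base of the downward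
  induction in \<open>bessel_ratio\<close>.\<close>

lemma bessel_ratio_large:
  assumes x: "0 \<le> x" "4 * x \<le> real v + 1"
  shows "bessel v x > 0" "bessel (Suc v) x > 0" "bessel (Suc v) x \<le> 2 / (real v + 1) * bessel v x"
proof -
  have close: "\<bar>fact w * bessel w x - 1\<bar> \<le> 2 / 7" if w: "v \<le> w" for w
  proof -
    have r: "x / (real v + 1) \<le> 1 / 4" "0 \<le> x / (real v + 1)" using x by (auto simp: field_simps)
    define t where "t = (\<lambda>l. fact w * ((- x) ^ l / (fact l * fact (w + l))))"
    have t: "t sums (fact w * bessel w x)" unfolding t_def by (intro sums_mult bessel_sums)
    have t0: "t 0 = 1" by (simp add: t_def)
    hence "(\<lambda>l. t (Suc l)) sums (fact w * bessel w x - 1)"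
      using t sums_Suc_iff[of t] by simp
    moreover have "(\<lambda>l. (x / (real v + 1)) * ((1 / 8) ^ l)) sums ((x / (real v + 1)) * (1 / (1 - 1 / 8)))"
      by (intro sums_mult geometric_sums) auto
    moreover have "\<bar>t (Suc l)\<bar> \<le> (x / (real v + 1)) * (1 / 8) ^ l" for l
    proof -
      have f1: "(real v + 1) ^ Suc l * fact w \<le> fact (w + Suc l)" for l
      proof (induction l)
        case 0
        have "(real v + 1) * fact w \<le> (real w + 1) * fact w" using w by (intro mult_right_mono) auto
        thus ?case by simp
      next
        case (Suc l)
        have "(real v + 1) * ((real v + 1) ^ Suc l * fact w) \<le> real (w + Suc (Suc l)) * fact (w + Suc l)"
          by (rule mult_mono[OF _ Suc.IH]) (use w in auto)
        thus ?case by (simp add: mult.assoc)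
      qed
      have f2: "(2::real) ^ l \<le> fact (Suc l)"
      proof (induction l)
        case (Suc l)
        have "(2::real) * 2 ^ l \<le> real (Suc (Suc l)) * fact (Suc l)"
          by (rule mult_mono[OF _ Suc.IH]) auto
        thus ?case by simp
      qed auto
      have "\<bar>t (Suc l)\<bar> = x ^ Suc l * (fact w / fact (w + Suc l)) / fact (Suc l)"
        using x by (simp add: t_def abs_mult power_abs mult_ac del: fact_Suc power_Suc)
      also have "\<dots> \<le> x ^ Suc l * (1 / (real v + 1) ^ Suc l) / 2 ^ l"
      proof (rule frac_le)
        have "fact w / fact (w + Suc l) \<le> 1 / (real v + 1) ^ Suc l"
          using f1[of l] by (simp add: divide_simps mult_ac del: power_Suc fact_Suc)
        thus "x ^ Suc l * (fact w / fact (w + Suc l)) \<le> x ^ Suc l * (1 / (real v + 1) ^ Suc l)"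
          using x by (intro mult_left_mono) auto
      qed (use x f2 in auto)
      also have "\<dots> = (x / (real v + 1)) ^ Suc l / 2 ^ l"
        by (simp only: power_divide times_divide_eq_right mult_1_right)
      also have "\<dots> = (x / (real v + 1)) * ((x / (real v + 1)) / 2) ^ l"
      proof -
        have "r ^ Suc l / 2 ^ l = r * (r / 2) ^ l" for r :: real by (simp add: power_divide)
        thus ?thesis .
      qed
      also have "\<dots> \<le> (x / (real v + 1)) * (1 / 8) ^ l"
        by (intro mult_left_mono power_mono) (use r x in \<open>auto intro!: divide_nonneg_nonneg\<close>)
      finally show ?thesis .
    qed
    ultimately have "\<bar>fact w * bessel w x - 1\<bar> \<le> (x / (real v + 1)) * (1 / (1 - 1 / 8))"
      by (metis (no_types, lifting) norm_suminf_le real_norm_def sums_iff)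
    also have "\<dots> \<le> 2 / 7"
    proof -
      have "X * (1 / (1 - 1 / 8)) \<le> 2 / 7" if "X \<le> 1 / 4" for X :: real using that by simp
      from this[OF r(1)] show ?thesis .
    qed
    finally show ?thesis .
  qed
  have 1: "5 / 7 \<le> fact v * bessel v x" using close[OF order_refl] unfolding abs_le_iff by linarith
  have 2: "fact (Suc v) * bessel (Suc v) x \<le> 9 / 7" "5 / 7 \<le> fact (Suc v) * bessel (Suc v) x"
    using close[of "Suc v"] unfolding abs_le_iff by (auto simp del: fact_Suc)
  show "bessel v x > 0" 
  proof -
    have "0 < fact v * bessel v x" using 1 by linarith
    thus ?thesis by (simp add: zero_less_mult_iff)
  qed
  show "bessel (Suc v) x > 0" 
  proof -
    have "0 < fact (Suc v) * bessel (Suc v) x" using 2 by linarith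
    thus ?thesis by (simp add: zero_less_mult_iff del: fact_Suc)
  qed
  have "fact (Suc v) * bessel (Suc v) x \<le> 2 * (fact v * bessel v x)" using 1 2 by linarith
  hence "fact v * ((real v + 1) * bessel (Suc v) x) \<le> fact v * (2 * bessel v x)" by (simp add: algebra_simps)
  hence "(real v + 1) * bessel (Suc v) x \<le> 2 * bessel v x" by simp
  thus "bessel (Suc v) x \<le> 2 / (real v + 1) * bessel v x" by (simp add: field_simps)
qed

text \<open>The bound on the ratio is propagated downwards in the order by the recurrence, which is the
  stable direction for the minimal solution.\<close>
lemma bessel_ratio:
  assumes x: "0 \<le> x" "4 * x \<le> (real v + 1)\<^sup>2"
  shows "bessel v x > 0 \<and> bessel (Suc v) x > 0 \<and> bessel (Suc v) x \<le> 2 / (real v + 1) * bessel v x"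
proof -
  \<comment> \<open>An order so large that the linear condition of \<open>bessel_ratio_large\<close>
    holds, although x may be quadratic in v.\<close>
  define M where "M = v + nat \<lceil>4 * x\<rceil>"
  have "v \<le> M" by (simp add: M_def)
  thus ?thesis using x
  proof (induction rule: inc_induct)
    case base
    have "4 * x \<le> real M + 1" unfolding M_def by linarith
    thus ?case using bessel_ratio_large[OF x(1)] by blast
  next
    case (step n)
    have "(real n + 1)\<^sup>2 \<le> (real (Suc n) + 1)\<^sup>2" by (intro power_mono) auto
    hence "4 * x \<le> (real (Suc n) + 1)\<^sup>2" using step.prems by linarith
    from step.IH[OF step.prems(1) this]
    have IH: "bessel (Suc n) x > 0" "bessel (Suc (Suc n)) x \<le> 2 / (real n + 2) * bessel (Suc n) x"
      by (auto simp: add_ac)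
    have "x * bessel (Suc (Suc n)) x \<le> x * (2 / (real n + 2) * bessel (Suc n) x)"
      by (intro mult_left_mono IH step.prems)
    also have "\<dots> = (x * (2 / (real n + 2))) * bessel (Suc n) x" by simp
    \<comment> \<open>In the recurrence the subtracted term takes away at most half of (n + 1)
      \<open>bessel (Suc n) x\<close>; the half that remains is exactly the ratio bound at
      n.\<close>
    also have "\<dots> \<le> ((real n + 1) / 2) * bessel (Suc n) x"
    proof (intro mult_right_mono)
      have "4 * x \<le> (real n + 1) * (real n + 2)"
        using step.prems(2) by (simp add: power2_eq_square algebra_simps)
      thus "x * (2 / (real n + 2)) \<le> (real n + 1) / 2" by (simp add: field_simps)
    qed (use IH in auto)
    finally have 1: "(real n + 1) / 2 * bessel (Suc n) x \<le> bessel n x"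
      using bessel_recurrence[of n x] by (simp add: algebra_simps)
    moreover have "0 < (real n + 1) / 2 * bessel (Suc n) x" using IH by simp
    ultimately have "bessel n x > 0" by linarith
    moreover have "bessel (Suc n) x \<le> 2 / (real n + 1) * bessel n x" using 1 by (simp add: field_simps)
    ultimately show ?case using IH by blast
  qed
qed

text \<open>One step of the recurrence from the ratio bound at \<open>Suc v\<close>, asking only for
  positivity at v, enlarges the range from (v + 1)^2 to (v + 2)^2. This is needed for v = 11, since
  16 pi^2 lies between 12^2 and 13^2.\<close>

lemma bessel_pos:
  assumes v: "v > 0" and x: "0 \<le> x" "4 * x \<le> (real v + 2)\<^sup>2"
  shows "bessel v x > 0"
proof -
  have IH: "bessel (Suc v) x > 0" "bessel (Suc (Suc v)) x > 0"
      "bessel (Suc (Suc v)) x \<le> 2 / (real v + 2) * bessel (Suc v) x"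
    using bessel_ratio[of x "Suc v"] x by (auto simp: add_ac)
  have "x * bessel (Suc (Suc v)) x \<le> (real v + 2)\<^sup>2 / 4 * (2 / (real v + 2) * bessel (Suc v) x)"
    by (rule mult_mono) (use x IH in auto)
  also have "\<dots> = (real v + 2) / 2 * bessel (Suc v) x"
    by (simp add: power2_eq_square field_simps)
  finally have "real v / 2 * bessel (Suc v) x \<le> bessel v x"
    using bessel_recurrence[of v x] by (simp add: algebra_simps)
  moreover have "0 < real v / 2 * bessel (Suc v) x" using IH v by simp
  ultimately show ?thesis by linarith
qed

text \<open>As the derivative of \<open>bessel v\<close> is minus \<open>bessel (Suc v)\<close>, the
  ratio bound places the logarithmic derivative between -2 / (v + 1) and 0; integrate from
  0.\<close>

lemma bessel_bounds:
  assumes x: "0 \<le> x" "4 * x \<le> (real v + 1)\<^sup>2"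
  shows "exp (- (2 * x / (real v + 1))) / fact v \<le> bessel v x" "bessel v x \<le> 1 / fact v"
proof -
  have sq: "4 * t \<le> (real v + 1)\<^sup>2" if "t \<le> x" for t using that x by linarith
  define r where "r = 2 / (real v + 1)"
  have "bessel v 0 * exp (r * 0) \<le> bessel v x * exp (r * x)"
  proof (rule DERIV_nonneg_imp_nondecreasing[OF x(1)])
    fix t assume t: "0 \<le> t" "t \<le> x"
    have "((\<lambda>t. exp (r * t)) has_real_derivative (exp (r * t) * r)) (at t)"
      by (auto intro!: derivative_eq_intros)
    from DERIV_mult[OF bessel_has_derivative[of v] this]
    have "((\<lambda>t. bessel v t * exp (r * t)) has_real_derivative
        (exp (r * t) * (r * bessel v t - bessel (Suc v) t))) (at t)"
      by (rule DERIV_cong) (simp add: algebra_simps)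
    moreover have "0 \<le> exp (r * t) * (r * bessel v t - bessel (Suc v) t)"
      using bessel_ratio[OF t(1) sq[OF t(2)]] by (simp add: r_def)
    ultimately show "\<exists>y. ((\<lambda>t. bessel v t * exp (r * t)) has_real_derivative y) (at t) \<and> 0 \<le> y"
      by blast
  qed
  hence "exp (- (r * x)) / fact v \<le> bessel v x"
    by (simp add: exp_minus field_simps)
  thus "exp (- (2 * x / (real v + 1))) / fact v \<le> bessel v x"
    by (simp add: r_def)
  have "bessel v x \<le> bessel v 0"
  proof (rule DERIV_nonpos_imp_nonincreasing[OF x(1)])
    fix t assume t: "0 \<le> t" "t \<le> x"
    show "\<exists>y. (bessel v has_real_derivative y) (at t) \<and> y \<le> 0"
      using bessel_has_derivative bessel_ratio[OF t(1) sq[OF t(2)]] by (metis less_imp_le neg_le_0_iff_le)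
  qed
  thus "bessel v x \<le> 1 / fact v" by simp
qed

section \<open>Poincare series\<close>

definition completion :: "int \<Rightarrow> int \<Rightarrow> int \<times> int" where
  "completion c d = (SOME p. fst p * d - snd p * c = 1)"

lemma completion:
  assumes "coprime c d"
  shows "fst (completion c d) * d - snd (completion c d) * c = 1"
proof -
  obtain u v where "u * c + v * d = 1" using assms by (metis bezout_int coprime_imp_gcd_eq_1)
  hence "fst (v, - u) * d - snd (v, - u) * c = 1" by simp
  thus ?thesis unfolding completion_def by (rule someI)
qed

text \<open>The value does not depend on the chosen completion of the row $(c, d)$ to a matrix in
  $\mathrm{SL}_2(\mathbb{Z})$, because two completions differ by a translation.\<close>
definition poincare_term :: "nat \<Rightarrow> nat \<Rightarrow> complex \<Rightarrow> int \<times> int \<Rightarrow> complex" where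
  "poincare_term k m z = (\<lambda>(c, d). inverse (of_int c * z + of_int d) ^ k *
     cexp (of_nat m * ((of_int (fst (completion c d)) * z + of_int (snd (completion c d))) / (of_int c * z + of_int d))))"

definition coprime_pairs :: "(int \<times> int) set" where
  "coprime_pairs = {(c, d). coprime c d}"

lemma denominator_nonzero:
  assumes z: "z \<in> upper_half" and "(c, d) \<noteq> (0, 0)"
  shows "of_int c * z + of_int d \<noteq> 0"
proof
  assume 0: "of_int c * z + of_int d = 0"
  hence "Im (of_int c * z + of_int d) = 0" by simp
  hence "c = 0" using z by (auto simp: upper_half_def)
  with 0 assms(2) show False by auto
qed

lemma coprime_not_0_0: "coprime (c :: int) d \<Longrightarrow> (c, d) \<noteq> (0, 0)"
  by auto

lemma Im_moebius:
  assumes "a * d - b * c = 1"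
  shows "Im ((of_int a * z + of_int b) / (of_int c * z + of_int d)) = Im z / (norm (of_int c * z + of_int d))\<^sup>2"
proof -
  have "(of_int a * Im z) * (of_int c * Re z + of_int d) - (of_int a * Re z + of_int b) * (of_int c * Im z) =
      of_int (a * d - b * c) * Im z" by (simp add: algebra_simps)
  thus ?thesis unfolding assms by (simp add: Im_divide cmod_power2)
qed

lemma poincare_term_eq:
  assumes z: "z \<in> upper_half" and ad: "a * d - b * c = 1"
  shows "poincare_term k m z (c, d) = inverse (of_int c * z + of_int d) ^ k *
     cexp (of_nat m * ((of_int a * z + of_int b) / (of_int c * z + of_int d)))"
proof -
  have cop: "coprime c d"
  proof (rule coprimeI)
    fix e assume "e dvd c" "e dvd d"
    hence "e dvd a * d - b * c" by simp
    thus "is_unit e" using ad by simp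
  qed
  define a' b' where "a' = fst (completion c d)" and "b' = snd (completion c d)"
  have ad': "a' * d - b' * c = 1" unfolding a'_def b'_def by (rule completion[OF cop])
  have nz: "of_int c * z + of_int d \<noteq> 0" using denominator_nonzero[OF z coprime_not_0_0[OF cop]] .
  have e: "(a' - a) * d = (b' - b) * c" using ad ad' by (simp add: algebra_simps)
  obtain t where t: "a' - a = c * t" "b' - b = d * t"
  proof (cases "c = 0")
    case True
    have 1: "a * d = 1" "a' * d = 1" using ad ad' True by auto
    hence "a' = a" by (metis mult.commute mult.left_commute mult.right_neutral)
    moreover have "b' - b = d * (a * (b' - b))" using 1 by (metis mult.commute mult.left_commute mult.right_neutral)
    ultimately show ?thesis using that[of "a * (b' - b)"] True by simp
  next
    case False
    have "c dvd (a' - a) * d" unfolding e by simp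
    hence "c dvd a' - a" using cop by (simp add: coprime_dvd_mult_left_iff)
    then obtain t where t: "a' - a = c * t" by blast
    have "(b' - b) * c = (d * t) * c" using e unfolding t by (simp only: mult_ac)
    hence "b' - b = d * t" using False by simp
    with t that show ?thesis by blast
  qed
  hence b': "b' = b + d * t" and a': "a' = a + c * t" using t by auto
  have "(of_int a' * z + of_int b') / (of_int c * z + of_int d) =
      (of_int a * z + of_int b) / (of_int c * z + of_int d) + (of_int t :: complex)"
    unfolding a' b' using nz by (simp add: field_simps)
  hence "cexp (of_nat m * ((of_int a' * z + of_int b') / (of_int c * z + of_int d))) =
      cexp (of_nat m * ((of_int a * z + of_int b) / (of_int c * z + of_int d))) * cexp (of_int (int m) * of_int t)"
    by (simp only: distrib_left cexp_add of_int_of_nat_eq)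
  thus ?thesis by (simp add: poincare_term_def a'_def[symmetric] b'_def[symmetric] del: of_int_of_nat_eq)
qed


lemma poincare_term_uminus:
  assumes z: "z \<in> upper_half" and "coprime c d" and k: "even k"
  shows "poincare_term k m z (- c, - d) = poincare_term k m z (c, d)"
proof -
  obtain a b where ad: "a * d - b * c = 1" using completion[OF assms(2)] by blast
  hence ad': "- a * - d - - b * - c = 1" by simp
  have 1: "of_int (- c) * z + of_int (- d) = - (of_int c * z + of_int d)"
    "of_int (- a) * z + of_int (- b) = - (of_int a * z + of_int b)" by simp_all
  show ?thesis
    unfolding poincare_term_eq[OF z ad] poincare_term_eq[OF z ad'] 1 minus_divide_divide
      inverse_minus_eq using k by simp
qed

lemma poincare_term_shift:
  assumes z: "z \<in> upper_half" and "coprime c d"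
  shows "poincare_term k m z (c, d + c * j) = poincare_term k m (z + of_int j) (c, d)"
proof -
  obtain a b where ad: "a * d - b * c = 1" using completion[OF assms(2)] by blast
  hence ad': "a * (d + c * j) - (b + a * j) * c = 1" by (simp add: algebra_simps)
  have z': "z + of_int j \<in> upper_half" using z by (simp add: upper_half_def)
  show ?thesis
    unfolding poincare_term_eq[OF z ad'] poincare_term_eq[OF z' ad]
    by (simp add: algebra_simps)
qed

lemma upper_half_inversion: "z \<in> upper_half \<Longrightarrow> - 1 / z \<in> upper_half"
  by (auto simp: upper_half_def Im_divide intro!: divide_pos_pos add_nonneg_pos)

lemma poincare_term_inversion:
  assumes z: "z \<in> upper_half" and "coprime c d"
  shows "poincare_term k m (- 1 / z) (c, d) = z ^ k * poincare_term k m z (d, - c)"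
proof -
  obtain a b where ad: "a * d - b * c = 1" using completion[OF assms(2)] by blast
  hence ad': "b * - c - - a * d = 1" by (simp add: algebra_simps)
  have z0: "z \<noteq> 0" using z by (auto simp: upper_half_def)
  have "coprime d (- c)" using assms(2) by (simp add: coprime_commute)
  hence nz: "of_int d * z + of_int (- c) \<noteq> 0" using denominator_nonzero[OF z coprime_not_0_0] by blast
  have 1: "of_int c * (- 1 / z) + of_int d = (of_int d * z + of_int (- c)) / z"
     "of_int a * (- 1 / z) + of_int b = (of_int b * z + of_int (- a)) / z"
    using z0 by (simp_all add: field_simps)
  have 2: "(of_int b * z + of_int (- a)) / z / ((of_int d * z + of_int (- c)) / z) =
     (of_int b * z + of_int (- a)) / (of_int d * z + of_int (- c))"
    using z0 by simp
  show ?thesis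
    unfolding poincare_term_eq[OF upper_half_inversion[OF z] ad] poincare_term_eq[OF z ad'] 1 2
    using z0 nz by (simp add: power_divide power_inverse field_simps)
qed

lemma norm_poincare_term_le:
  assumes z: "z \<in> upper_half" and "coprime c d"
  shows "norm (poincare_term k m z (c, d)) \<le> norm (inverse (of_int c * z + of_int d)) ^ k"
proof -
  obtain a b where ad: "a * d - b * c = 1" using completion[OF assms(2)] by blast
  have "0 \<le> real m * (Im z / (norm (of_int c * z + of_int d))\<^sup>2)"
    using z by (intro mult_nonneg_nonneg divide_nonneg_nonneg) (auto simp: upper_half_def)
  define w where "w = (of_int a * z + of_int b) / (of_int c * z + of_int d)"
  have "Im w = Im z / (norm (of_int c * z + of_int d))\<^sup>2"
    unfolding w_def by (rule Im_moebius[OF ad])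
  hence "norm (cexp (of_nat m * w)) \<le> 1"
    using z unfolding norm_cexp by (simp add: upper_half_def)
  thus ?thesis
    unfolding poincare_term_eq[OF z ad] w_def[symmetric] norm_mult norm_power by (rule mult_left_le) simp
qed

lemma poincare_term_summable:
  assumes z: "z \<in> upper_half" and k: "k \<ge> 4"
  shows "poincare_term k m z summable_on coprime_pairs"
proof -
  obtain K where K: "K > 0"
    "\<And>c d :: int. (c, d) \<noteq> (0, 0) \<Longrightarrow> 1 + \<bar>real_of_int c\<bar> \<le> K * norm (of_int c * z + of_int d)"
    "\<And>c d :: int. (c, d) \<noteq> (0, 0) \<Longrightarrow> 1 + \<bar>real_of_int d\<bar> \<le> K * norm (of_int c * z + of_int d)"
    using lattice_lower_bound[OF z] by metis
  define s where "s = (\<lambda>c::int. 1 / (1 + \<bar>real_of_int c\<bar>) ^ 2)"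
  have s_sum: "s summable_on UNIV" unfolding s_def by (rule summable_inverse_square_int)
  have s0: "s c \<ge> 0" for c by (simp add: s_def)
  have "(\<lambda>(c, d). s c * s d) summable_on UNIV \<times> UNIV"
    by (rule summable_on_SigmaI[where g = "\<lambda>c. s c * (\<Sum>\<^sub>\<infinity>d. s d)"])
      (use s_sum s0 in \<open>auto intro!: has_sum_cmult_right summable_on_cmult_left\<close>)
  hence "(\<lambda>(c, d). s c * s d) summable_on coprime_pairs"
    by (rule summable_on_subset_banach) simp
  hence sum: "(\<lambda>p. K ^ k * (case p of (c, d) \<Rightarrow> s c * s d)) summable_on coprime_pairs"
    by (rule summable_on_cmult_right)
  have "(\<lambda>p. norm (poincare_term k m z p)) summable_on coprime_pairs"
  proof (rule Infinite_Sum.abs_summable_on_comparison_test'[OF sum])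
    fix p assume "p \<in> coprime_pairs"
    then obtain c d where p: "p = (c, d)" and cop: "coprime c d" by (auto simp: coprime_pairs_def)
    let ?c = "1 + \<bar>real_of_int c\<bar>" and ?d = "1 + \<bar>real_of_int d\<bar>"
    define N where "N = norm (of_int c * z + of_int d)"
    have cN: "?c \<le> K * N" "?d \<le> K * N" unfolding N_def by (intro K coprime_not_0_0 cop)+
    have N: "N > 0" unfolding N_def using denominator_nonzero[OF z coprime_not_0_0[OF cop]] by simp
    have "inverse N \<le> K * (1 / ?c)" "inverse N \<le> K * (1 / ?d)"
      using cN N by (simp_all add: field_simps)
    hence 1: "inverse N ^ 2 \<le> (K * (1 / ?c)) ^ 2" "inverse N ^ 2 \<le> (K * (1 / ?d)) ^ 2"
      using N by (intro power_mono; simp)+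
    have "1 \<le> K * N" using cN by linarith
    hence "inverse N \<le> K" using N by (simp add: field_simps)
    hence 2: "inverse N ^ (k - 4) \<le> K ^ (k - 4)" using N by (intro power_mono) auto
    have "inverse N ^ k = inverse N ^ (k - 4) * (inverse N ^ 2 * inverse N ^ 2)"
      using k by (simp flip: power_add)
    also have "\<dots> \<le> K ^ (k - 4) * ((K * (1 / ?c)) ^ 2 * (K * (1 / ?d)) ^ 2)"
      by (intro mult_mono 1 2) (use N K in auto)
    also have "\<dots> = (K ^ (k - 4) * (K ^ 2 * K ^ 2)) * (s c * s d)"
      by (simp add: s_def power_mult_distrib power_divide)
    also have "K ^ (k - 4) * (K ^ 2 * K ^ 2) = K ^ k"
      using k by (simp flip: power_add)
    finally show "norm (poincare_term k m z p) \<le> K ^ k * (case p of (c, d) \<Rightarrow> s c * s d)"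
      using norm_poincare_term_le[OF z cop, of k m] by (simp add: p N_def norm_inverse)
  qed
  thus ?thesis by (rule abs_summable_summable)
qed

text \<open>Both (c, d) and (-c, -d) occur among the coprime rows, hence the factor 1/2. For m = 0
  this is the Eisenstein series E_k with constant term 1.\<close>

definition poincare :: "nat \<Rightarrow> nat \<Rightarrow> complex \<Rightarrow> complex" where
  "poincare k m z = (\<Sum>\<^sub>\<infinity>p\<in>coprime_pairs. poincare_term k m z p) / 2"

lemma poincare_inversion:
  assumes z: "z \<in> upper_half"
  shows "poincare k m (- 1 / z) = z ^ k * poincare k m z"
proof -
  have "(\<Sum>\<^sub>\<infinity>p\<in>coprime_pairs. poincare_term k m (- 1 / z) p) =
      (\<Sum>\<^sub>\<infinity>p\<in>coprime_pairs. z ^ k * poincare_term k m z p)"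
    by (rule infsum_reindex_bij_witness[of _ "\<lambda>(c, d). (- d, c)" "\<lambda>(c, d). (d, - c)"])
      (auto simp: coprime_pairs_def coprime_commute poincare_term_inversion[OF z] simp del: divide_minus_left)
  also have "\<dots> = z ^ k * (\<Sum>\<^sub>\<infinity>p\<in>coprime_pairs. poincare_term k m z p)"
    by (rule infsum_cmult_right')
  finally show ?thesis by (simp add: poincare_def)
qed

section \<open>Fourier coefficients of the Poincare series\<close>

definition reduced_pairs :: "(int \<times> int) set" where
  "reduced_pairs = {(c, d). 1 \<le> c \<and> 0 \<le> d \<and> d < c \<and> coprime c d}"

text \<open>\<open>fst (completion c d)\<close> inverts d modulo c, so for fixed c the exponentials
  are the terms of the Kloosterman sum S(m, n; c). They are not grouped, because for c >= 2 the
  estimates use only their absolute value 1.\<close>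

definition poincare_summand :: "nat \<Rightarrow> nat \<Rightarrow> nat \<Rightarrow> int \<times> int \<Rightarrow> complex" where
  "poincare_summand k m n = (\<lambda>(c, d).
     inverse (of_int c) ^ k * cexp ((of_nat m * of_int (fst (completion c d)) + of_nat n * of_int d) / of_int c) *
     of_real ((2 * pi) ^ k * real n ^ (k - 1) * bessel (k - 1) (4 * pi\<^sup>2 * real m * real n / (of_int c)\<^sup>2)))"

definition poincare_coeff :: "nat \<Rightarrow> nat \<Rightarrow> nat \<Rightarrow> complex" where
  "poincare_coeff k m n = of_bool (n = m) + (\<Sum>\<^sub>\<infinity>p\<in>reduced_pairs. poincare_summand k m n p)"

lemma norm_cexp_real: "w \<in> \<real> \<Longrightarrow> norm (cexp w) = 1"
  by (auto simp: norm_cexp elim: Reals_cases)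

lemma norm_poincare_summand:
  "norm (poincare_summand k m n (c, d)) = \<bar>inverse (of_int c)\<bar> ^ k *
     ((2 * pi) ^ k * real n ^ (k - 1) * \<bar>bessel (k - 1) (4 * pi\<^sup>2 * real m * real n / (of_int c)\<^sup>2)\<bar>)"
proof -
  have "norm (cexp ((of_nat m * of_int (fst (completion c d)) + of_nat n * of_int d) / of_int c)) = 1"
    by (rule norm_cexp_real) auto
  thus ?thesis by (simp add: poincare_summand_def norm_mult norm_power norm_inverse abs_mult)
qed

text \<open>From a d - b c = 1 one gets (a z + b) / (c z + d) = a / c - 1 / (c^2 (z + d/c)), so the
  translates form a sum as in \<open>horocycle_expansion\<close> at the point z + d/c with t = m /
  c^2. Divisibility of k by 4 turns (-2 pi i)^k into (2 pi)^k.\<close>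

lemma poincare_term_translates:
  assumes z: "z \<in> upper_half" and c: "c \<ge> 1" and cop: "coprime c d" and k: "k \<ge> 2" "k mod 4 = 0"
  shows "((\<lambda>j. poincare_term k m (z + of_int j) (c, d)) has_sum
    (\<Sum>\<^sub>\<infinity>n. poincare_summand k m n (c, d) * cexp (of_nat n * z))) UNIV"
proof -
  define a where "a = fst (completion c d)"
  define b where "b = snd (completion c d)"
  have ad: "a * d - b * c = 1" unfolding a_def b_def by (rule completion[OF cop])
  define C :: complex where "C = of_int c"
  have C: "C \<noteq> 0" using c by (simp add: C_def)
  define z' where "z' = z + of_int d / C"
  have z': "z' \<in> upper_half" using z by (simp add: z'_def C_def upper_half_def Im_divide)
  define t where "t = real m / (of_int c)\<^sup>2"
  have t: "t \<ge> 0" by (simp add: t_def)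
  have tC: "of_real t = of_nat m / C\<^sup>2" by (simp add: t_def C_def)
  have k4: "(- 2 * of_real pi * \<i>) ^ k = of_real ((2 * pi) ^ k)"
  proof -
    obtain r where r: "k = 4 * r" using k(2) by (metis mod_0_imp_dvd dvd_def)
    have "(- 2 * of_real pi * \<i>) ^ 4 = (of_real ((2 * pi) ^ 4) :: complex)"
      by (simp add: power_mult_distrib)
    thus ?thesis unfolding r power_mult by (metis of_real_power)
  qed
  have lhs: "poincare_term k m (z + of_int j) (c, d) = inverse C ^ k * cexp (of_nat m * of_int a / C) *
      (inverse (z' + of_int j) ^ k * cexp (- of_real t * inverse (z' + of_int j)))" for j
  proof -
    have zj: "z + of_int j \<in> upper_half" "z' + of_int j \<in> upper_half" using z z' by (simp_all add: upper_half_def)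
    have nz: "z' + of_int j \<noteq> 0" using zj(2) unfolding upper_half_def
      by (metis (mono_tags) less_irrefl mem_Collect_eq zero_complex.sel(2))
    have 1: "of_int c * (z + of_int j) + of_int d = C * (z' + of_int j)"
      using C by (simp add: z'_def C_def algebra_simps)
    have "(of_int a * (z + of_int j) + of_int b) * C = of_int a * (C * (z' + of_int j)) - of_int (a * d - b * c)"
      unfolding z'_def using C by (simp add: algebra_simps) (simp add: C_def)
    hence "of_int a * (z + of_int j) + of_int b = (of_int a * (C * (z' + of_int j)) - 1) / C"
      unfolding ad using C by (simp add: field_simps)
    moreover have "((X * (C * w) - 1) / C) / (C * w) = X / C - inverse w / C\<^sup>2" if "w \<noteq> 0" for w X
      using C that by (simp add: field_simps power2_eq_square)
    ultimately have h: "(of_int a * (z + of_int j) + of_int b) / (C * (z' + of_int j)) =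
        of_int a / C - inverse (z' + of_int j) / C\<^sup>2"
      using nz by simp
    have 2: "of_nat m * ((of_int a * (z + of_int j) + of_int b) / (C * (z' + of_int j))) =
        of_nat m * of_int a / C + - of_real t * inverse (z' + of_int j)"
      unfolding h tC by (simp add: algebra_simps)
    show ?thesis
      unfolding poincare_term_eq[OF zj(1) ad] 1 2 cexp_add
      by (simp add: power_mult_distrib mult_ac)
  qed
  have "((\<lambda>j. poincare_term k m (z + of_int j) (c, d)) has_sum
      (inverse C ^ k * cexp (of_nat m * of_int a / C) * (\<Sum>\<^sub>\<infinity>n. (- 2 * of_real pi * \<i>) ^ k * of_nat n ^ (k - 1) *
        of_real (bessel (k - 1) (4 * pi\<^sup>2 * t * real n)) * cexp (of_nat n * z')))) UNIV"
    unfolding lhs by (intro has_sum_cmult_right horocycle_expansion z' k t)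
  also have "inverse C ^ k * cexp (of_nat m * of_int a / C) * (\<Sum>\<^sub>\<infinity>n. (- 2 * of_real pi * \<i>) ^ k * of_nat n ^ (k - 1) *
        of_real (bessel (k - 1) (4 * pi\<^sup>2 * t * real n)) * cexp (of_nat n * z')) =
      (\<Sum>\<^sub>\<infinity>n. inverse C ^ k * cexp (of_nat m * of_int a / C) * ((- 2 * of_real pi * \<i>) ^ k * of_nat n ^ (k - 1) *
        of_real (bessel (k - 1) (4 * pi\<^sup>2 * t * real n)) * cexp (of_nat n * z')))"
    by (rule infsum_cmult_right'[symmetric])
  also have "\<dots> = (\<Sum>\<^sub>\<infinity>n. poincare_summand k m n (c, d) * cexp (of_nat n * z))"
  proof (rule infsum_cong)
    fix n :: nat
    have "cexp (of_nat n * z') = cexp (of_nat n * z) * cexp (of_nat n * of_int d / C)"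
      unfolding cexp_add[symmetric] z'_def by (simp add: algebra_simps)
    moreover have "4 * pi\<^sup>2 * t * real n = 4 * pi\<^sup>2 * real m * real n / (of_int c)\<^sup>2"
      by (simp add: t_def)
    moreover have "cexp ((of_nat m * of_int a + of_nat n * of_int d) / C) =
        cexp (of_nat m * of_int a / C) * cexp (of_nat n * of_int d / C)"
      unfolding cexp_add[symmetric] by (simp add: add_divide_distrib)
    ultimately show "inverse C ^ k * cexp (of_nat m * of_int a / C) * ((- 2 * of_real pi * \<i>) ^ k * of_nat n ^ (k - 1) *
        of_real (bessel (k - 1) (4 * pi\<^sup>2 * t * real n)) * cexp (of_nat n * z')) =
        poincare_summand k m n (c, d) * cexp (of_nat n * z)"
      unfolding k4 poincare_summand_def prod.case a_def[symmetric] C_def[symmetric]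
      by (simp add: mult_ac)
  qed
  finally show ?thesis .
qed

text \<open>For each c there are at most c values of d, and c^(-k) <= 2^(4-k) c^(-4) for c >= 2.
  Then c * c^(-4) <= c^(-2) / 2, and the sum of c^(-2) over c >= 2 is pi^2/6 - 1 <= 1. The pair (1,
  0) is left out because it carries the main term.\<close>

lemma reduced_pairs_tail:
  assumes k: "k \<ge> 4"
  shows "(\<lambda>(c, d). inverse (real_of_int c) ^ k) summable_on (reduced_pairs - {(1, 0)})"
    and "(\<Sum>\<^sub>\<infinity>(c, d)\<in>reduced_pairs - {(1, 0)}. inverse (real_of_int c) ^ k) \<le> 8 / 2 ^ k"
proof -
  define T where "T = (SIGMA c:{2::int..}. {0..<c})"
  define f where "f = (\<lambda>(c :: int, d :: int). 16 / 2 ^ k * (1 / real_of_int c ^ 4))"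
  have "(\<lambda>n. 1 / (real n + 1)\<^sup>2) sums (pi\<^sup>2 / 6)"
    using inverse_squares_sums by (simp add: add.commute)
  hence "(\<lambda>n. 1 / (real (Suc n) + 1)\<^sup>2) sums (pi\<^sup>2 / 6 - 1)"
    using sums_Suc_iff[of "\<lambda>n. 1 / (real n + 1)\<^sup>2" "pi\<^sup>2 / 6 - 1"] by simp
  hence "((\<lambda>n. 1 / (real (Suc n) + 1)\<^sup>2) has_sum (pi\<^sup>2 / 6 - 1)) UNIV"
    by (rule sums_nonneg_imp_has_sum) auto
  also have "?this \<longleftrightarrow> ((\<lambda>c. 1 / (real_of_int c)\<^sup>2) has_sum (pi\<^sup>2 / 6 - 1)) {2..}"
    by (rule has_sum_reindex_bij_witness[of _ "\<lambda>c. nat (c - 2)" "\<lambda>n. int n + 2"]) (auto simp: add_ac)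
  finally have sq: "((\<lambda>c. 1 / (real_of_int c)\<^sup>2) has_sum (pi\<^sup>2 / 6 - 1)) {2..}" .
  have rows: "((\<lambda>d. f (c, d)) has_sum (16 / 2 ^ k * (1 / real_of_int c ^ 3))) {0..<c}" if "c \<in> {2..}" for c
    by (rule has_sum_finiteI) (use that in \<open>auto simp: f_def power_numeral_reduce field_simps\<close>)
  have le: "16 / 2 ^ k * (1 / real_of_int c ^ 3) \<le> 8 / 2 ^ k * (1 / (real_of_int c)\<^sup>2)" if "c \<in> {2..}" for c
    using that by (auto simp: power_numeral_reduce field_simps)
  have cube: "(\<lambda>c. 16 / 2 ^ k * (1 / real_of_int c ^ 3)) summable_on {2..}"
    by (rule summable_on_comparison_test[OF summable_on_cmult_right[OF has_sum_imp_summable[OF sq]] le]) auto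
  have fT: "f summable_on T"
    unfolding T_def by (rule summable_on_SigmaI[OF rows cube]) (auto simp: f_def)
  have "((\<lambda>c. 16 / 2 ^ k * (1 / real_of_int c ^ 3)) has_sum infsum f T) {2..}"
    by (rule has_sum_SigmaD[OF has_sum_infsum[OF fT, unfolded T_def] rows, folded T_def])
  hence "infsum f T \<le> 8 / 2 ^ k * (pi\<^sup>2 / 6 - 1)"
    by (rule has_sum_mono[OF _ has_sum_cmult_right[OF sq] le])
  also have "\<dots> \<le> 8 / 2 ^ k * 1"
  proof (intro mult_left_mono)
    have "pi\<^sup>2 \<le> (3.2)\<^sup>2" using pi_approx by (intro power_mono) auto
    thus "pi\<^sup>2 / 6 - 1 \<le> 1" by (simp add: power2_eq_square)
  qed auto
  finally have f_le: "infsum f T \<le> 8 / 2 ^ k" by simp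
  have sub: "reduced_pairs - {(1, 0)} \<subseteq> T" by (auto simp: reduced_pairs_def T_def)
  have f_sub: "f summable_on (reduced_pairs - {(1, 0)})"
    by (rule summable_on_subset_banach[OF fT sub])
  have bound: "(case p of (c, d) \<Rightarrow> inverse (real_of_int c) ^ k) \<le> f p" if pT: "p \<in> T" for p
  proof -
    obtain c d where p: "p = (c, d)" and c: "c \<ge> 2" using pT by (auto simp: T_def)
    have "inverse (real_of_int c) ^ k = inverse (real_of_int c) ^ (k - 4) * inverse (real_of_int c) ^ 4"
      using k by (simp flip: power_add)
    also have "\<dots> \<le> inverse 2 ^ (k - 4) * inverse (real_of_int c) ^ 4"
      using c by (intro mult_right_mono power_mono le_imp_inverse_le) auto
    also have "inverse 2 ^ (k - 4) = (16 / 2 ^ k :: real)"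
    proof -
      have "(2::real) ^ k = 2 ^ (k - 4) * 2 ^ 4"
        by (subst power_add[symmetric]) (use k in simp)
      thus ?thesis by (simp add: power_inverse field_simps)
    qed
    finally show ?thesis by (simp add: p f_def power_inverse inverse_eq_divide power_divide)
  qed
  show sm: "(\<lambda>(c, d). inverse (real_of_int c) ^ k) summable_on (reduced_pairs - {(1, 0)})"
    by (rule summable_on_comparison_test[OF f_sub]) (use bound sub in \<open>auto simp: reduced_pairs_def\<close>)
  have "(\<Sum>\<^sub>\<infinity>(c, d)\<in>reduced_pairs - {(1, 0)}. inverse (real_of_int c) ^ k) \<le> infsum f T"
    by (rule infsum_mono_neutral[OF sm fT]) (use bound sub in \<open>auto simp: f_def T_def\<close>)
  with f_le show "(\<Sum>\<^sub>\<infinity>(c, d)\<in>reduced_pairs - {(1, 0)}. inverse (real_of_int c) ^ k) \<le> 8 / 2 ^ k"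
    by linarith
qed

lemma reduced_pairs_insert: "reduced_pairs = insert (1, 0) (reduced_pairs - {(1, 0)})"
  by (auto simp: reduced_pairs_def)

lemma reduced_pairs_summable:
  "k \<ge> 4 \<Longrightarrow> (\<lambda>(c, d). inverse (real_of_int c) ^ k) summable_on reduced_pairs"
  by (subst reduced_pairs_insert, subst summable_on_insert_iff) (rule reduced_pairs_tail)

lemma poincare_summand_summable:
  assumes z: "z \<in> upper_half" and k: "k \<ge> 4"
  shows "(\<lambda>(p, n). poincare_summand k m n p * cexp (of_nat n * z)) summable_on (reduced_pairs \<times> UNIV)"
proof -
  define u where "u = (\<lambda>n. (2 * pi) ^ k * (real n ^ (k - 1) * iexp (k - 1) (4 * pi\<^sup>2 * real m * real n) * norm (cexp (of_nat n * z))))"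
  have u: "u summable_on UNIV" unfolding u_def
    by (intro summable_on_cmult_right summable_iexp_cexp z) simp
  show ?thesis
  proof (rule summable_on_productI)
    fix p :: "int \<times> int" and n :: nat
    assume "p \<in> reduced_pairs"
    then obtain c d where p: "p = (c, d)" and c: "c \<ge> 1" by (auto simp: reduced_pairs_def)
    define x where "x = 4 * pi\<^sup>2 * real m * real n"
    have x: "x \<ge> 0" by (simp add: x_def)
    have "\<bar>x / (of_int c)\<^sup>2\<bar> \<le> x"
    proof -
      have "(1::real) \<le> (of_int c)\<^sup>2" using c by (simp add: one_le_power)
      hence "x / (of_int c)\<^sup>2 \<le> x / 1" using x by (intro divide_left_mono) auto
      thus ?thesis using x by simp
    qed
    hence "\<bar>bessel (k - 1) (x / (of_int c)\<^sup>2)\<bar> \<le> iexp (k - 1) x"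
      by (intro order_trans[OF abs_bessel_le] iexp_mono) auto
    hence "\<bar>inverse (of_int c)\<bar> ^ k * ((2 * pi) ^ k * real n ^ (k - 1) * \<bar>bessel (k - 1) (x / (of_int c)\<^sup>2)\<bar>) * norm (cexp (of_nat n * z)) \<le>
       \<bar>inverse (of_int c)\<bar> ^ k * ((2 * pi) ^ k * real n ^ (k - 1) * iexp (k - 1) x) * norm (cexp (of_nat n * z))"
      by (intro mult_right_mono mult_left_mono) auto
    thus "norm (case (p, n) of (p, n) \<Rightarrow> poincare_summand k m n p * cexp (of_nat n * z)) \<le>
        (case p of (c, d) \<Rightarrow> inverse (real_of_int c) ^ k) * u n"
      using c unfolding p prod.case norm_mult norm_poincare_summand x_def u_def by (simp add: mult_ac)
  next
    fix p :: "int \<times> int"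
    show "((\<lambda>n. (case p of (c, d) \<Rightarrow> inverse (real_of_int c) ^ k) * u n) has_sum
       (case p of (c, d) \<Rightarrow> inverse (real_of_int c) ^ k) * infsum u UNIV) UNIV"
      by (intro has_sum_cmult_right has_sum_infsum u)
  next
    show "(\<lambda>p. (case p of (c, d) \<Rightarrow> inverse (real_of_int c) ^ k) * infsum u UNIV) summable_on reduced_pairs"
      by (intro summable_on_cmult_left reduced_pairs_summable k)
  qed auto
qed

text \<open>The rows (0, 1) and (0, -1) give \<open>cexp (of_nat m * z)\<close>, the diagonal term
  of \<open>poincare_coeff\<close>. Rows with c < 0 repeat those with c > 0, and the latter are the
  translates (c, d + c j) of reduced rows, so \<open>poincare_term_translates\<close> and one
  interchange of sums suffice.\<close>

theorem poincare_expansion: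
  assumes z: "z \<in> upper_half" and k: "k \<ge> 4" "k mod 4 = 0"
  shows "(\<lambda>n. poincare_coeff k m n * cexp (of_nat n * z)) sums poincare k m z"
proof -
  have ev: "even k" using k(2) by presburger
  define pos where "pos = {(c, d). coprime c d \<and> 0 < (c::int)}"
  define neg where "neg = {(c, d). coprime c d \<and> (c::int) < 0}"
  let ?t = "poincare_term k m z"
  have sm: "?t summable_on coprime_pairs" by (rule poincare_term_summable[OF z k(1)])
  have sub: "pos \<subseteq> coprime_pairs" "neg \<subseteq> coprime_pairs" "{(0, 1), (0, - 1)} \<subseteq> coprime_pairs"
    by (auto simp: pos_def neg_def coprime_pairs_def)
  have dec: "coprime_pairs = ({(0, 1), (0, - 1)} \<union> pos) \<union> neg"
  proof -
    have "(c, d) \<in> {(0, 1), (0, - 1)} \<union> pos \<union> neg" if cop: "coprime c d" for c d :: int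
    proof (cases "c = 0")
      case True
      hence "\<bar>d\<bar> = 1" using cop by simp
      thus ?thesis using True by (auto simp: abs_if split: if_splits)
    qed (use cop in \<open>auto simp: pos_def neg_def\<close>)
    thus ?thesis using sub by (auto simp: coprime_pairs_def)
  qed
  define S where "S = infsum ?t pos"
  have pos_sum: "(?t has_sum S) pos"
    unfolding S_def by (intro has_sum_infsum summable_on_subset_banach[OF sm] sub)
  have neg_sum: "(?t has_sum S) neg"
  proof -
    have "(?t has_sum S) pos \<longleftrightarrow> (?t has_sum S) neg"
      by (rule has_sum_reindex_bij_witness[of _ "\<lambda>(c, d). (- c, - d)" "\<lambda>(c, d). (- c, - d)"])
        (auto simp: pos_def neg_def poincare_term_uminus[OF z _ ev])
    thus ?thesis using pos_sum by blast
  qed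
  have "?t (0, 1) = cexp (of_nat m * z)"
    using poincare_term_eq[OF z, of 1 1 0 0 k m] by simp
  moreover have "?t (0, - 1) = ?t (0, 1)" using poincare_term_uminus[OF z _ ev, of 0 1 m] by simp
  ultimately have "(?t has_sum (2 * cexp (of_nat m * z))) {(0, 1), (0, - 1)}"
    by (intro has_sum_finiteI) auto
  hence "(?t has_sum (2 * cexp (of_nat m * z) + S + S)) coprime_pairs"
    unfolding dec by (intro has_sum_Un_disjoint pos_sum neg_sum) (auto simp: pos_def neg_def)
  hence P: "poincare k m z = cexp (of_nat m * z) + S"
    by (simp add: poincare_def infsumI add_divide_distrib)
  have "((\<lambda>((c, d), j). ?t (c, d + c * j)) has_sum S) (reduced_pairs \<times> UNIV) \<longleftrightarrow> (?t has_sum S) pos"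
  proof (rule has_sum_reindex_bij_witness[of _ "\<lambda>(c, d). ((c, d mod c), d div c)" "\<lambda>((c :: int, d :: int), j :: int). (c, d + c * j)"], goal_cases)
    case (1 p)
    thus ?case by (auto simp: reduced_pairs_def)
  next
    case (2 p)
    have "coprime c (d + c * j) \<longleftrightarrow> coprime c d" for c d j :: int
      using gcd_add_mult[of c j d] by (simp add: coprime_iff_gcd_eq_1 mult.commute[of j] add.commute[of d])
    thus ?case using 2 by (auto simp: reduced_pairs_def pos_def)
  next
    case (3 q)
    thus ?case by (auto simp: pos_def)
  next
    case (4 q)
    thus ?case by (auto simp: reduced_pairs_def pos_def)
  next
    case (5 p)
    thus ?case by auto
  qed simp
  with pos_sum have "((\<lambda>((c, d), j). ?t (c, d + c * j)) has_sum S) (reduced_pairs \<times> UNIV)" by blast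
  hence rows: "((\<lambda>p. \<Sum>\<^sub>\<infinity>n. poincare_summand k m n p * cexp (of_nat n * z)) has_sum S) reduced_pairs"
  proof (rule has_sum_SigmaD, goal_cases)
    case (1 p)
    then obtain c d where p: "p = (c, d)" "c \<ge> 1" "coprime c d" by (auto simp: reduced_pairs_def)
    show ?case
      using poincare_term_translates[OF z p(2,3), of k m] k
      unfolding p(1) prod.case poincare_term_shift[OF z p(3)] by simp
  qed
  have sm2: "(\<lambda>(p, n). poincare_summand k m n p * cexp (of_nat n * z)) summable_on (reduced_pairs \<times> UNIV)"
    by (rule poincare_summand_summable[OF z k(1)])
  have "((\<lambda>n. (\<Sum>\<^sub>\<infinity>p\<in>reduced_pairs. poincare_summand k m n p) * cexp (of_nat n * z)) has_sum S) UNIV"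
  proof (rule infsum_swap_complex[OF sm2 _ _ rows])
    fix p assume "p \<in> reduced_pairs"
    hence "(\<lambda>n. poincare_summand k m n p * cexp (of_nat n * z)) summable_on UNIV"
      using summable_on_SigmaD1[OF sm2] by simp
    thus "((\<lambda>n. case (p, n) of (p, n) \<Rightarrow> poincare_summand k m n p * cexp (of_nat n * z)) has_sum
       (\<Sum>\<^sub>\<infinity>n. poincare_summand k m n p * cexp (of_nat n * z))) UNIV" by simp
  next
    fix n :: nat
    have "(\<lambda>p. poincare_summand k m n p * cexp (of_nat n * z)) summable_on reduced_pairs"
    proof -
      have "(\<lambda>(n, p). poincare_summand k m n p * cexp (of_nat n * z)) summable_on (UNIV \<times> reduced_pairs)"
        using sm2 by (subst summable_on_swap) simp
      from summable_on_SigmaD1[OF this, of n] show ?thesis by simp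
    qed
    hence "((\<lambda>p. poincare_summand k m n p * cexp (of_nat n * z)) has_sum
       (\<Sum>\<^sub>\<infinity>p\<in>reduced_pairs. poincare_summand k m n p * cexp (of_nat n * z))) reduced_pairs" by simp
    thus "((\<lambda>p. case (p, n) of (p, n) \<Rightarrow> poincare_summand k m n p * cexp (of_nat n * z)) has_sum
       (\<Sum>\<^sub>\<infinity>p\<in>reduced_pairs. poincare_summand k m n p) * cexp (of_nat n * z)) reduced_pairs"
      by (simp add: infsum_cmult_left')
  qed
  hence "(\<lambda>n. (\<Sum>\<^sub>\<infinity>p\<in>reduced_pairs. poincare_summand k m n p) * cexp (of_nat n * z)) sums S"
    by (rule has_sum_imp_sums)
  moreover have "(\<lambda>n. if n = m then cexp (of_nat n * z) else 0) sums cexp (of_nat m * z)"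
    by (rule sums_single)
  ultimately have "(\<lambda>n. (if n = m then cexp (of_nat n * z) else 0) +
      (\<Sum>\<^sub>\<infinity>p\<in>reduced_pairs. poincare_summand k m n p) * cexp (of_nat n * z)) sums (cexp (of_nat m * z) + S)"
    by (intro sums_add)
  also have "(\<lambda>n. (if n = m then cexp (of_nat n * z) else 0) +
      (\<Sum>\<^sub>\<infinity>p\<in>reduced_pairs. poincare_summand k m n p) * cexp (of_nat n * z)) =
      (\<lambda>n. poincare_coeff k m n * cexp (of_nat n * z))"
    by (auto simp: poincare_coeff_def algebra_simps)
  finally show ?thesis unfolding P .
qed

section \<open>Forms on the upper half-plane\<close>

lemma has_q_expansion_iff:
  "has_q_expansion f a \<longleftrightarrow> (\<forall>z\<in>upper_half. (\<lambda>n. a n * cexp (of_nat n * z)) sums f z)"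
  by (simp add: has_q_expansion_def cexp_def mult.assoc)

lemma cexp_surj:
  assumes "norm q < 1" "q \<noteq> 0"
  obtains z where "z \<in> upper_half" "cexp z = q" "norm q = exp (- 2 * pi * Im z)"
proof -
  define z where "z = ln q / (2 * of_real pi * \<i>)"
  have 1: "cexp z = q" using assms by (simp add: z_def cexp_def)
  hence 2: "norm q = exp (- 2 * pi * Im z)" using norm_cexp[of z] by simp
  hence "Im z > 0" using assms by (simp add: zero_less_mult_iff mult_less_0_iff)
  with 1 2 show ?thesis using that by (simp add: upper_half_def)
qed

context
  fixes f a
  assumes q: "has_q_expansion f a"
begin

lemma q_expansion_sums: "z \<in> upper_half \<Longrightarrow> (\<lambda>n. a n * cexp z ^ n) sums f z"
  using q by (simp add: has_q_expansion_iff cexp_power)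

lemma q_expansion_conv_radius: "fps_conv_radius (Abs_fps a) \<ge> 1"
  unfolding fps_conv_radius_def
proof (rule conv_radius_geI_ex)
  fix r :: real assume r: "0 < r" "ereal r < 1"
  have n: "norm (complex_of_real r) = r" using r by simp
  obtain z where "z \<in> upper_half" "cexp z = of_real r"
    using cexp_surj[of "of_real r"] r by auto
  with q_expansion_sums[of z] n show "\<exists>z. norm z = r \<and> summable (\<lambda>n. fps_nth (Abs_fps a) n * z ^ n)"
    by (intro exI[of _ "of_real r"]) (auto simp: sums_iff)
qed

lemma q_expansion_eval: "z \<in> upper_half \<Longrightarrow> f z = eval_fps (Abs_fps a) (cexp z)"
  using q_expansion_sums[of z] by (simp add: eval_fps_def sums_iff)

lemma unit_ball_conv_radius: "norm z < 1 \<Longrightarrow> (z :: complex) \<in> eball 0 (fps_conv_radius (Abs_fps a))"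
  using q_expansion_conv_radius by (simp add: in_eball_iff) (rule less_le_trans[of _ 1], auto)

lemma q_expansion_holomorphic: "f holomorphic_on upper_half"
proof -
  have "(\<lambda>z. eval_fps (Abs_fps a) (cexp z)) holomorphic_on upper_half"
  proof (rule holomorphic_on_compose_gen[of cexp _ "eval_fps (Abs_fps a)" "ball 0 1", unfolded o_def])
    show "cexp holomorphic_on upper_half" unfolding cexp_def [abs_def] by (intro holomorphic_intros)
    show "eval_fps (Abs_fps a) holomorphic_on ball 0 1"
      by (rule holomorphic_on_eval_fps) (use unit_ball_conv_radius in auto)
    show "cexp ` upper_half \<subseteq> ball 0 1" using norm_cexp_less_1 by auto
  qed
  thus ?thesis using q_expansion_eval by (simp cong: holomorphic_cong)
qed

lemma q_expansion_shift:
  assumes z: "z \<in> upper_half"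
  shows "f (z + of_int j) = f z"
proof -
  have "z + of_int j \<in> upper_half" using z by (simp add: upper_half_def)
  from q_expansion_sums[OF this] have "(\<lambda>n. a n * cexp z ^ n) sums f (z + of_int j)"
    by (simp add: cexp_add)
  with q_expansion_sums[OF z] show ?thesis using sums_unique2 by blast
qed

lemma q_expansion_abs_summable:
  assumes y: "y > 0"
  shows "summable (\<lambda>n. norm (a n) * exp (- 2 * pi * real n * y))"
proof -
  have "\<i> * of_real (y / 2) \<in> upper_half" using y by (simp add: upper_half_def)
  from q_expansion_sums[OF this] have "summable (\<lambda>n. a n * cexp (\<i> * of_real (y / 2)) ^ n)"
    by (simp add: sums_iff)
  moreover have "norm (cexp (\<i> * of_real y)) < norm (cexp (\<i> * of_real (y / 2)))"
    using y by (simp add: norm_cexp)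
  ultimately have "summable (\<lambda>n. norm (a n * cexp (\<i> * of_real y) ^ n))"
    by (rule powser_insidea)
  thus ?thesis
    by (simp add: norm_mult norm_cexp cexp_power mult_ac)
qed

lemma q_expansion_norm_le:
  assumes z: "z \<in> upper_half"
  shows "norm (f z) \<le> (\<Sum>n. norm (a n) * exp (- 2 * pi * real n * Im z))"
proof -
  have s: "summable (\<lambda>n. norm (a n * cexp z ^ n))"
    using q_expansion_abs_summable[of "Im z"] z
    by (simp add: norm_mult norm_cexp cexp_power mult_ac upper_half_def)
  have "norm (\<Sum>n. a n * cexp z ^ n) \<le> (\<Sum>n. norm (a n * cexp z ^ n))"
    by (rule summable_norm[OF s])
  thus ?thesis
    using q_expansion_sums[OF z] by (simp add: sums_iff norm_mult norm_cexp cexp_power mult_ac)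
qed

text \<open>Cauchy's inequality for the power series in q on the circle |q| = e^(-2 pi y), the image
  of the line Im z = y.\<close>

lemma q_expansion_coeff_bound:
  assumes y: "y > 0" and M: "\<And>z. Im z = y \<Longrightarrow> norm (f z) \<le> M"
  shows "norm (a n) \<le> M * exp (2 * pi * real n * y)"
proof -
  define r where "r = exp (- 2 * pi * y)"
  have r: "0 < r" "r < 1" using y by (auto simp: r_def)
  have sub: "cball (0 :: complex) r \<subseteq> eball 0 (fps_conv_radius (Abs_fps a))"
  proof
    fix x :: complex assume "x \<in> cball 0 r"
    hence "norm x < 1" using r by simp
    thus "x \<in> eball 0 (fps_conv_radius (Abs_fps a))" by (rule unit_ball_conv_radius)
  qed
  have "norm ((deriv ^^ n) (eval_fps (Abs_fps a)) 0) \<le> fact n * M / r ^ n"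
  proof (rule Cauchy_inequality)
    show "eval_fps (Abs_fps a) holomorphic_on ball 0 r"
      by (rule holomorphic_on_eval_fps) (use sub in auto)
    show "continuous_on (cball 0 r) (eval_fps (Abs_fps a))"
      by (rule continuous_on_eval_fps[THEN continuous_on_subset]) (use sub in auto)
    fix x :: complex assume x: "norm (0 - x) = r"
    hence "norm x < 1" "x \<noteq> 0" using r by auto
    then obtain z where z: "z \<in> upper_half" "cexp z = x" "norm x = exp (- 2 * pi * Im z)"
      by (rule cexp_surj)
    hence "Im z = y" using x by (simp add: r_def)
    with M q_expansion_eval[OF z(1)] z(2) show "norm (eval_fps (Abs_fps a) x) \<le> M" by metis
  qed (use r in auto)
  moreover have "(deriv ^^ n) (eval_fps (Abs_fps a)) 0 = fact n * a n"
  proof -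
    have "0 < fps_conv_radius (Abs_fps a)"
      by (rule less_le_trans[OF _ q_expansion_conv_radius]) simp
    from fps_nth_conv_deriv[OF this, of n] show ?thesis by simp
  qed
  ultimately have "fact n * norm (a n) \<le> fact n * (M / r ^ n)"
    by (simp add: norm_mult)
  hence "norm (a n) \<le> M / r ^ n" by (subst (asm) mult_le_cancel_left_pos) auto
  also have "M / r ^ n = M * exp (2 * pi * real n * y)"
    by (simp add: r_def exp_of_nat_mult[symmetric] exp_minus field_simps)
  finally show ?thesis .
qed

text \<open>A q-expansion on the half-plane already implies holomorphy and periodicity, so only the
  inversion is left to check.\<close>

lemma modular_formI:
  assumes "\<And>z. z \<in> upper_half \<Longrightarrow> f (- 1 / z) = z ^ k * f z"
  shows "modular_form k f"
  unfolding modular_form_def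
  using q q_expansion_holomorphic q_expansion_shift[of _ 1] assms by auto

end

lemma modular_form_inversion:
  "modular_form k f \<Longrightarrow> z \<in> upper_half \<Longrightarrow> f (- 1 / z) = z ^ k * f z"
  by (simp add: modular_form_def)

lemma poincare_modular_form:
  assumes "k \<ge> 4" "k mod 4 = 0"
  shows "has_q_expansion (poincare k m) (poincare_coeff k m)" "modular_form k (poincare k m)"
proof -
  show 1: "has_q_expansion (poincare k m) (poincare_coeff k m)"
    unfolding has_q_expansion_iff using poincare_expansion[OF _ assms] by blast
  show "modular_form k (poincare k m)"
    by (rule modular_formI[OF 1 poincare_inversion])
qed

lemma has_q_expansion_linear:
  assumes "has_q_expansion f a" "has_q_expansion g b"
  shows "has_q_expansion (\<lambda>z. f z - c * g z) (\<lambda>n. a n - c * b n)"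
  unfolding has_q_expansion_iff
proof
  fix z assume z: "z \<in> upper_half"
  have "(\<lambda>n. a n * cexp (of_nat n * z) - c * (b n * cexp (of_nat n * z))) sums (f z - c * g z)"
    using assms z unfolding has_q_expansion_iff by (intro sums_diff sums_mult) auto
  thus "(\<lambda>n. (a n - c * b n) * cexp (of_nat n * z)) sums (f z - c * g z)"
    by (simp add: algebra_simps)
qed

lemma modular_form_linear:
  assumes f: "modular_form k f" "has_q_expansion f a" and g: "modular_form k g" "has_q_expansion g b"
  shows "modular_form k (\<lambda>z. f z - c * g z)"
  by (rule modular_formI[OF has_q_expansion_linear[OF f(2) g(2)]])
    (simp add: modular_form_inversion[OF f(1)] modular_form_inversion[OF g(1)] algebra_simps del: divide_minus_left)

text \<open>Adding the reflection cnj(f(-cnj z)) conjugates the coefficients, and for even k the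
  reflection again has weight k. This supplies real forms from \<open>poincare\<close> without a
  proof that \<open>poincare_coeff\<close> is real.\<close>

lemma modular_form_real_part:
  assumes f: "modular_form k f" "has_q_expansion f a" and k: "even k"
  obtains g where "modular_form k g" "has_q_expansion g (\<lambda>n. of_real (Re (a n)))"
proof -
  define g where "g = (\<lambda>z. (f z + cnj (f (- cnj z))) / 2)"
  have c: "- cnj z \<in> upper_half" if "z \<in> upper_half" for z using that by (simp add: upper_half_def)
  have q: "has_q_expansion g (\<lambda>n. of_real (Re (a n)))"
    unfolding has_q_expansion_iff
  proof
    fix z assume z: "z \<in> upper_half"
    have "(\<lambda>n. a n * cexp (of_nat n * - cnj z)) sums f (- cnj z)"
      using f(2) c[OF z] unfolding has_q_expansion_iff by blast
    hence "(\<lambda>n. cnj (a n * cexp (of_nat n * - cnj z))) sums cnj (f (- cnj z))"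
      by (simp only: sums_cnj)
    moreover have "cnj (cexp (of_nat n * - cnj z)) = cexp (of_nat n * z)" for n
      by (simp add: cexp_def exp_cnj)
    ultimately have "(\<lambda>n. (a n * cexp (of_nat n * z) + cnj (a n) * cexp (of_nat n * z)) / 2) sums g z"
      unfolding g_def using f(2) z by (intro sums_divide sums_add) (auto simp: has_q_expansion_iff)
    moreover have "(x * w + cnj x * w) / 2 = of_real (Re x) * w" for x w :: complex
      using complex_add_cnj[of x] by (simp add: distrib_right[symmetric])
    ultimately show "(\<lambda>n. of_real (Re (a n)) * cexp (of_nat n * z)) sums g z" by simp
  qed
  moreover have "modular_form k g"
  proof (rule modular_formI[OF q])
    fix z assume z: "z \<in> upper_half"
    have "- cnj (- 1 / z) = - 1 / (- cnj z)" by simp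
    hence "cnj (f (- cnj (- 1 / z))) = cnj ((- cnj z) ^ k * f (- cnj z))"
      using modular_form_inversion[OF f(1) c[OF z]] by simp
    also have "\<dots> = z ^ k * cnj (f (- cnj z))" using k by simp
    finally show "g (- 1 / z) = z ^ k * g z"
      unfolding g_def modular_form_inversion[OF f(1) z] by (simp add: distrib_left)
  qed
  ultimately show ?thesis using that by blast
qed

section \<open>The relation from the inversion, and growth of coefficients\<close>

definition weight_seq :: "nat \<Rightarrow> real \<Rightarrow> nat \<Rightarrow> real" where
  "weight_seq k Y n = exp (- 2 * pi * real n / Y) - Y ^ k * exp (- 2 * pi * real n * Y)"

lemma weighted_sum_zero:
  assumes f: "modular_form k f" "has_q_expansion f (\<lambda>n. of_real (b n))" and k: "k mod 4 = 0" and Y: "Y > 0"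
  shows "(\<lambda>n. b n * weight_seq k Y n) sums 0" "summable (\<lambda>n. \<bar>b n * weight_seq k Y n\<bar>)"
proof -
  have s: "summable (\<lambda>n. \<bar>b n\<bar> * exp (- 2 * pi * real n * y))" if "y > 0" for y
    using q_expansion_abs_summable[OF f(2) that] by simp
  have s1: "summable (\<lambda>n. \<bar>b n\<bar> * exp (- 2 * pi * real n / Y))"
    using s[of "1 / Y"] Y by simp
  have "summable (\<lambda>n. \<bar>b n\<bar> * exp (- 2 * pi * real n / Y) + Y ^ k * (\<bar>b n\<bar> * exp (- 2 * pi * real n * Y)))"
    by (intro summable_add summable_mult s s1 Y)
  thus "summable (\<lambda>n. \<bar>b n * weight_seq k Y n\<bar>)"
  proof (rule summable_comparison_test'[of _ 0])
    fix n :: nat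
    have "\<bar>weight_seq k Y n\<bar> \<le> exp (- 2 * pi * real n / Y) + Y ^ k * exp (- 2 * pi * real n * Y)"
      unfolding weight_seq_def using Y by (intro order_trans[OF abs_triangle_ineq4]) (simp add: abs_mult)
    hence "\<bar>b n\<bar> * \<bar>weight_seq k Y n\<bar> \<le> \<bar>b n\<bar> * (exp (- 2 * pi * real n / Y) + Y ^ k * exp (- 2 * pi * real n * Y))"
      by (rule mult_left_mono) simp
    thus "norm \<bar>b n * weight_seq k Y n\<bar> \<le> \<bar>b n\<bar> * exp (- 2 * pi * real n / Y) + Y ^ k * (\<bar>b n\<bar> * exp (- 2 * pi * real n * Y))"
      by (simp add: abs_mult algebra_simps)
  qed
  define z where "z = \<i> * of_real Y"
  have z: "z \<in> upper_half" using Y by (simp add: z_def upper_half_def)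
  have S: "- 1 / z = \<i> * of_real (1 / Y)" using Y by (simp add: z_def field_simps)
  have zk: "z ^ k = of_real (Y ^ k)"
  proof -
    obtain r where r: "k = 4 * r" using k by (metis mod_0_imp_dvd dvd_def)
    have "\<i> ^ k = 1" unfolding r power_mult by simp
    thus ?thesis by (simp add: z_def power_mult_distrib)
  qed
  have e: "cexp (of_nat n * (\<i> * of_real y)) = of_real (exp (- 2 * pi * real n * y))" for n y
  proof -
    have "2 * of_real pi * \<i> * (of_nat n * (\<i> * of_real y)) = of_real (- 2 * pi * real n * y)" by simp
    thus ?thesis unfolding cexp_def by (simp only: exp_of_real)
  qed
  have 1: "(\<lambda>n. of_real (b n * exp (- 2 * pi * real n * y))) sums f (\<i> * of_real y)" if "y > 0" for y
  proof -
    have "\<i> * of_real y \<in> upper_half" using that by (simp add: upper_half_def)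
    with f(2) have "(\<lambda>n. of_real (b n) * cexp (of_nat n * (\<i> * of_real y))) sums f (\<i> * of_real y)"
      unfolding has_q_expansion_iff by blast
    thus ?thesis unfolding e by simp
  qed
  have "(\<lambda>n. of_real (b n * exp (- 2 * pi * real n * (1 / Y))) - of_real (Y ^ k) * of_real (b n * exp (- 2 * pi * real n * Y)))
      sums (f (- 1 / z) - of_real (Y ^ k) * f z)"
    unfolding S unfolding z_def using Y by (intro sums_diff sums_mult 1) auto
  hence "(\<lambda>n. complex_of_real (b n * weight_seq k Y n)) sums of_real 0"
    unfolding modular_form_inversion[OF f(1) z] zk by (simp add: weight_seq_def algebra_simps)
  thus "(\<lambda>n. b n * weight_seq k Y n) sums 0" unfolding sums_of_real_iff .
qed

text \<open>Every orbit of $\mathrm{SL}_2(\mathbb{Z})$ meets $\mathrm{Im}\, z \ge 1/2$; each inversion at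
  least doubles the imaginary part below that height.\<close>
lemma modular_form_bound:
  assumes f: "modular_form (2 * h) f"
    and M: "\<And>z. Im z \<ge> 1 / 2 \<Longrightarrow> Im z ^ h * norm (f z) \<le> M"
    and z: "z \<in> upper_half"
  shows "Im z ^ h * norm (f z) \<le> M"
proof -
  obtain a where q: "has_q_expansion f a" using f by (auto simp: modular_form_def)
  have "Im z ^ h * norm (f z) \<le> M" if "z \<in> upper_half" "Im z * 2 ^ N \<ge> 1 / 2" for N z
    using that
  proof (induction N arbitrary: z)
    case 0
    thus ?case using M by simp
  next
    case (Suc N z)
    show ?case
    proof (cases "Im z \<ge> 1 / 2")
      case False
      define w where "w = z + of_int (- round (Re z))"
      have w: "w \<in> upper_half" "Im w = Im z" "f w = f z"
        using Suc.prems(1) q_expansion_shift[OF q, of z "- round (Re z)"] by (auto simp: w_def upper_half_def)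
      have "\<bar>Re w\<bar> \<le> 1 / 2" using of_int_round_abs_le[of "Re z"] by (simp add: w_def abs_minus_commute)
      hence "(Re w)\<^sup>2 \<le> (1 / 2)\<^sup>2" by (metis abs_ge_zero power2_abs power_mono)
      moreover have "(Im w)\<^sup>2 \<le> (1 / 2)\<^sup>2" using False w Suc.prems(1) by (intro power_mono) (auto simp: upper_half_def)
      ultimately have n: "(norm w)\<^sup>2 \<le> 1 / 2"
        unfolding cmod_power2 power_divide one_power2 by simp
      have w0: "norm w > 0" using w(1) by (auto simp: upper_half_def)
      have I: "Im (- 1 / w) = Im z / (norm w)\<^sup>2"
        using w(2) by (simp add: Im_divide cmod_power2)
      have "Im z / (1 / 2) \<le> Im z / (norm w)\<^sup>2"
        using n w0 Suc.prems(1) by (intro divide_left_mono) (auto simp: upper_half_def)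
      hence "2 * Im z * 2 ^ N \<le> Im (- 1 / w) * 2 ^ N"
        unfolding I by (intro mult_right_mono) auto
      hence "1 / 2 \<le> Im (- 1 / w) * 2 ^ N" using Suc.prems(2) by simp
      from Suc.IH[OF upper_half_inversion[OF w(1)] this]
      have "(Im z / (norm w)\<^sup>2) ^ h * (norm w ^ (2 * h) * norm (f w)) \<le> M"
        unfolding I modular_form_inversion[OF f w(1)] norm_mult norm_power .
      thus ?thesis using w0 w(3) by (simp add: power_divide power_mult)
    qed (use M in blast)
  qed
  moreover obtain N where "1 / 2 / Im z < 2 ^ N" using real_arch_pow[of 2] by auto
  hence "1 / 2 \<le> Im z * 2 ^ N" using z by (simp add: upper_half_def field_simps)
  ultimately show ?thesis using z by blast
qed

lemma modular_form_coeff_bound: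
  assumes f: "modular_form (2 * h) f" "has_q_expansion f a" and h: "h > 0" and n: "n > 0"
    and M: "\<And>z. Im z \<ge> 1 / 2 \<Longrightarrow> Im z ^ h * norm (f z) \<le> M"
  shows "norm (a n) \<le> M * (2 * pi * exp 1 / real h) ^ h * real n ^ h"
proof -
  \<comment> \<open>The height that minimises y^(-h) e^(2 pi n y).\<close>
  define y where "y = real h / (2 * pi * real n)"
  have y: "y > 0" using h n by (simp add: y_def)
  have "norm (f z) \<le> M / y ^ h" if "Im z = y" for z
    using modular_form_bound[OF f(1) M, of z] that y by (simp add: upper_half_def field_simps)
  from q_expansion_coeff_bound[OF f(2) y this]
  have "norm (a n) \<le> M / y ^ h * exp (2 * pi * real n * y)" .
  also have "2 * pi * real n * y = real h * 1" using n by (simp add: y_def)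
  also have "exp (real h * 1) = exp 1 ^ h" by (rule exp_of_nat_mult)
  also have "M / y ^ h * exp 1 ^ h = M * (2 * pi * exp 1 / real h) ^ h * real n ^ h"
    by (simp add: y_def power_divide power_mult_distrib)
  finally show ?thesis .
qed

section \<open>First negative coefficients\<close>

lemma poincare_coeff_0: "k \<ge> 2 \<Longrightarrow> poincare_coeff k m 0 = of_bool (m = 0)"
  by (auto simp: poincare_coeff_def poincare_summand_def power_0_left case_prod_unfold)

text \<open>Only the pair (1, 0) is kept exactly. For c >= 2 the Bessel argument is at most a
  quarter of that for c = 1, so a hypothesis weaker by a factor 4 than the one in
  \<open>bessel_bounds\<close> still puts these arguments in range, where the Bessel values are at
  most 1 / (k - 1)!. The number of d for each c is handled by
  \<open>reduced_pairs_tail\<close>.\<close>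

lemma Re_poincare_coeff_ge:
  assumes k: "k \<ge> 4" and x: "4 * pi\<^sup>2 * real m * real n \<le> (real k)\<^sup>2"
  shows "Re (poincare_coeff k m n) \<ge> of_bool (n = m) + (2 * pi) ^ k * real n ^ (k - 1) *
    (bessel (k - 1) (4 * pi\<^sup>2 * real m * real n) - 8 / 2 ^ k / fact (k - 1))"
proof -
  let ?R = "reduced_pairs - {(1, 0)}" and ?s = "poincare_summand k m n"
  define T where "T = (2 * pi) ^ k * real n ^ (k - 1)"
  have T: "T \<ge> 0" by (simp add: T_def)
  have bd: "norm (?s p) \<le> T / fact (k - 1) * (case p of (c, d) \<Rightarrow> inverse (real_of_int c) ^ k)" if pR: "p \<in> ?R" for p
  proof -
    obtain c d where p: "p = (c, d)" by (cases p)
    have c: "c \<ge> 2"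
      using pR by (auto simp: p reduced_pairs_def)
    define X where "X = 4 * pi\<^sup>2 * real m * real n / (of_int c)\<^sup>2"
    have X0: "0 \<le> X" by (simp add: X_def)
    have "(2::real)\<^sup>2 \<le> (of_int c)\<^sup>2" using c by (intro power_mono) auto
    hence "X \<le> 4 * pi\<^sup>2 * real m * real n / 2\<^sup>2"
      unfolding X_def using c by (intro divide_left_mono) auto
    hence X: "4 * X \<le> (real (k - 1) + 1)\<^sup>2" using x k by (simp add: of_nat_diff)
    have "\<bar>bessel (k - 1) X\<bar> \<le> 1 / fact (k - 1)"
      using bessel_bounds(2)[OF X0 X] bessel_ratio[OF X0 X] by simp
    hence "\<bar>inverse (of_int c)\<bar> ^ k * (T * \<bar>bessel (k - 1) X\<bar>) \<le> \<bar>inverse (of_int c)\<bar> ^ k * (T * (1 / fact (k - 1)))"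
      by (intro mult_left_mono) (use T in auto)
    thus ?thesis using c unfolding p norm_poincare_summand X_def[symmetric] T_def[symmetric]
      by (simp add: mult_ac)
  qed
  have sm: "(\<lambda>p. T / fact (k - 1) * (case p of (c, d) \<Rightarrow> inverse (real_of_int c) ^ k)) summable_on ?R"
    by (intro summable_on_cmult_right reduced_pairs_tail k)
  have abs: "(\<lambda>p. norm (?s p)) summable_on ?R"
    by (rule Infinite_Sum.abs_summable_on_comparison_test'[OF sm bd])
  have "norm (infsum ?s ?R) \<le> (\<Sum>\<^sub>\<infinity>p\<in>?R. norm (?s p))"
    by (rule norm_infsum_bound[OF abs])
  also have "\<dots> \<le> (\<Sum>\<^sub>\<infinity>p\<in>?R. T / fact (k - 1) * (case p of (c, d) \<Rightarrow> inverse (real_of_int c) ^ k))"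
    by (rule infsum_mono[OF abs sm bd])
  also have "\<dots> = T / fact (k - 1) * (\<Sum>\<^sub>\<infinity>(c, d)\<in>?R. inverse (real_of_int c) ^ k)"
    by (rule infsum_cmult_right')
  also have "\<dots> \<le> T / fact (k - 1) * (8 / 2 ^ k)"
    by (intro mult_left_mono reduced_pairs_tail k) (use T in auto)
  finally have tail: "- (T / fact (k - 1) * (8 / 2 ^ k)) \<le> Re (infsum ?s ?R)"
    using abs_Re_le_cmod[of "infsum ?s ?R"] by linarith
  have "infsum ?s reduced_pairs = infsum ?s (insert (1, 0) ?R)"
    using reduced_pairs_insert by simp
  also have "\<dots> = ?s (1, 0) + infsum ?s ?R"
    by (rule infsum_insert[OF abs_summable_summable[OF abs]]) simp
  finally have "Re (poincare_coeff k m n) = of_bool (n = m) + Re (?s (1, 0)) + Re (infsum ?s ?R)"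
    by (simp add: poincare_coeff_def)
  moreover have "?s (1, 0) = of_real (T * bessel (k - 1) (4 * pi\<^sup>2 * real m * real n))"
    using cexp_mult_int[of "int m"] by (simp add: poincare_summand_def T_def)
  hence "Re (?s (1, 0)) = T * bessel (k - 1) (4 * pi\<^sup>2 * real m * real n)" by simp
  moreover have "T * (bessel (k - 1) (4 * pi\<^sup>2 * real m * real n) - 8 / 2 ^ k / fact (k - 1)) =
      T * bessel (k - 1) (4 * pi\<^sup>2 * real m * real n) - T / fact (k - 1) * (8 / 2 ^ k)"
    by (simp add: algebra_simps)
  ultimately show ?thesis using tail unfolding T_def[symmetric] by linarith
qed

text \<open>For m = 0 every Bessel argument vanishes, and \<open>bessel (k - 1) 0\<close> is 1 / (k
  - 1)!; the pair (1, 0) thus gives the 1 in the last factor and all other pairs at most 8 /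
  2^k.\<close>

lemma eisenstein_coeff_ge:
  assumes "k \<ge> 4"
  shows "Re (poincare_coeff k 0 n) \<ge> (2 * pi) ^ k * real n ^ (k - 1) / fact (k - 1) * (1 - 8 / 2 ^ k)"
proof -
  have "of_bool (n = 0) + (2 * pi) ^ k * real n ^ (k - 1) * (1 / fact (k - 1) - 8 / 2 ^ k / fact (k - 1)) \<le> Re (poincare_coeff k 0 n)"
    using Re_poincare_coeff_ge[OF assms, of 0 n] by simp
  moreover have "(2 * pi) ^ k * real n ^ (k - 1) / fact (k - 1) * (1 - 8 / 2 ^ k) =
      (2 * pi) ^ k * real n ^ (k - 1) * (1 / fact (k - 1) - 8 / 2 ^ k / fact (k - 1))"
    by (simp add: field_simps)
  moreover have "(0 :: real) \<le> of_bool (n = 0)" by simp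
  ultimately show ?thesis by linarith
qed

lemma exp_half_le: "exp (1 / 2 :: real) \<le> 5 / 3"
proof (rule power_le_imp_le_base[where n = 1])
  have "exp (1 / 2 :: real) ^ 2 = exp 1" by (simp flip: exp_of_nat_mult)
  also have "\<dots> \<le> (5 / 3) ^ 2" using e_less_272 by (simp add: power2_eq_square)
  finally show "exp (1 / 2 :: real) ^ Suc 1 \<le> (5 / 3) ^ Suc 1" by (simp add: numeral_2_eq_2)
qed simp

text \<open>With x = 4 pi^2 n the hypothesis gives 2 x / k <= (k - 1) / 2, so
  \<open>bessel_bounds\<close> yields a main term of at least e^(-(k-1)/2) / (k - 1)!. It beats the
  tail 8 / 2^k because sqrt e <= 5/3 and (6/5)^11 > 4.\<close>

lemma poincare_coeff_pos:
  assumes k: "k \<ge> 12" and n: "n > 0" "16 * pi\<^sup>2 * real n \<le> (real k - 1)\<^sup>2"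
  shows "Re (poincare_coeff k 1 n) > 0"
proof -
  define x where "x = 4 * pi\<^sup>2 * real n"
  have x0: "x \<ge> 0" by (simp add: x_def)
  have x1: "4 * x \<le> (real k - 1)\<^sup>2" using n by (simp add: x_def)
  have "(real k - 1)\<^sup>2 \<le> (real k)\<^sup>2" using k by (intro power_mono) auto
  hence x2: "4 * x \<le> (real k)\<^sup>2" using x1 by linarith
  hence x3: "4 * x \<le> (real (k - 1) + 1)\<^sup>2" using k by (simp add: of_nat_diff)
  have "2 * x / real k \<le> (real k - 1) / 2"
  proof -
    have "4 * x \<le> (real k - 1) * (real k - 1)" using x1 by (simp add: power2_eq_square)
    also have "\<dots> \<le> (real k - 1) * real k" using k by (intro mult_left_mono) auto
    finally show ?thesis using k by (simp add: field_simps)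
  qed
  hence "exp (- (real (k - 1) * (1 / 2))) \<le> exp (- (2 * x / real k))" using k by (simp add: of_nat_diff)
  also have "\<dots> / fact (k - 1) \<le> bessel (k - 1) x"
    using bessel_bounds(1)[OF x0 x3] k by (simp add: of_nat_diff)
  finally have 1: "exp (- (real (k - 1) * (1 / 2))) / fact (k - 1) \<le> bessel (k - 1) x"
    by (simp add: divide_right_mono order_trans)
  have "8 / 2 ^ k < exp (- (real (k - 1) * (1 / 2)))"
  proof -
    have "(8::real) * exp (real (k - 1) * (1 / 2)) = 8 * exp (1 / 2) ^ (k - 1)"
      by (simp only: exp_of_nat_mult)
    also have "\<dots> \<le> 8 * (5 / 3) ^ (k - 1)"
      by (intro mult_left_mono power_mono exp_half_le) auto
    also have "\<dots> < 2 * 2 ^ (k - 1)"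
    proof -
      have "(4::real) < (6 / 5) ^ 11" by (simp add: power_numeral_reduce)
      also have "\<dots> \<le> (6 / 5) ^ (k - 1)" using k by (intro power_increasing) auto
      finally have "4 * (5 / 3) ^ (k - 1) < (6 / 5) ^ (k - 1) * (5 / 3 :: real) ^ (k - 1)"
        by (rule mult_strict_right_mono) simp
      also have "\<dots> = 2 ^ (k - 1)" by (simp flip: power_mult_distrib)
      finally show ?thesis by simp
    qed
    also have "\<dots> = 2 ^ k" using k by (simp flip: power_Suc)
    finally show ?thesis by (simp add: exp_minus field_simps)
  qed
  hence "8 / 2 ^ k / fact (k - 1) < exp (- (real (k - 1) * (1 / 2))) / fact (k - 1)"
    by (rule divide_strict_right_mono) simp
  hence "0 < (2 * pi) ^ k * real n ^ (k - 1) * (bessel (k - 1) x - 8 / 2 ^ k / fact (k - 1))"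
    using 1 n by (intro mult_pos_pos) auto
  moreover have "x \<le> (real k)\<^sup>2" using x2 x0 by linarith
  hence "of_bool (n = 1) + (2 * pi) ^ k * real n ^ (k - 1) * (bessel (k - 1) x - 8 / 2 ^ k / fact (k - 1)) \<le>
      Re (poincare_coeff k 1 n)"
    using Re_poincare_coeff_ge[of k 1 n] k by (simp add: x_def)
  moreover have "(0 :: real) \<le> of_bool (n = 1)" by simp
  ultimately show ?thesis by linarith
qed

text \<open>For k >= 16 one has 16 pi^2 <= 15^2 and \<open>poincare_coeff_pos\<close> applies. For k
  = 12 it does not, as 16 pi^2 > 11^2: there \<open>bessel_pos\<close> gives only a positive main
  term, and the diagonal term 1 absorbs the tail.\<close>

lemma poincare_coeff_one_pos:
  assumes k: "k \<ge> 12" "k mod 4 = 0"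
  shows "Re (poincare_coeff k 1 1) > 0"
proof (cases "k = 12")
  case False
  hence "k \<ge> 16" using k by presburger
  have "pi\<^sup>2 \<le> (3.2)\<^sup>2" using pi_approx by (intro power_mono) auto
  hence "16 * pi\<^sup>2 \<le> 15\<^sup>2" by (simp add: power2_eq_square)
  also have "\<dots> \<le> (real k - 1)\<^sup>2" using \<open>k \<ge> 16\<close> by (intro power_mono) auto
  finally show ?thesis using poincare_coeff_pos[of k 1] k by simp
next
  case True
  have pi2: "pi\<^sup>2 \<le> (3.15)\<^sup>2" using pi_approx by (intro power_mono) auto
  have "bessel 11 (4 * pi\<^sup>2) > 0"
    by (rule bessel_pos) (use pi2 in \<open>auto simp: power2_eq_square\<close>)
  moreover have "1 + (2 * pi) ^ 12 * (bessel 11 (4 * pi\<^sup>2) - 8 / 2 ^ 12 / fact 11) \<le> Re (poincare_coeff 12 1 1)"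
    using Re_poincare_coeff_ge[of 12 1 1] pi2 by (simp add: power2_eq_square)
  moreover have "(2 * pi) ^ 12 * (8 / 2 ^ 12 / fact 11) < 1"
  proof -
    have "(2 * pi) ^ 12 \<le> 6.3 ^ 12" using pi_approx by (intro power_mono) auto
    hence "(2 * pi) ^ 12 * (8 / 2 ^ 12 / fact 11) \<le> 6.3 ^ 12 * (8 / 2 ^ 12 / fact 11)"
      by (rule mult_right_mono) simp
    also have "\<dots> < 1" by (simp add: fact_numeral power_numeral_reduce)
    finally show ?thesis .
  qed
  moreover have "0 < (2 * pi) ^ 12 * bessel 11 (4 * pi\<^sup>2)" using calculation(1) by simp
  ultimately show ?thesis unfolding True right_diff_distrib by linarith
qed

section \<open>Positivity of the weights and the comparison with the Eisenstein series\<close>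

lemma weight_seq_le: "Y > 0 \<Longrightarrow> weight_seq k Y n \<le> exp (- 2 * pi * real n / Y)"
  by (simp add: weight_seq_def)

text \<open>The second exponential in \<open>weight_seq\<close> is Y^k e^(-n t) times the first,
  with t = 2 pi (Y - 1/Y) >= 0. So n = 1 is the worst case, and d bounds the relative loss for every
  n.\<close>

lemma weight_seq_ge:
  assumes Y: "Y \<ge> 1" and d: "Y ^ k * exp (- 2 * pi * (Y - 1 / Y)) \<le> d" and n: "n > 0"
  shows "(1 - d) * exp (- 2 * pi * real n / Y) \<le> weight_seq k Y n"
proof -
  define t where "t = 2 * pi * (Y - 1 / Y)"
  have "1 / Y \<le> 1" using Y by simp
  hence "1 / Y \<le> Y" using Y by linarith
  hence t: "t \<ge> 0" by (simp add: t_def)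
  have "real n * t \<ge> 1 * t" using n t by (intro mult_right_mono) auto
  hence "exp (- (real n * t)) \<le> exp (- t)" by simp
  hence "Y ^ k * exp (- (real n * t)) \<le> Y ^ k * exp (- t)" using Y by (intro mult_left_mono) auto
  also have "\<dots> \<le> d" using d by (simp add: t_def)
  finally have 1: "exp (- 2 * pi * real n / Y) * (Y ^ k * exp (- (real n * t))) \<le> exp (- 2 * pi * real n / Y) * d"
    by (rule mult_left_mono) simp
  have "- 2 * pi * real n * Y = - 2 * pi * real n / Y + - (real n * t)"
    by (simp add: t_def algebra_simps)
  hence "exp (- 2 * pi * real n * Y) = exp (- 2 * pi * real n / Y) * exp (- (real n * t))"
    by (simp only: exp_add)
  thus ?thesis using 1 by (simp add: weight_seq_def algebra_simps)
qed

lemma cusp_form_nonneg_imp_zero: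
  assumes f: "modular_form k f" "has_q_expansion f (\<lambda>n. of_real (b n))" and k: "k mod 4 = 0"
    and b: "b 0 = 0" "\<And>n. b n \<ge> 0"
    and Y: "Y \<ge> 1" "Y ^ k * exp (- 2 * pi * (Y - 1 / Y)) < 1"
  shows "b n = 0"
proof -
  have w: "weight_seq k Y n > 0" if "n > 0" for n
  proof -
    have "0 < (1 - Y ^ k * exp (- 2 * pi * (Y - 1 / Y))) * exp (- 2 * pi * real n / Y)" using Y by simp
    also have "\<dots> \<le> weight_seq k Y n" by (rule weight_seq_ge[OF Y(1) order_refl that])
    finally show ?thesis .
  qed
  have nn: "b n * weight_seq k Y n \<ge> 0" for n using w[of n] b by (cases "n = 0") auto
  have "(\<lambda>n. b n * weight_seq k Y n) sums 0" using weighted_sum_zero(1)[OF f k] Y by simp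
  hence "b n * weight_seq k Y n = 0"
    using suminf_eq_zero_iff[OF _ nn] by (auto simp: sums_iff)
  thus ?thesis using w[of n] b by (cases "n = 0") auto
qed

text \<open>t^h e^(-t) is largest at t = h; this is 1 + u <= e^u for u = t/h - 1, raised to the
  power h.\<close>

lemma power_times_exp_le:
  assumes h: "h > 0" and t: "t \<ge> 0"
  shows "t ^ h * exp (- t) \<le> (real h / exp 1) ^ h"
proof -
  have "t / real h \<le> exp (t / real h - 1)" using exp_ge_add_one_self[of "t / real h - 1"] by simp
  hence "(t / real h) ^ h \<le> exp (t / real h - 1) ^ h" using t by (intro power_mono) auto
  also have "\<dots> = exp (real h * (t / real h - 1))" by (rule exp_of_nat_mult[symmetric])
  also have "real h * (t / real h - 1) = t + - (real h * 1)" using h by (simp add: algebra_simps)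
  also have "exp \<dots> = exp t * inverse (exp 1 ^ h)" by (simp only: exp_add exp_minus exp_of_nat_mult)
  finally show ?thesis using h by (simp add: power_divide exp_minus field_simps)
qed

text \<open>\<open>D\<close> is the constant of the coefficient bound \<open>b_le\<close>. The
  hypothesis \<open>tail\<close> lets the terms from r on be absorbed into S, and
  \<open>large\<close> lets the Eisenstein coefficient at r dominate the cuspidal one.\<close>

lemma first_negative_coeff_contradiction:
  assumes k: "k = 2 * h" "k mod 4 = 0" "k \<ge> 4"
    and f: "modular_form k f" "has_q_expansion f (\<lambda>n. of_real (a n))"
    and r: "r > 0" "a r < 0" "\<And>m. m < r \<Longrightarrow> a m \<ge> 0"
    and Y: "Y \<ge> 2" and d: "Y ^ k * exp (- 2 * pi * (Y - 1 / Y)) \<le> d" "d < 1"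
    and D: "D = exp (2 * pi / Y) / (1 - d)"
    and tail: "\<And>n. n \<ge> r \<Longrightarrow> D * real n ^ h * exp (- 2 * pi * real n / Y) \<le> 1 / (40 * (real n)\<^sup>2)"
    and large: "(20 / 9) * D * Y ^ k \<le> (2 * pi) ^ k * real r ^ (h - 1) / fact (k - 1) * (1 - 8 / 2 ^ k)"
  shows False
proof -
  define e where "e = (\<lambda>n. Re (poincare_coeff k 0 n))"
  define w where "w = weight_seq k Y"
  have h: "h > 0" using k by simp
  have "even k" using k by simp
  obtain E where E: "modular_form k E" "has_q_expansion E (\<lambda>n. of_real (e n))"
    using modular_form_real_part[OF poincare_modular_form(2,1)[OF k(3,2)] \<open>even k\<close>] unfolding e_def by blast
  have e0: "e 0 = 1" using k by (simp add: e_def poincare_coeff_0)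
  have "8 / 2 ^ k \<le> (1 :: real)"
  proof -
    have "(2::real) ^ 3 \<le> 2 ^ k" using k by (intro power_increasing) auto
    thus ?thesis by simp
  qed
  hence e_nn: "e n \<ge> 0" for n
    using eisenstein_coeff_ge[OF k(3), of n] unfolding e_def by (intro order_trans[OF _ eisenstein_coeff_ge[OF k(3)]]) auto
  define b where "b = (\<lambda>n. a n - a 0 * e n)"
  define g where "g = (\<lambda>z. f z - of_real (a 0) * E z)"
  have g: "modular_form k g" "has_q_expansion g (\<lambda>n. of_real (b n))"
    using modular_form_linear[OF f E, of "of_real (a 0)"] has_q_expansion_linear[OF f(2) E(2), of "of_real (a 0)"]
    by (simp_all add: g_def b_def)
  have a0: "a 0 \<ge> 0" using r by simp
  have b0: "b 0 = 0" by (simp add: b_def e0)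
  have D0: "D > 0" using D d by simp
  have Y0: "Y > 0" "Y \<ge> 1" using Y by auto
  have w_le: "w n \<le> exp (- 2 * pi * real n / Y)" for n
    unfolding w_def by (rule weight_seq_le[OF Y0(1)])
  have w_ge: "(1 - d) * exp (- 2 * pi * real n / Y) \<le> w n" if "n > 0" for n
    unfolding w_def by (rule weight_seq_ge[OF Y0(2) d(1) that])
  have w_pos: "w n > 0" if "n > 0" for n
    using w_ge[OF that] d(2) by (smt (verit) exp_gt_zero mult_pos_pos)
  define S where "S = (\<Sum>n. \<bar>b n * w n\<bar>)"
  have S_sum: "(\<lambda>n. \<bar>b n * w n\<bar>) sums S"
    unfolding S_def w_def by (rule summable_sums[OF weighted_sum_zero(2)[OF g k(2) Y0(1)]])
  have S0: "S \<ge> 0" by (rule sums_le[OF _ sums_zero S_sum]) simp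
  have b_le: "\<bar>b n\<bar> \<le> D * S * real n ^ h" if n: "n > 0" for n
  proof -
    \<comment> \<open>The first factor is the reciprocal of the one produced by
      \<open>modular_form_coeff_bound\<close>; the two cancel and leave D.\<close>
    define K where "K = (real h / (2 * pi * exp 1)) ^ h * D"
    have "Im z ^ h * norm (g z) \<le> K * S" if z: "Im z \<ge> 1 / 2" for z
    proof -
      have zH: "z \<in> upper_half" using z by (simp add: upper_half_def)
      define y where "y = Im z"
      have y: "y \<ge> 1 / 2" using z by (simp add: y_def)
      have "1 / Y \<le> 1 / 2" using Y by (intro divide_left_mono) auto
      hence yY: "1 / Y \<le> y" using y by linarith
      \<comment> \<open>One factor e^(-2 pi y) is spent on y^h; the other n - 1 are compared with
        the height 1 / Y, which is at most 1/2 because Y >= 2. Restoring n factors there costs e^(2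
        pi / Y), the numerator of D.\<close>
      have termwise: "y ^ h * (\<bar>b n\<bar> * exp (- 2 * pi * real n * y)) \<le> K * \<bar>b n * w n\<bar>" for n
      proof (cases "n = 0")
        case False
        hence n: "n > 0" by simp
        have "(2 * pi * y) ^ h * exp (- (2 * pi * y)) \<le> (real h / exp 1) ^ h"
          using y by (intro power_times_exp_le h) auto
        hence 1: "y ^ h * exp (- 2 * pi * y) \<le> (real h / (2 * pi * exp 1)) ^ h"
          by (simp add: power_mult_distrib power_divide field_simps)
        have "(real n - 1) * (1 / Y) \<le> (real n - 1) * y" using n yY by (intro mult_left_mono) auto
        hence "2 * pi * ((real n - 1) * (1 / Y)) \<le> 2 * pi * ((real n - 1) * y)" by (rule mult_left_mono) simp
        hence 2: "exp (- 2 * pi * ((real n - 1) * y)) \<le> exp (- 2 * pi * ((real n - 1) * (1 / Y)))"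
          by (simp only: exp_le_cancel_iff mult_minus_left neg_le_iff_le)
        have "y ^ h * exp (- 2 * pi * real n * y) = (y ^ h * exp (- 2 * pi * y)) * exp (- 2 * pi * ((real n - 1) * y))"
          unfolding mult.assoc exp_add[symmetric] by (simp add: algebra_simps)
        also have "\<dots> \<le> (real h / (2 * pi * exp 1)) ^ h * exp (- 2 * pi * ((real n - 1) * (1 / Y)))"
          by (intro mult_mono 1 2) auto
        also have "exp (- 2 * pi * ((real n - 1) * (1 / Y))) = exp (2 * pi / Y) * exp (- 2 * pi * real n / Y)"
          unfolding exp_add[symmetric] using Y0 by (simp add: field_simps)
        also have "\<dots> = D * ((1 - d) * exp (- 2 * pi * real n / Y))" using d by (simp add: D)
        also have "(real h / (2 * pi * exp 1)) ^ h * (D * ((1 - d) * exp (- 2 * pi * real n / Y))) \<le>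
            (real h / (2 * pi * exp 1)) ^ h * (D * w n)"
          by (intro mult_left_mono w_ge n) (use D0 in auto)
        also have "\<dots> = K * w n" by (simp add: K_def)
        finally have "\<bar>b n\<bar> * (y ^ h * exp (- 2 * pi * real n * y)) \<le> \<bar>b n\<bar> * (K * w n)"
          by (rule mult_left_mono) simp
        thus ?thesis using w_pos[OF n] by (simp add: abs_mult mult_ac)
      qed (simp add: b0)
      have "norm (g z) \<le> (\<Sum>n. \<bar>b n\<bar> * exp (- 2 * pi * real n * y))"
        using q_expansion_norm_le[OF g(2) zH] by (simp add: y_def)
      hence "y ^ h * norm (g z) \<le> y ^ h * (\<Sum>n. \<bar>b n\<bar> * exp (- 2 * pi * real n * y))"
        using y by (intro mult_left_mono) auto
      also have s: "summable (\<lambda>n. \<bar>b n\<bar> * exp (- 2 * pi * real n * y))"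
        using q_expansion_abs_summable[OF g(2), of y] y by simp
      have "y ^ h * (\<Sum>n. \<bar>b n\<bar> * exp (- 2 * pi * real n * y)) =
          (\<Sum>n. y ^ h * (\<bar>b n\<bar> * exp (- 2 * pi * real n * y)))"
        by (rule suminf_mult[OF s, symmetric])
      also have "\<dots> \<le> K * S"
        by (rule sums_le[OF termwise summable_sums[OF summable_mult[OF s]] sums_mult[OF S_sum]])
      finally show ?thesis by (simp add: y_def)
    qed
    from modular_form_coeff_bound[OF g(1)[unfolded k(1)] g(2) h n this]
    have "\<bar>b n\<bar> \<le> K * S * (2 * pi * exp 1 / real h) ^ h * real n ^ h" by simp
    also have "\<dots> = ((real h / (2 * pi * exp 1)) * (2 * pi * exp 1 / real h)) ^ h * (D * S * real n ^ h)"
      unfolding K_def power_mult_distrib by simp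
    also have "(real h / (2 * pi * exp 1)) * (2 * pi * exp 1 / real h) = 1" using h by simp
    finally show ?thesis by simp
  qed
  have e_sum: "(\<lambda>n. if n = 0 then 0 else e n * w n) sums (Y ^ k - 1)"
  proof -
    have "(\<lambda>n. e n * w n) sums 0" unfolding w_def by (rule weighted_sum_zero(1)[OF E k(2) Y0(1)])
    from sums_diff[OF this sums_single[of 0 "\<lambda>n. e n * w n"]]
    have "(\<lambda>n. e n * w n - (if n = 0 then e n * w n else 0)) sums (0 - e 0 * w 0)" .
    moreover have "0 - e 0 * w 0 = Y ^ k - 1" by (simp add: e0 w_def weight_seq_def)
    ultimately show ?thesis by (simp add: if_distrib cong: if_cong)
  qed
  \<comment> \<open>The term at n = 0 is 1 / 0 = 0, so the series may start there.\<close>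
  have sq: "(\<lambda>n. 1 / (real n)\<^sup>2) sums (pi\<^sup>2 / 6)"
  proof -
    have "(\<lambda>n. 1 / (real (Suc n))\<^sup>2) sums (pi\<^sup>2 / 6)"
      using inverse_squares_sums by simp
    thus ?thesis by (subst (asm) sums_Suc_iff) simp
  qed
  \<comment> \<open>Below r, b(n) >= -a(0) e(n) gives |b(n)| <= b(n) + 2 a(0) e(n). From r on no
    sign is known: there 2 |b(n)| w(n) is bounded by \<open>tail\<close>, whose 1/40 becomes
    1/20.\<close>
  have pointwise: "\<bar>b n * w n\<bar> \<le> b n * w n + 2 * a 0 * (if n = 0 then 0 else e n * w n) + S / 20 * (1 / (real n)\<^sup>2)" for n
  proof (cases "n = 0")
    case True
    thus ?thesis by (simp add: b0)
  next
    case False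
    hence n: "n > 0" and w: "w n > 0" using w_pos by auto
    have ew: "0 \<le> a 0 * (e n * w n)" using a0 e_nn[of n] w by simp
    have abs: "\<bar>b n * w n\<bar> = \<bar>b n\<bar> * w n" using w by (simp add: abs_mult)
    show ?thesis
    proof (cases "n < r")
      case True
      hence "\<bar>b n\<bar> \<le> b n + 2 * (a 0 * e n)" using r(3)[OF True] a0 e_nn[of n] by (auto simp: b_def abs_if)
      hence "\<bar>b n\<bar> * w n \<le> (b n + 2 * (a 0 * e n)) * w n" using w by (intro mult_right_mono) auto
      moreover have "0 \<le> S / 20 * (1 / (real n)\<^sup>2)" using S0 by simp
      ultimately show ?thesis unfolding abs using n by (simp add: algebra_simps)
    next
      case ge: False
      have "\<bar>b n\<bar> * w n \<le> (D * S * real n ^ h) * exp (- 2 * pi * real n / Y)"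
        using w w_le D0 S0 by (intro mult_mono b_le n) auto
      also have "\<dots> = S * (D * real n ^ h * exp (- 2 * pi * real n / Y))" by simp
      also have "\<dots> \<le> S * (1 / (40 * (real n)\<^sup>2))" using ge by (intro mult_left_mono tail S0) auto
      finally have 1: "2 * (\<bar>b n\<bar> * w n) \<le> S / 20 * (1 / (real n)\<^sup>2)" by (simp add: field_simps)
      have "- (b n * w n) \<le> \<bar>b n\<bar> * w n" using w by (metis abs abs_ge_minus_self)
      thus ?thesis unfolding abs using 1 ew n by simp
    qed
  qed
  \<comment> \<open>Summing, the relation for g gives 0 and the relation for E_k gives Y^k - 1. The
    last term is at most S / 10, and moving it to the left produces the 20/9 in
    \<open>large\<close>.\<close>
  have "S \<le> 0 + 2 * a 0 * (Y ^ k - 1) + S / 20 * (pi\<^sup>2 / 6)"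
    by (rule sums_le[OF pointwise S_sum]) (intro sums_add sums_mult sq e_sum weighted_sum_zero(1)[OF g k(2) Y0(1), folded w_def])
  also have "S / 20 * (pi\<^sup>2 / 6) \<le> S / 20 * 2"
  proof (rule mult_left_mono)
    have "pi\<^sup>2 \<le> (3.2)\<^sup>2" using pi_approx by (intro power_mono) auto
    thus "pi\<^sup>2 / 6 \<le> 2" by (simp add: power2_eq_square)
  qed (use S0 in simp)
  finally have "9 / 10 * S \<le> 2 * a 0 * (Y ^ k - 1)" by simp
  also have "\<dots> \<le> 2 * a 0 * Y ^ k" using a0 by (intro mult_left_mono) auto
  finally have S_le: "S \<le> 20 / 9 * a 0 * Y ^ k" by simp
  have "a 0 * e r < \<bar>b r\<bar>" using r(2) a0 e_nn[of r] by (auto simp: b_def abs_if)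
  also have "\<dots> \<le> D * S * real r ^ h" by (rule b_le[OF r(1)])
  also have "\<dots> \<le> D * (20 / 9 * a 0 * Y ^ k) * real r ^ h"
    using D0 by (intro mult_right_mono mult_left_mono S_le) auto
  also have "\<dots> = a 0 * real r ^ h * (20 / 9 * D * Y ^ k)" by simp
  also have "\<dots> \<le> a 0 * real r ^ h * ((2 * pi) ^ k * real r ^ (h - 1) / fact (k - 1) * (1 - 8 / 2 ^ k))"
    by (intro mult_left_mono large) (use a0 in auto)
  also have "\<dots> = a 0 * ((2 * pi) ^ k * (real r ^ h * real r ^ (h - 1)) / fact (k - 1) * (1 - 8 / 2 ^ k))"
    by simp
  also have "real r ^ h * real r ^ (h - 1) = real r ^ (k - 1)"
  proof -
    have "h + (h - 1) = k - 1" using h k(1) by simp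
    thus ?thesis by (simp only: power_add[symmetric])
  qed
  also have "a 0 * ((2 * pi) ^ k * real r ^ (k - 1) / fact (k - 1) * (1 - 8 / 2 ^ k)) \<le> a 0 * e r"
    unfolding e_def by (intro mult_left_mono eisenstein_coeff_ge k a0)
  finally show False by simp
qed

section \<open>Numerical estimates\<close>

lemma e_gt_2718: "2718 / 1000 < exp (1 :: real)"
  using e_approx_32 by (simp add: abs_if split: if_split_asm)

text \<open>By 2.718 < e < 2.72, bounds on logarithms of numbers become comparisons of rational
  powers that can be evaluated; \<open>ratio_le_ln\<close> is the counterpart from below.\<close>

lemma ln_le_ratio:
  fixes a :: real
  assumes "a > 0" "q > 0" "a ^ q \<le> (2718 / 1000) ^ p"
  shows "ln a \<le> real p / real q"
proof -
  have "a ^ q \<le> exp 1 ^ p"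
    using assms(3) e_gt_2718 by (intro order_trans[OF assms(3)] power_mono) auto
  also have "exp 1 ^ p = exp (real p)" by (simp flip: exp_of_nat_mult)
  finally have "ln (a ^ q) \<le> ln (exp (real p))" using assms(1) by (intro ln_mono) auto
  hence "real q * ln a \<le> real p" using assms(1) by (simp add: ln_realpow)
  thus ?thesis using assms(2) by (simp add: field_simps)
qed

lemma ratio_le_ln:
  fixes a :: real
  assumes "a > 0" "q > 0" "(272 / 100) ^ p \<le> a ^ q"
  shows "real p / real q \<le> ln a"
proof -
  have "exp (real p) = exp 1 ^ p" by (simp flip: exp_of_nat_mult)
  also have "\<dots> \<le> (272 / 100) ^ p" using e_less_272 by (intro power_mono) auto
  also note assms(3)
  finally have "ln (exp (real p)) \<le> ln (a ^ q)" by (intro ln_mono) auto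
  hence "real p \<le> real q * ln a" using assms(1) by (simp add: ln_realpow)
  thus ?thesis using assms(2) by (simp add: field_simps)
qed

lemma ln_le_tangent:
  fixes u t :: real
  assumes "u > 0" "t > 0"
  shows "ln u \<le> u / t + ln t - 1"
proof -
  have "ln (u / t) \<le> u / t - 1" using assms by (intro ln_le_minus_one) auto
  thus ?thesis using assms by (simp add: ln_div)
qed

text \<open>Two terms of the series of -ln(1 - x); the difference has derivative x^2 / (1 - x). The
  quadratic term supplies the constant 9/8 in \<open>large_bound\<close>.\<close>

lemma ln_one_minus_le:
  fixes x :: real
  assumes "0 \<le> x" "x < 1"
  shows "x + x\<^sup>2 / 2 \<le> - ln (1 - x)"
proof -
  have "- ln (1 - 0) - 0 - 0\<^sup>2 / 2 \<le> - ln (1 - x) - x - x\<^sup>2 / 2"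
  proof (rule DERIV_nonneg_imp_nondecreasing[OF assms(1)])
    fix t assume t: "0 \<le> t" "t \<le> x"
    have d1: "((\<lambda>x. ln (1 - x)) has_real_derivative (1 / (1 - t) * (0 - 1))) (at t)"
    proof (rule DERIV_chain2[OF DERIV_ln_divide])
      show "0 < 1 - t" using t assms by simp
      show "((\<lambda>x. 1 - x) has_real_derivative (0 - 1)) (at t)"
        by (intro DERIV_diff DERIV_const DERIV_ident)
    qed
    have d2: "((\<lambda>x. x\<^sup>2 / 2) has_real_derivative t) (at t)"
      by (auto intro!: derivative_eq_intros)
    have "((\<lambda>x. - ln (1 - x) - x - x\<^sup>2 / 2) has_real_derivative (1 / (1 - t) - 1 - t)) (at t)"
      by (rule DERIV_cong[OF DERIV_diff[OF DERIV_diff[OF DERIV_minus[OF d1] DERIV_ident] d2]]) simp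
    moreover have "1 / (1 - t) - 1 - t = t\<^sup>2 / (1 - t)"
      using t assms by (simp add: field_simps power2_eq_square)
    moreover have "0 \<le> t\<^sup>2 / (1 - t)" using t assms by simp
    ultimately show "\<exists>y. ((\<lambda>x. - ln (1 - x) - x - x\<^sup>2 / 2) has_real_derivative y) (at t) \<and> 0 \<le> y"
      by (intro exI[of _ "1 / (1 - t) - 1 - t"] conjI) (simp_all only:)
  qed
  thus ?thesis by simp
qed

text \<open>The induction step is (1 - 1/(n+2))^(n+2) <= 1/e. With n = k - 1 this reads (k-1)! <= e
  (k/e)^k, whose exponent k matches the other factors in \<open>large_bound\<close>.\<close>

lemma fact_le_exp_power: "fact n \<le> exp 1 * (real (Suc n) / exp 1) ^ Suc n"
proof (induction n)
  case (Suc n)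
  have "1 - 1 / (real n + 2) \<le> exp (- (1 / (real n + 2)))"
    using exp_ge_add_one_self[of "- (1 / (real n + 2))"] by simp
  hence "((real n + 1) / (real n + 2)) ^ (n + 2) \<le> exp (- (1 / (real n + 2))) ^ (n + 2)"
    by (intro power_mono) (auto simp: field_simps)
  also have "\<dots> = exp (real (n + 2) * - (1 / (real n + 2)))" by (rule exp_of_nat_mult[symmetric])
  also have "real (n + 2) * - (1 / (real n + 2)) = - 1" by (simp add: field_simps)
  finally have "(real n + 1) ^ (n + 2) * exp 1 \<le> (real n + 2) ^ (n + 2)"
    by (simp add: power_divide exp_minus field_simps del: power_Suc)
  hence "(real n + 1) ^ (n + 2) * exp 1 / exp 1 ^ (n + 2) \<le> (real n + 2) ^ (n + 2) / exp 1 ^ (n + 2)"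
    by (rule divide_right_mono) simp
  moreover have "(real n + 1) ^ (n + 2) * exp 1 / exp 1 ^ (n + 2) = (real n + 1) * (real (Suc n) / exp 1) ^ Suc n"
    by (simp add: power_divide add.commute)
  moreover have "(real n + 2) ^ (n + 2) / exp 1 ^ (n + 2) = (real (Suc (Suc n)) / exp 1) ^ Suc (Suc n)"
    by (simp only: power_divide[symmetric]) (simp add: add.commute)
  ultimately have 1: "(real n + 1) * (real (Suc n) / exp 1) ^ Suc n \<le> (real (Suc (Suc n)) / exp 1) ^ Suc (Suc n)"
    by simp
  have "fact (Suc n) \<le> (real n + 1) * (exp 1 * (real (Suc n) / exp 1) ^ Suc n)"
    using mult_left_mono[OF Suc.IH, of "real n + 1"] by (simp add: add.commute)
  also have "\<dots> = exp 1 * ((real n + 1) * (real (Suc n) / exp 1) ^ Suc n)" by simp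
  also have "\<dots> \<le> exp 1 * (real (Suc (Suc n)) / exp 1) ^ Suc (Suc n)" by (intro mult_left_mono 1) simp
  finally show ?case .
qed simp

section \<open>Choice of Y and the numerical inequalities for k >= 12\<close>

locale weight_estimates =
  fixes k h :: nat
  assumes k: "k \<ge> 12" "k = 2 * h"
begin

definition "K = real k"
definition "L = ln K + ln (ln K)"
text \<open>The shift is limited by positivity of the weights: the base in \<open>defect_le\<close>
  tends to e^(3/2) / (2 pi), so for large k any shift below log(2 pi) would do. It multiplies Y^k by
  (v / L)^k, a saving on which \<open>large_bound\<close> relies.\<close>

definition "v = L - 3 / 2"
definition "Y = K * v / (2 * pi)"
definition "B = 1 / 7316 * K ^ 4 * L\<^sup>2"

lemma K: "K \<ge> 12" and K_pos: "K > 0"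
  using k(1) by (simp_all add: K_def)

lemma two_h: "2 * real h = K"
  unfolding K_def using k(2) by simp

lemma ln_K_ge: "ln K \<ge> 12 / 5"
proof -
  have "real 12 / real 5 \<le> ln (12 :: real)" by (rule ratio_le_ln) (simp_all add: power_numeral_reduce)
  also have "\<dots> \<le> ln K" using K by simp
  finally show ?thesis by simp
qed

lemma ln_K_pos: "ln K > 0"
  using ln_K_ge by linarith

lemma L_ge: "L \<ge> 49 / 15"
proof -
  have "real 13 / real 15 \<le> ln (12 / 5 :: real)" by (rule ratio_le_ln) (simp_all add: power_numeral_reduce)
  also have "\<dots> \<le> ln (ln K)" using ln_K_ge by simp
  finally show ?thesis using ln_K_ge by (simp add: L_def)
qed

lemma v_ge: "v \<ge> 53 / 30"
  using L_ge by (simp add: v_def)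

lemma ln_12_le: "ln (12 :: real) \<le> 5 / 2"
  using ln_le_ratio[of 12 2 5] by (simp add: power_numeral_reduce)

lemma ln_K_le: "ln K \<le> K / 12 + 3 / 2"
  using ln_le_tangent[of K 12] K_pos ln_12_le by simp

lemma Kv_ge: "106 / 5 \<le> K * v"
  using mult_mono[of 12 K "53 / 30" v] K v_ge by simp

lemma Kv_pos: "K * v > 0"
  using Kv_ge by linarith

lemma Y_ge: "Y \<ge> 2"
proof -
  have "2 * (2 * pi) \<le> K * v" using Kv_ge pi_less_4 by linarith
  thus ?thesis by (simp add: Y_def field_simps)
qed

lemma two_pi_Y: "2 * pi * Y = K * v"
  by (simp add: Y_def)

lemma two_pi_div_Y: "2 * pi / Y = 4 * pi\<^sup>2 / (K * v)"
  by (simp add: Y_def power2_eq_square)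

lemma exp_two_pi_div_Y: "exp (2 * pi / Y) \<le> 33 / 5"
proof -
  have "pi\<^sup>2 \<le> (31416 / 10000)\<^sup>2" using pi_approx by (intro power_mono) auto
  hence "4 * pi\<^sup>2 \<le> 15 / 8 * (106 / 5)" by (simp add: power2_eq_square)
  also have "\<dots> \<le> 15 / 8 * (K * v)" using Kv_ge by simp
  finally have "2 * pi / Y \<le> 15 / 8" unfolding two_pi_div_Y using Kv_pos by (simp add: field_simps)
  also have "\<dots> \<le> ln (33 / 5)"
    using ratio_le_ln[of "33 / 5" 8 15] by (simp add: power_numeral_reduce)
  finally show ?thesis by (metis exp_le_cancel_iff exp_ln zero_less_divide_iff zero_less_numeral)
qed

text \<open>Since 2 pi Y = K v and e^(-v) = e^(3/2) / (K ln K), the left side is (v e^(3/2) / (2 pi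
  ln K))^k e^(2 pi / Y). The base is at most 78/100, which already suffices at the twelfth
  power.\<close>

lemma defect_le: "Y ^ k * exp (- 2 * pi * (Y - 1 / Y)) \<le> 34 / 100"
proof -
  \<comment> \<open>The tangent at 12 has intercept ln 12 - 1 <= 3/2, which cancels against the
    shift in \<open>v\<close>.\<close>
  have "v \<le> 13 / 12 * ln K"
    using ln_le_tangent[of "ln K" 12] ln_K_pos ln_12_le by (simp add: v_def L_def)
  moreover have "exp (3 / 2 :: real) \<le> 9 / 2"
  proof -
    have "3 / 2 \<le> ln (9 / 2 :: real)" using ratio_le_ln[of "9 / 2" 2 3] by (simp add: power_numeral_reduce)
    thus ?thesis by (metis exp_le_cancel_iff exp_ln zero_less_divide_iff zero_less_numeral)
  qed
  ultimately have "v * exp (3 / 2) \<le> (13 / 12 * ln K) * (9 / 2)"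
    using ln_K_pos by (intro mult_mono) auto
  also have "\<dots> = (39 / 8) * ln K" by simp
  also have "\<dots> \<le> (78 / 100 * (2 * pi)) * ln K"
    using pi_approx ln_K_pos by (intro mult_right_mono) auto
  finally have b: "v * exp (3 / 2) / (2 * pi * ln K) \<le> 78 / 100"
    using ln_K_pos by (simp add: field_simps)
  have "exp (- v) = exp (3 / 2) / (K * ln K)"
  proof -
    have "- v = 3 / 2 - (ln K + ln (ln K))" by (simp add: v_def L_def)
    thus ?thesis using K_pos ln_K_pos by (simp only: exp_diff exp_add exp_ln)
  qed
  hence Yv: "Y * exp (- v) = v * exp (3 / 2) / (2 * pi * ln K)"
    using K_pos ln_K_pos by (simp add: Y_def)
  have v0: "v > 0" using v_ge by linarith
  have "- 2 * pi * (Y - 1 / Y) = - (2 * pi * Y) + 2 * pi / Y" by (simp add: algebra_simps)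
  also have "\<dots> = real k * (- v) + 2 * pi / Y" unfolding two_pi_Y by (simp add: K_def)
  finally have "Y ^ k * exp (- 2 * pi * (Y - 1 / Y)) = (Y * exp (- v)) ^ k * exp (2 * pi / Y)"
    by (simp only: exp_add exp_of_nat_mult power_mult_distrib mult.assoc)
  also have "\<dots> \<le> (78 / 100) ^ k * (33 / 5)"
    unfolding Yv by (intro mult_mono power_mono b exp_two_pi_div_Y) (use v0 ln_K_pos in auto)
  also have "\<dots> \<le> (78 / 100) ^ 12 * (33 / 5)"
    by (intro mult_right_mono power_decreasing) (use k in auto)
  also have "\<dots> \<le> 34 / 100" by (simp add: power_numeral_reduce)
  finally show ?thesis .
qed

definition "D = exp (2 * pi / Y) / (1 - 34 / 100)"

lemma D_le: "D \<le> 10" and D_pos: "D > 0"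
  using exp_two_pi_div_Y by (simp_all add: D_def)

lemma sqrt_K_sq: "(sqrt K)\<^sup>2 = K"
  using K_pos by simp

lemma sqrt_K_ge: "sqrt K \<ge> 346 / 100"
  by (rule real_le_rsqrt) (use K in \<open>simp add: power2_eq_square\<close>)

lemma ln_K_sqrt: "ln K = 2 * ln (sqrt K)"
  using K_pos by (simp add: ln_sqrt)

lemma ln_sqrt_K_le: "ln (sqrt K) \<le> sqrt K * (2 / 7) + 3 / 11"
proof -
  have "ln (7 / 2 :: real) \<le> 14 / 11" using ln_le_ratio[of "7 / 2" 11 14] by (simp add: power_numeral_reduce)
  thus ?thesis using ln_le_tangent[of "sqrt K" "7 / 2"] sqrt_K_ge K_pos by simp
qed

text \<open>With sqrt K in place of L the final estimate becomes quadratic in sqrt K. At K = 12 the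
  two sides are about 3.40 and 3.46, hence the tangent points 7/2 near sqrt 12 (in
  \<open>ln_sqrt_K_le\<close>) and 5/2 near ln 12.\<close>

lemma L_le_sqrt: "L \<le> sqrt K"
proof -
  define l where "l = ln (sqrt K)"
  have l: "l \<le> sqrt K * (2 / 7) + 3 / 11" unfolding l_def by (rule ln_sqrt_K_le)
  have "ln (5 / 2 :: real) \<le> 12 / 13" using ln_le_ratio[of "5 / 2" 13 12] by (simp add: power_numeral_reduce)
  moreover have "ln (ln K) \<le> ln K / (5 / 2) + ln (5 / 2) - 1"
    by (rule ln_le_tangent) (use ln_K_pos in auto)
  moreover have "ln K = 2 * l" using ln_K_sqrt by (simp add: l_def)
  ultimately have "L \<le> 14 / 5 * l - 1 / 13" by (simp add: L_def)
  also have "\<dots> \<le> sqrt K" using l sqrt_K_ge by simp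
  finally show ?thesis .
qed

lemma B_ge: "K ^ 4 / 690 \<le> B"
proof -
  have "(49 / 15)\<^sup>2 \<le> L\<^sup>2" using L_ge by (intro power_mono) auto
  hence "7316 / 690 \<le> L\<^sup>2" by (simp add: power2_eq_square)
  hence "K ^ 4 * (7316 / 690) \<le> K ^ 4 * L\<^sup>2" using K_pos by (intro mult_left_mono) auto
  thus ?thesis by (simp add: B_def)
qed

text \<open>With D <= 10 and 10 * 40 <= e^6, it is enough in logarithms that (h + 2) ln x + 6 <= 4
  pi^2 x / (K v) for x = n. The tangent to the logarithm at t = K^4 / 690, a lower bound for x,
  makes the left side linear in x.\<close>

lemma tail_bound:
  assumes n: "real n \<ge> B"
  shows "D * real n ^ h * exp (- 2 * pi * real n / Y) \<le> 1 / (40 * (real n)\<^sup>2)"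
proof -
  define x where "x = real n"
  define t where "t = K ^ 4 / 690"
  have t: "t > 0" using K_pos by (simp add: t_def)
  have xt: "t \<le> x" using n B_ge by (simp add: t_def x_def)
  have x: "x > 0" using xt t by linarith
  have "ln (690 :: real) \<ge> 6" using ratio_le_ln[of 690 1 6] by (simp add: power_numeral_reduce)
  hence "ln t \<le> K / 3"
    using ln_K_le K_pos by (simp add: t_def ln_div ln_realpow)
  hence lnx: "ln x \<le> x / t + K / 3" using ln_le_tangent[OF x t] by linarith
  have vK: "v \<le> K / 6"
  proof -
    have "0 \<le> (sqrt K - 3)\<^sup>2" by simp
    hence "sqrt K \<le> K / 6 + 3 / 2" using sqrt_K_sq by (simp add: power2_diff)
    thus ?thesis using L_le_sqrt by (simp add: v_def)
  qed
  have v0: "v > 0" using v_ge by linarith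
  have lnx_tail: "0 \<le> x / t + K / 3" using x t K_pos by simp
  have e1: "(real h + 2) * ln x + 6 \<le> (2 / 3 * K) * (x / t + K / 3) + 6"
  proof -
    have "(real h + 2) * ln x \<le> (real h + 2) * (x / t + K / 3)" using lnx by (intro mult_left_mono) auto
    also have "\<dots> \<le> (2 / 3 * K) * (x / t + K / 3)"
    proof (rule mult_right_mono[OF _ lnx_tail])
      show "real h + 2 \<le> 2 / 3 * K" using K two_h by linarith
    qed
    finally show ?thesis by simp
  qed
  have "K * v * ((real h + 2) * ln x + 6) \<le> K * v * ((2 / 3 * K) * (x / t + K / 3) + 6)"
    using Kv_pos by (intro mult_left_mono e1) auto
  also have "\<dots> \<le> K * (K / 6) * ((2 / 3 * K) * (x / t + K / 3) + 6)"
    using K_pos lnx_tail by (intro mult_right_mono mult_left_mono vK) auto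
  also have "\<dots> = K ^ 3 / (9 * t) * x + K ^ 4 / 27 + K\<^sup>2"
    using t by (simp add: field_simps power_numeral_reduce)
  also have "K ^ 3 / (9 * t) = 690 / (9 * K)"
    using K_pos by (simp add: t_def field_simps power_numeral_reduce)
  also have "K ^ 4 / 27 = 690 / 27 * t" by (simp add: t_def)
  \<comment> \<open>By K >= 12 and t <= x everything becomes a multiple of x; the three coefficients
    add up to less than 37, against 4 pi^2 > 39.\<close>
  also have "690 / (9 * K) * x + 690 / 27 * t + K\<^sup>2 \<le> 690 / 108 * x + 690 / 27 * x + 690 / 144 * x"
  proof (intro add_mono mult_right_mono mult_left_mono)
    show "690 / (9 * K) \<le> 690 / 108" using K by (simp add: field_simps)
    have "144 * K\<^sup>2 \<le> K\<^sup>2 * K\<^sup>2"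
      using K by (intro mult_right_mono) (auto simp: power2_eq_square intro!: mult_mono[of 12 K 12 K, simplified])
    hence "K\<^sup>2 \<le> 690 / 144 * t" by (simp add: t_def power_numeral_reduce power2_eq_square mult.assoc)
    also have "\<dots> \<le> 690 / 144 * x" using xt by simp
    finally show "K\<^sup>2 \<le> 690 / 144 * x" .
  qed (use x xt in auto)
  also have "\<dots> \<le> 4 * pi\<^sup>2 * x"
  proof -
    have "(314 / 100)\<^sup>2 \<le> pi\<^sup>2" using pi_approx by (intro power_mono) auto
    hence "39 * x \<le> 4 * pi\<^sup>2 * x" using x by (intro mult_right_mono) (auto simp: power2_eq_square)
    thus ?thesis using x by simp
  qed
  finally have "(real h + 2) * ln x + 6 \<le> 2 * pi / Y * x"
    unfolding two_pi_div_Y using Kv_pos by (simp add: field_simps)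
  hence "exp (real (h + 2) * ln x + real 6 * 1) \<le> exp (2 * pi / Y * x)" by (simp add: add.commute)
  hence "x ^ (h + 2) * exp 1 ^ 6 \<le> exp (2 * pi / Y * x)"
    unfolding exp_add exp_of_nat_mult using x by simp
  moreover have "400 \<le> exp (1 :: real) ^ 6"
  proof -
    have "(400 :: real) \<le> (2718 / 1000) ^ 6" by (simp add: power_numeral_reduce)
    also have "\<dots> \<le> exp 1 ^ 6" using e_gt_2718 by (intro power_mono) auto
    finally show ?thesis .
  qed
  hence "x ^ (h + 2) * 400 \<le> x ^ (h + 2) * exp 1 ^ 6" using x by (intro mult_left_mono) auto
  ultimately have "x ^ (h + 2) * 400 \<le> exp (2 * pi / Y * x)" by linarith
  hence "400 * (x ^ h * x\<^sup>2) * exp (- (2 * pi / Y * x)) \<le> 1"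
    by (simp add: exp_minus field_simps power_add power2_eq_square)
  hence "10 * x ^ h * exp (- (2 * pi / Y * x)) \<le> 1 / (40 * x\<^sup>2)" using x by (simp add: field_simps)
  moreover have "D * x ^ h * exp (- (2 * pi / Y * x)) \<le> 10 * x ^ h * exp (- (2 * pi / Y * x))"
    using x D_le by (intro mult_right_mono) auto
  ultimately show ?thesis by (simp add: x_def)
qed

text \<open>After cancelling (2 pi)^k and using (k-1)! <= e (k/e)^k, what remains is (223/10) (K v /
  (4 pi^2))^k e (K/e)^k <= B^(h-1), proved in logarithms as \<open>main\<close>. The constant is
  (20/9) * 10, from D <= 10, rounded up to absorb the factor 1 - 8 / 2^k >= 511/512.\<close>

lemma large_bound:
  assumes r: "real r \<ge> B"
  shows "(20 / 9) * D * Y ^ k \<le> (2 * pi) ^ k * real r ^ (h - 1) / fact (k - 1) * (1 - 8 / 2 ^ k)"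
proof -
  define s where "s = sqrt K"
  have s: "s \<ge> 346 / 100" "s\<^sup>2 = K" "L \<le> s" unfolding s_def using sqrt_K_ge sqrt_K_sq L_le_sqrt by auto
  have v0: "v > 0" using v_ge by linarith
  have L0: "L > 0" using L_ge by linarith
  have B0: "B > 0" using B_ge K_pos by (smt (verit) divide_pos_pos zero_less_power)
  have f: "fact (k - 1) \<le> exp 1 * (K / exp 1) ^ k"
  proof -
    have "Suc (k - 1) = k" using k(1) by simp
    thus ?thesis using fact_le_exp_power[of "k - 1"] by (simp only: K_def)
  qed
  have c223: "ln (223 / 10 :: real) \<le> 16 / 5" using ln_le_ratio[of "223 / 10" 5 16] by (simp add: power_numeral_reduce)
  have c7316: "ln (7316 :: real) \<ge> 35 / 4" using ratio_le_ln[of 7316 4 35] by (simp add: power_numeral_reduce)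
  \<comment> \<open>Together with the 1 from (K/e)^k this makes 4 pi^2 e exceed sqrt 7316 by a
    factor e^(22/100), a gain of 22/100 for each unit of K. The decimals satisfy 85.54^2 >= 7316 and
    39.43 * 2.175 >= 85.54.\<close>
  have c1: "ln (4 * pi\<^sup>2) \<ge> ln 7316 / 2 - 78 / 100"
  proof -
    have p: "3943 / 100 \<le> 4 * pi\<^sup>2"
    proof -
      have "(31415 / 10000)\<^sup>2 \<le> pi\<^sup>2" using pi_approx by (intro power_mono) auto
      thus ?thesis by (simp add: power2_eq_square)
    qed
    have "ln (7316 :: real) \<le> ln ((8554 / 100) ^ 2)" by (intro ln_mono) (simp_all add: power2_eq_square)
    also have "\<dots> = 2 * ln (8554 / 100)" by (simp add: ln_realpow)
    also have "ln (8554 / 100 :: real) \<le> ln (3943 / 100 * (2175 / 1000))" by (intro ln_mono) simp_all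
    also have "\<dots> = ln (3943 / 100) + ln (2175 / 1000)" by (rule ln_mult_pos) simp_all
    also have "ln (2175 / 1000 :: real) \<le> 7 / 9" using ln_le_ratio[of "2175 / 1000" 9 7] by (simp add: power_numeral_reduce)
    also have "ln (3943 / 100) \<le> ln (4 * pi\<^sup>2)" using p by (intro ln_mono) auto
    finally show ?thesis by simp
  qed
  \<comment> \<open>The gain from the shift: v / L = 1 - 3 / (2 L), and L <= s turns the bound into
    one in s alone.\<close>
  have c2: "ln L - ln v \<ge> (3 / 2) / s + (9 / 8) / K"
  proof -
    define x where "x = (3 / 2) / L"
    have x: "0 \<le> x" "x < 1" using L_ge by (auto simp: x_def)
    have "1 - x = v / L" using L0 by (simp add: x_def v_def field_simps)
    hence "- ln (1 - x) = ln L - ln v" using L0 v0 by (simp add: ln_div)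
    moreover have xs: "(3 / 2) / s \<le> x" unfolding x_def using s L0 by (intro divide_left_mono) auto
    moreover have "((3 / 2) / s)\<^sup>2 \<le> x\<^sup>2" using xs s by (intro power_mono) auto
    moreover have "((3 / 2) / s)\<^sup>2 = (9 / 4) / K" using s by (simp add: power_divide power2_eq_square)
    ultimately show ?thesis using ln_one_minus_le[OF x] by simp
  qed
  have c3: "K * ((3 / 2) / s + (9 / 8) / K) = 3 / 2 * s + 9 / 8"
    using s K_pos by (simp add: distrib_left s(2)[symmetric] power2_eq_square)
  have c4: "ln K \<le> 4 / 7 * s + 6 / 11" unfolding s_def using ln_sqrt_K_le ln_K_sqrt by simp
  have c5: "2 * ln L \<le> ln K"
  proof -
    have "ln L \<le> ln s" using s L0 by simp
    thus ?thesis unfolding ln_K_sqrt s_def by simp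
  qed
  \<comment> \<open>What \<open>main\<close> comes to: the exponent h - 1 loses one ln B, at most 5
    ln K - ln 7316 by c5. Inserting c4, the coefficient of s is 5 * 4/7 - 3/2 = 19/14 after the gain
    from the shift; then complete the square.\<close>
  have quad: "0 \<le> 22 / 100 * K - 19 / 14 * s + 147 / 50"
  proof -
    have "0 \<le> 22 / 100 * (s - 475 / 154)\<^sup>2" by simp
    also have "\<dots> = 22 / 100 * s\<^sup>2 - 19 / 14 * s + 22 / 100 * (475 / 154)\<^sup>2"
      by (simp add: power2_eq_square algebra_simps)
    finally show ?thesis unfolding s(2) by (simp add: power2_eq_square)
  qed
  have main: "ln (223 / 10) + K * (ln K + ln v - ln (4 * pi\<^sup>2)) + (1 + K * (ln K - 1)) \<le>
      (K / 2 - 1) * (4 * ln K + 2 * ln L - ln 7316)"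
  proof -
    have "K * ((3 / 2) / s + (9 / 8) / K) \<le> K * (ln L - ln v)" using c2 K_pos by (intro mult_left_mono) auto
    hence 1: "3 / 2 * s + 9 / 8 \<le> K * (ln L - ln v)" unfolding c3 .
    have 2: "K * (22 / 100) \<le> K * (ln (4 * pi\<^sup>2) + 1 - ln 7316 / 2)" using c1 K_pos by (intro mult_left_mono) auto
    have "(K / 2 - 1) * (4 * ln K + 2 * ln L - ln 7316) -
       (ln (223 / 10) + K * (ln K + ln v - ln (4 * pi\<^sup>2)) + (1 + K * (ln K - 1))) =
       K * (ln L - ln v) + K * (ln (4 * pi\<^sup>2) + 1 - ln 7316 / 2) - 4 * ln K - 2 * ln L + ln 7316 - ln (223 / 10) - 1"
      by (simp add: algebra_simps)
    moreover have "0 \<le> P + Q - 4 * ln K - 2 * ln L + ln 7316 - ln (223 / 10) - 1"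
      if "3 / 2 * s + 9 / 8 \<le> P" "K * (22 / 100) \<le> Q" for P Q
      using that c223 c7316 c4 c5 quad by linarith
    note this[OF 1 2]
    ultimately show ?thesis by linarith
  qed
  have "ln B = 4 * ln K + 2 * ln L - ln 7316"
    using K_pos L0 by (simp add: B_def ln_mult ln_div ln_realpow)
  hence "223 / 10 * (K * v / (4 * pi\<^sup>2)) ^ k * (exp 1 * (K / exp 1) ^ k) \<le> B ^ (h - 1)"
  proof -
    assume lnB: "ln B = 4 * ln K + 2 * ln L - ln 7316"
    have "ln (223 / 10 * (K * v / (4 * pi\<^sup>2)) ^ k * (exp 1 * (K / exp 1) ^ k)) =
      ln (223 / 10) + real k * (ln K + ln v - ln (4 * pi\<^sup>2)) + (1 + real k * (ln K - 1))"
      using K_pos v0 by (simp add: ln_mult ln_div ln_realpow)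
    also have "\<dots> \<le> (K / 2 - 1) * ln B" using main unfolding lnB K_def .
    also have "\<dots> = ln (B ^ (h - 1))" 
    proof -
      have "h \<ge> 1" using k by simp
      hence "K / 2 - 1 = real (h - 1)" using two_h by (simp add: of_nat_diff)
      thus ?thesis using B0 by (simp only: ln_realpow)
    qed
    finally show ?thesis using B0 K_pos v0 by (subst (asm) ln_le_cancel_iff) auto
  qed
  also have "\<dots> \<le> real r ^ (h - 1)" using r B0 by (intro power_mono) auto
  finally have big: "223 / 10 * (K * v / (4 * pi\<^sup>2)) ^ k * (exp 1 * (K / exp 1) ^ k) \<le> real r ^ (h - 1)" .
  have "Y = 2 * pi * (K * v / (4 * pi\<^sup>2))" by (simp add: Y_def power2_eq_square)
  hence Yk: "Y ^ k = (2 * pi) ^ k * (K * v / (4 * pi\<^sup>2)) ^ k" by (simp only: power_mult_distrib)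
  have "8 / 2 ^ k \<le> (8 / 2 ^ 12 :: real)" using k by (intro divide_left_mono power_increasing) auto
  also have "\<dots> = 1 / 512" by simp
  finally have q: "8 / 2 ^ k \<le> (1 / 512 :: real)" .
  have "200 / 9 \<le> 223 / 10 * (1 - q)" if "q \<le> 1 / 512" for q :: real using that by simp
  moreover have "0 \<le> 1 - q" if "q \<le> 1 / 512" for q :: real using that by simp
  note pos = this[OF q]
  ultimately have small: "200 / 9 \<le> 223 / 10 * (1 - 8 / 2 ^ k :: real)" using q by blast
  have "(20 / 9) * D * Y ^ k * fact (k - 1) \<le> (20 / 9) * 10 * Y ^ k * (exp 1 * (K / exp 1) ^ k)"
    using Y_ge D_le D_pos K_pos f by (intro mult_mono) auto
  also have "\<dots> = 200 / 9 * (Y ^ k * (exp 1 * (K / exp 1) ^ k))" by simp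
  also have "\<dots> \<le> 223 / 10 * (1 - 8 / 2 ^ k) * (Y ^ k * (exp 1 * (K / exp 1) ^ k))"
    using Y_ge K_pos by (intro mult_right_mono small) auto
  also have "\<dots> = (2 * pi) ^ k * (223 / 10 * (K * v / (4 * pi\<^sup>2)) ^ k * (exp 1 * (K / exp 1) ^ k)) * (1 - 8 / 2 ^ k)"
    unfolding Yk by simp
  also have "\<dots> \<le> (2 * pi) ^ k * real r ^ (h - 1) * (1 - 8 / 2 ^ k)"
    by (intro mult_right_mono mult_left_mono big pos) auto
  finally show ?thesis by (simp add: field_simps)
qed

end

section \<open>Main result\<close>

lemma N_values_le:
  assumes wt: "k \<ge> 12" "k mod 4 = 0" and r: "r \<in> N_values k"
  shows "real r \<le> 1 / 7316 * real k ^ 4 * (ln (real k) + ln (ln (real k)))\<^sup>2"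
proof (rule ccontr)
  have "even k" using wt(2) by presburger
  then obtain h where h: "k = 2 * h" by (rule evenE)
  interpret weight_estimates k h by unfold_locales (use wt h in auto)
  assume "\<not> ?thesis"
  hence rB: "B \<le> real r" "real r > B" by (simp_all add: B_def L_def K_def)
  moreover have "B > 0" using B_ge K_pos by (smt (verit) divide_pos_pos zero_less_power)
  ultimately have r0: "r > 0" by linarith
  obtain f a where f: "modular_form k f" "has_q_expansion f a" and a: "\<And>n. a n \<in> \<real>"
    "Re (a r) < 0" "\<And>m. m < r \<Longrightarrow> Re (a m) \<ge> 0"
    using r unfolding N_values_def by blast
  have "(\<lambda>n. of_real (Re (a n))) = a" using a(1) by auto
  hence q: "has_q_expansion f (\<lambda>n. of_real (Re (a n)))" using f(2) by simp
  show False
  proof (rule first_negative_coeff_contradiction[OF h wt(2) _ f(1) q r0 a(2,3) Y_ge defect_le _ D_def])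
    fix n assume "r \<le> n"
    hence "B \<le> real n" using rB by linarith
    thus "D * real n ^ h * exp (- 2 * pi * real n / Y) \<le> 1 / (40 * (real n)\<^sup>2)" by (rule tail_bound)
  qed (use wt large_bound[OF rB(1)] in auto)
qed

lemma N_values_exceeding:
  assumes wt: "k \<ge> 12" "k mod 4 = 0"
  obtains r where "r \<in> N_values k" "(real k - 1)\<^sup>2 / (16 * pi\<^sup>2) < real r"
proof -
  have "even k" using wt(2) by presburger
  then obtain h where h: "k = 2 * h" by (rule evenE)
  \<comment> \<open>The Y of the upper bound serves here too: only the positivity of its weights is
    needed.\<close>
  interpret weight_estimates k h by unfold_locales (use wt h in auto)
  have k4: "k \<ge> 4" and ev: "even k" using wt h by auto
  define b where "b = (\<lambda>n. Re (poincare_coeff k 1 n))"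
  obtain g where g: "modular_form k g" "has_q_expansion g (\<lambda>n. of_real (b n))"
    using modular_form_real_part[OF poincare_modular_form(2,1)[OF k4 wt(2)] ev] unfolding b_def by blast
  have b0: "b 0 = 0" using wt by (simp add: b_def poincare_coeff_0)
  have "\<exists>n. b n < 0"
  proof (rule ccontr)
    assume "\<not> (\<exists>n. b n < 0)"
    hence nn: "b n \<ge> 0" for n by (simp add: not_less)
    have "Y \<ge> 1" using Y_ge by linarith
    moreover have "Y ^ k * exp (- 2 * pi * (Y - 1 / Y)) < 1" using defect_le by linarith
    ultimately have "b 1 = 0" by (rule cusp_form_nonneg_imp_zero[OF g wt(2) b0 nn])
    thus False using poincare_coeff_one_pos[OF wt] by (simp add: b_def)
  qed
  then obtain r where r: "b r < 0" "\<And>m. m < r \<Longrightarrow> \<not> b m < 0"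
    using exists_least_iff[of "\<lambda>n. b n < 0"] by blast
  have "r \<in> N_values k"
    unfolding N_values_def using g r by (intro CollectI exI[of _ g] exI[of _ "\<lambda>n. of_real (b n)"]) (auto simp: not_less)
  moreover have "(real k - 1)\<^sup>2 / (16 * pi\<^sup>2) < real r"
  proof (rule ccontr)
    assume "\<not> ?thesis"
    hence "16 * pi\<^sup>2 * real r \<le> (real k - 1)\<^sup>2" by (simp add: field_simps)
    moreover have "r > 0" using r(1) b0 by (cases "r = 0") auto
    ultimately show False using poincare_coeff_pos[OF wt(1), of r] r(1) by (simp add: b_def)
  qed
  ultimately show ?thesis by (rule that)
qed

theorem theorem1:
  fixes k :: nat
  assumes "k \<ge> 12" and "k mod 4 = 0"
  shows "finite (N_values k) \<and> N_values k \<noteq> {} \<and>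
         (real k - 1)^2 / (16 * pi^2) < real (A k) \<and>
         real (A k) \<le> (1 / 7316) * real k ^ 4 * (ln (real k) + ln (ln (real k)))^2"
proof -
  define X where "X = 1 / 7316 * real k ^ 4 * (ln (real k) + ln (ln (real k)))\<^sup>2"
  have "N_values k \<subseteq> {..nat \<lfloor>X\<rfloor>}"
    using N_values_le[OF assms] by (auto simp: X_def le_nat_floor)
  hence fin: "finite (N_values k)" by (rule finite_subset) simp
  obtain r where r: "r \<in> N_values k" "(real k - 1)\<^sup>2 / (16 * pi\<^sup>2) < real r"
    by (rule N_values_exceeding[OF assms])
  have "r \<le> A k" unfolding A_def by (rule Max_ge[OF fin r(1)])
  moreover have "A k \<in> N_values k" unfolding A_def by (rule Max_in[OF fin]) (use r in auto)
  hence "real (A k) \<le> (1 / 7316) * real k ^ 4 * (ln (real k) + ln (ln (real k)))^2"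
    by (rule N_values_le[OF assms])
  ultimately show ?thesis using fin r by auto
qed

end
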